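(* Let $L(s)=\sum_{n\ge1}a(n)n^{-s}$ be a good Dirichlet series (in the sense defined in the context), with associated sequence $\gamma(n)$. Then for each fixed integer $d\ge 1$, the Jensen polynomial $J^{d,n}_{\gamma}(X)$ is hyperbolic for all but at most finitely many $n$.
   Context: Notation: $\Gamma_{\mathbb{R}}(s)=\pi^{-s/2}\Gamma(s/2)$ and $\Gamma_{\mathbb{C}}(s)=2(2\pi)^{-s}\Gamma(s)$. A Dirichlet series $L(s)=\sum_{n\ge1}a(n)n^{-s}$ is called good if: (1) there are $N>0$ and nonnegative integers $J,M$ such that the completed function $\Lambda(s)=N^{s/2}\prod_{j=1}^{J}\Gamma_{\mathbb{R}}(s)\prod_{m=1}^{M}\Gamma_{\mathbb{C}}(s)\,L(s)$ has an integral representation $\Lambda(s)=N^{s/2}\int_0^\infty [f(t)-f(\infty)]\,t^{s}\,\frac{dt}{t}$, where $f(t)=\alpha(0)+\sum_{n\ge n_0}\alpha(n)e^{-\pi n t}$ for some positive integer $n_0$, and $f(\infty)=\alpha(0)$; (2) $f$ satisfies $f\left(\frac{1}{Nt}\right)=\epsilon N^{k/2}t^{k}f(t)$ for some $\epsilon\in\{\pm1\}$ and some $k\in\mathbb{Q}$, which gives an analytic continuation and the functional equation $\Lambda(s)=\epsilon\Lambda(k-s)$; (3) the coefficients of $\Lambda(s)$ are real. For a good $L(s)$ define $\Xi(z)=\left(-z^2-\frac{k^2}{4}\right)\Lambda\left(\frac{k}{2}-iz\right)$ if $\Lambda(s)$ has a pole at $s=k$, and $\Xi(z)=\Lambda\left(\frac{k}{2}-iz\right)$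 otherwise. If $\epsilon=1$, define $\gamma(n)$ by $\Xi(i\sqrt{x})=\sum_{n\ge0}\frac{\gamma(n)}{n!}x^n$, i.e. $\gamma(n)=(-1)^n\frac{n!}{(2n)!}\Xi^{(2n)}(0)$. If $\epsilon=-1$, define $\gamma(n)$ by $\frac{\Xi(i\sqrt{x})}{\sqrt{x}}=\sum_{n\ge0}\frac{\gamma(n)}{n!}x^n$, i.e. $\gamma(n)=i^{2n+1}\frac{n!}{(2n+1)!}\Xi^{(2n+1)}(0)$. For a sequence $a:\mathbb{N}\to\mathbb{R}$ and positive integers $d,n$, the Jensen polynomial of degree $d$ and shift $n$ is $J^{d,n}_a(X)=\sum_{j=0}^{d}\binom{d}{j}a(n+j)X^j$. A real polynomial is hyperbolic if all of its roots are real. *)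

theory Defs
  imports "HOL-Complex_Analysis.Complex_Analysis"
begin

definition Gamma_R :: "complex \<Rightarrow> complex" where
  "Gamma_R s = of_real pi powr (- s / 2) * Gamma (s / 2)"

definition Gamma_C :: "complex \<Rightarrow> complex" where
  "Gamma_C s = 2 * (2 * of_real pi) powr (- s) * Gamma s"

text \<open>Coefficients are indexed from 1; the value \<open>a 0\<close> plays no role.\<close>

definition dirichlet_term :: "(nat \<Rightarrow> complex) \<Rightarrow> complex \<Rightarrow> nat \<Rightarrow> complex" where
  "dirichlet_term a s n = a (Suc n) * of_nat (Suc n) powr (- s)"

definition dirichlet_series :: "(nat \<Rightarrow> complex) \<Rightarrow> complex \<Rightarrow> complex" where
  "dirichlet_series a s = (\<Sum>n. dirichlet_term a s n)"

definition completed_series ::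
    "real \<Rightarrow> nat \<Rightarrow> nat \<Rightarrow> (nat \<Rightarrow> complex) \<Rightarrow> complex \<Rightarrow> complex" where
  "completed_series N J M a s =
     of_real N powr (s / 2) * (\<Prod>j=1..J. Gamma_R s) * (\<Prod>m=1..M. Gamma_C s) * dirichlet_series a s"

definition exp_term :: "(nat \<Rightarrow> complex) \<Rightarrow> real \<Rightarrow> nat \<Rightarrow> complex" where
  "exp_term \<alpha> t n = \<alpha> n * of_real (exp (- pi * real n * t))"

definition exp_series :: "nat \<Rightarrow> (nat \<Rightarrow> complex) \<Rightarrow> real \<Rightarrow> complex" where
  "exp_series n\<^sub>0 \<alpha> t = \<alpha> 0 + (\<Sum>m. exp_term \<alpha> t (n\<^sub>0 + m))"

definition mellin_integrand :: "nat \<Rightarrow> (nat \<Rightarrow> complex) \<Rightarrow> complex \<Rightarrow> real \<Rightarrow> complex" where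
  "mellin_integrand n\<^sub>0 \<alpha> s t = (exp_series n\<^sub>0 \<alpha> t - \<alpha> 0) * of_real t powr s / of_real t"

text \<open>
  A good Dirichlet series together with the data witnessing that it is good. The index
  \<open>n\<^sub>0\<close> is that of the first term of \<open>f(t) - f(\<infinity>)\<close>, so its coefficient is nonzero; this
  excludes exactly the series \<open>L = 0\<close>, all of whose Jensen polynomials vanish identically.
  The coefficients of \<open>\<Lambda>(s)\<close> are read as those of the series \<open>f\<close> that represents it.
  The identity between the completed series and the Mellin integral is required on some right
  half-plane on which both sides converge.
\<close>

locale good_dirichlet_series =
  fixes a :: "nat \<Rightarrow> complex" and N :: real and J M n\<^sub>0 :: nat
    and \<alpha> :: "nat \<Rightarrow> complex" and \<epsilon> k :: real
  assumes N_pos: "N > 0"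
    and n0_pos: "n\<^sub>0 > 0"
    and leading_coeff: "\<alpha> n\<^sub>0 \<noteq> 0"
    and exp_summable: "\<And>t. t > 0 \<Longrightarrow> summable (\<lambda>m. exp_term \<alpha> t (n\<^sub>0 + m))"
    and integral_representation:
      "\<exists>\<sigma>. \<forall>s. Re s > \<sigma> \<longrightarrow>
         summable (dirichlet_term a s) \<and>
         set_integrable lborel {0<..} (mellin_integrand n\<^sub>0 \<alpha> s) \<and>
         completed_series N J M a s =
           of_real N powr (s / 2) * (LINT t:{0<..}|lborel. mellin_integrand n\<^sub>0 \<alpha> s t)"
    and sign: "\<epsilon> \<in> {1, -1}"
    and weight_rational: "k \<in> \<rat>"
    and modularity: "\<And>t. t > 0 \<Longrightarrow>
      exp_series n\<^sub>0 \<alpha> (1 / (N * t)) = of_real (\<epsilon> * N powr (k / 2) * t powr k) * exp_series n\<^sub>0 \<alpha> t"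
    and real_coeffs: "\<And>n. \<alpha> n \<in> \<real>"

text \<open>
  The meromorphic continuation of the completed series to the whole plane. A
  \<^const>\<open>nicely_meromorphic_on\<close> function is analytic off its poles and takes the value 0
  at them, so the continuation is unique as a function on \<open>\<complex>\<close>.
\<close>

definition completed_L ::
    "real \<Rightarrow> nat \<Rightarrow> nat \<Rightarrow> (nat \<Rightarrow> complex) \<Rightarrow> complex \<Rightarrow> complex" where
  "completed_L N J M a =
     (THE \<Lambda>. \<Lambda> nicely_meromorphic_on UNIV \<and>
        (\<exists>\<sigma>. \<forall>s. Re s > \<sigma> \<longrightarrow> \<Lambda> s = completed_series N J M a s))"

text \<open>
  The polynomial factor cancels the poles of \<open>\<Lambda>\<close>; \<^const>\<open>remove_sings\<close> supplies the limiting
  value at those points, which matters for the Taylor expansion at 0 when \<open>k = 0\<close>.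
\<close>

definition Xi ::
    "real \<Rightarrow> nat \<Rightarrow> nat \<Rightarrow> (nat \<Rightarrow> complex) \<Rightarrow> real \<Rightarrow> complex \<Rightarrow> complex" where
  "Xi N J M a k =
     (let \<Lambda> = completed_L N J M a in
      if is_pole \<Lambda> (of_real k)
      then remove_sings (\<lambda>z. (- z\<^sup>2 - (of_real k)\<^sup>2 / 4) * \<Lambda> (of_real k / 2 - \<i> * z))
      else (\<lambda>z. \<Lambda> (of_real k / 2 - \<i> * z)))"

text \<open>
  The Taylor coefficients below are real for a good Dirichlet series, since \<open>\<Lambda>\<close> is then real
  on the real axis; \<^const>\<open>Re\<close> only changes the type.
\<close>

definition xi_gamma ::
    "real \<Rightarrow> nat \<Rightarrow> nat \<Rightarrow> (nat \<Rightarrow> complex) \<Rightarrow> real \<Rightarrow> real \<Rightarrow> nat \<Rightarrow> real" where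
  "xi_gamma N J M a \<epsilon> k n =
     (if \<epsilon> = 1
      then Re ((-1) ^ n * (fact n / fact (2 * n)) * (deriv ^^ (2 * n)) (Xi N J M a k) 0)
      else Re (\<i> ^ (2 * n + 1) * (fact n / fact (2 * n + 1)) *
               (deriv ^^ (2 * n + 1)) (Xi N J M a k) 0))"

definition jensen_poly :: "(nat \<Rightarrow> real) \<Rightarrow> nat \<Rightarrow> nat \<Rightarrow> real poly" where
  "jensen_poly a d n = (\<Sum>j=0..d. monom (real (d choose j) * a (n + j)) j)"

definition hyperbolic :: "real poly \<Rightarrow> bool" where
  "hyperbolic p \<longleftrightarrow> (\<forall>z::complex. poly (map_poly of_real p) z = 0 \<longrightarrow> z \<in> \<real>)"

end

theory Submission
  imports Defs "HOL-Real_Asymp.Real_Asymp"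
begin

text \<open>
  Splitting the Mellin integral at the fixed point of \<open>t \<mapsto> 1 / (N t)\<close> writes \<open>\<gamma> n\<close> as
  \<open>2 n! / (2 n + e)!\<close> times a moment \<open>\<integral> \<phi> u * u ^ (2 n + e)\<close> over the half-line, or a combination of two
  such moments if \<open>\<Lambda>\<close> has a pole, where \<open>e \<in> {0, 1}\<close> and \<open>\<phi>\<close> decays like
  \<open>exp (\<kappa> u - c exp u)\<close>. Hyperbolicity is tested on the scaled differences
  \<open>n ^ (i / 2) * \<Delta> ^ i\<close> of the normalised sequence \<open>j \<mapsto> \<gamma> (n + j)\<close>. The factorials alone contribute the
  values \<open>He\<^sub>i 0\<close> of the Hermite polynomials in the limit. The measure \<open>\<phi> u * u ^ m du\<close> concentrates
  at its peak \<open>v\<close> with relative width \<open>(m v) ^ (- 1 / 2)\<close>, and since \<open>v \<rightarrow> \<infinity>\<close> this is too narrow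
  to affect these limits. Hence the rescaled Jensen polynomials converge pointwise to a Hermite polynomial,
  whose sign alternation they eventually inherit.
\<close>

subsection \<open>Scaled differences and Jensen polynomials\<close>

text \<open>Multiplying the sequence by a constant and by a geometric factor \<open>r n ^ j\<close>
  does not affect hyperbolicity, so only ratios such as \<open>F (m + 2 * j) / F m\<close> enter.
  The obstacle is that the limit of these ratios for each fixed \<open>j\<close> says too little:
  the normalised Jensen polynomial tends to \<open>(1 + X) ^ d\<close>, and its roots separate only
  at distance \<open>1 / sqrt n\<close> from -1, where its values are of size
  \<open>n ^ (- d / 2)\<close>. The i-th difference must therefore be known to precision
  \<open>n ^ (- i / 2)\<close>, for every \<open>i\<close> up to \<open>d\<close>. For the
  factorials this comes from their two-term recurrence, for the moments from the fact that a
  difference in \<open>j\<close> inserts \<open>(u / v)^2 - 1\<close> into the integrand,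
  \<open>v\<close> being the peak. The central moments that result are bounded by comparing \<phi>
  with a smooth weight and integrating that weight by parts, since \<phi> is controlled only in size
  and may change sign near 0. If \<Lambda> has a pole, the moment of lower index dominates, because
  \<open>v^2 / m\<close> tends to 0.\<close>

definition fdiff :: "(nat \<Rightarrow> real) \<Rightarrow> nat \<Rightarrow> real" where
  "fdiff A j = A (Suc j) - A j"

text \<open>If \<open>A n j\<close> is close to \<open>f (j / sqrt n)\<close> for a smooth
  \<open>f\<close>, then \<open>h i\<close> is the i-th derivative of \<open>f\<close> at 0. The
  limits 1, 0, 0, ... say that \<open>A\<close> is the constant 1 to every order at this
  scale.\<close>

definition diff_asymp :: "(nat \<Rightarrow> nat \<Rightarrow> real) \<Rightarrow> (nat \<Rightarrow> real) \<Rightarrow> bool" where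
  "diff_asymp A h \<longleftrightarrow> (\<forall>i. (\<lambda>n. sqrt (real n) ^ i * (fdiff ^^ i) (A n) 0) \<longlonglongrightarrow> h i)"

lemma fdiff_funpow_add: "(fdiff ^^ i) (\<lambda>j. A j + B j) = (\<lambda>j. (fdiff ^^ i) A j + (fdiff ^^ i) B j)"
  by (induction i) (auto simp: fdiff_def fun_eq_iff)

lemma fdiff_funpow_cmult: "(fdiff ^^ i) (\<lambda>j. c * A j) = (\<lambda>j. c * (fdiff ^^ i) A j)"
  by (induction i) (auto simp: fdiff_def fun_eq_iff algebra_simps)

lemma fdiff_funpow_shift: "(fdiff ^^ i) (\<lambda>j. A (Suc j)) = (\<lambda>j. (fdiff ^^ i) A j + (fdiff ^^ Suc i) A j)"
proof -
  have "(\<lambda>j. A (Suc j)) = (\<lambda>j. A j + fdiff A j)" by (auto simp: fdiff_def)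
  then show ?thesis by (simp add: fdiff_funpow_add funpow_swap1)
qed

text \<open>The discrete Leibniz rule, which breaks off because the index has a constant first
  difference. At \<open>i = 0\<close> the truncated \<open>i - 1\<close> is harmless: it comes with
  the factor 0.\<close>

lemma fdiff_funpow_ident_mult:
  "(fdiff ^^ i) (\<lambda>j. real j * B j) 0 = real i * ((fdiff ^^ (i - 1)) B 0 + (fdiff ^^ i) B 0)"
proof -
  have "(fdiff ^^ i) (\<lambda>j. real j * B j) =
      (\<lambda>j. real j * (fdiff ^^ i) B j + real i * (fdiff ^^ (i - 1)) B (Suc j))"
  proof (induction i)
    case (Suc i)
    have "fdiff (\<lambda>j. real j * A j + real i * C (Suc j)) =
        (\<lambda>j. real j * fdiff A j + A (Suc j) + real i * fdiff C (Suc j))" for A C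
      by (auto simp: fdiff_def fun_eq_iff algebra_simps)
    from this[of "(fdiff ^^ i) B" "(fdiff ^^ (i - 1)) B"]
    have "(fdiff ^^ Suc i) (\<lambda>j. real j * B j) =
      (\<lambda>j. real j * (fdiff ^^ Suc i) B j + (fdiff ^^ i) B (Suc j) + real i * fdiff ((fdiff ^^ (i - 1)) B) (Suc j))"
      by (simp add: Suc.IH)
    also have "\<dots> = (\<lambda>j. real j * (fdiff ^^ Suc i) B j + real (Suc i) * (fdiff ^^ (Suc i - 1)) B (Suc j))"
      by (cases i) (auto simp: fun_eq_iff algebra_simps)
    finally show ?case .
  qed simp
  then show ?thesis by (cases i) (auto simp: fdiff_def)
qed

lemma diff_asymp_add:
  assumes "diff_asymp A g" "diff_asymp B h"
  shows "diff_asymp (\<lambda>n j. A n j + B n j) (\<lambda>i. g i + h i)"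
  using assms unfolding diff_asymp_def by (auto simp: fdiff_funpow_add distrib_left intro!: tendsto_add)

lemma diff_asymp_cmult:
  assumes "diff_asymp A h" "c \<longlonglongrightarrow> c'"
  shows "diff_asymp (\<lambda>n j. c n * A n j) (\<lambda>i. c' * h i)"
proof -
  have "(\<lambda>n. c n * (sqrt (real n) ^ i * (fdiff ^^ i) (A n) 0)) \<longlonglongrightarrow> c' * h i" for i
    using assms unfolding diff_asymp_def by (auto intro!: tendsto_mult)
  then show ?thesis unfolding diff_asymp_def by (simp add: fdiff_funpow_cmult algebra_simps)
qed

lemma diff_asymp_fdiff:
  assumes "diff_asymp A h"
  shows "diff_asymp (\<lambda>n j. sqrt (real n) * fdiff (A n) j) (\<lambda>i. h (Suc i))"
proof -
  have "(\<lambda>n. sqrt (real n) ^ Suc i * (fdiff ^^ Suc i) (A n) 0) \<longlonglongrightarrow> h (Suc i)" for i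
    using assms unfolding diff_asymp_def by blast
  then show ?thesis unfolding diff_asymp_def
    by (simp add: fdiff_funpow_cmult funpow_swap1 algebra_simps)
qed

lemma diff_asymp_cong:
  assumes "diff_asymp A h" "eventually (\<lambda>n. A n = B n) sequentially" "\<And>i. h i = h' i"
  shows "diff_asymp B h'"
  unfolding diff_asymp_def
proof
  fix i
  have "(\<lambda>n. sqrt (real n) ^ i * (fdiff ^^ i) (A n) 0) \<longlonglongrightarrow> h' i"
    using assms(1,3) by (auto simp: diff_asymp_def)
  then show "(\<lambda>n. sqrt (real n) ^ i * (fdiff ^^ i) (B n) 0) \<longlonglongrightarrow> h' i"
    by (rule Lim_transform_eventually) (use assms(2) in \<open>auto elim!: eventually_mono\<close>)
qed

text \<open>A unit shift adds a scaled difference with coefficient \<open>1 / sqrt n\<close>, which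
  tends to 0; bounded shifts are invisible at this scale.\<close>

lemma diff_asymp_shift:
  assumes "diff_asymp A h"
  shows "diff_asymp (\<lambda>n j. A n (Suc j)) h"
proof -
  have "(\<lambda>n. inverse (sqrt (real n))) \<longlonglongrightarrow> 0" by real_asymp
  then have "diff_asymp (\<lambda>n j. A n j + inverse (sqrt (real n)) * (sqrt (real n) * fdiff (A n) j))
      (\<lambda>i. h i + 0 * h (Suc i))"
    by (intro diff_asymp_add diff_asymp_cmult diff_asymp_fdiff assms) auto
  then show ?thesis
  proof (rule diff_asymp_cong)
    show "\<forall>\<^sub>F n in sequentially. (\<lambda>j. A n j + inverse (sqrt (real n)) * (sqrt (real n) * fdiff (A n) j)) = (\<lambda>j. A n (Suc j))"
      using eventually_gt_at_top[of 0] by eventually_elim (simp add: fdiff_def mult.assoc[symmetric])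
  qed simp
qed

text \<open>In the Leibniz rule every difference that falls on \<open>B\<close> contributes 0 in the
  limit, and the unit shift in the other term is absorbed by
  \<open>diff_asymp_shift\<close>.\<close>

lemma diff_asymp_mult:
  assumes "diff_asymp A h" "diff_asymp B (\<lambda>i. if i = 0 then c else 0)"
  shows "diff_asymp (\<lambda>n j. A n j * B n j) (\<lambda>i. c * h i)"
proof -
  have "(\<lambda>n. sqrt (real n) ^ i * (fdiff ^^ i) (\<lambda>j. A n j * B n j) 0) \<longlonglongrightarrow> c * h i" for i
    using assms
  proof (induction i arbitrary: A B h c)
    case 0
    then have "(\<lambda>n. A n 0) \<longlonglongrightarrow> h 0" "(\<lambda>n. B n 0) \<longlonglongrightarrow> c"
      unfolding diff_asymp_def by (auto dest!: spec[where x = 0])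
    from tendsto_mult[OF this] show ?case by (simp add: mult.commute)
  next
    case (Suc i)
    let ?S = "\<lambda>n. sqrt (real n)"
    have 1: "(\<lambda>n. ?S n ^ i * (fdiff ^^ i) (\<lambda>j. (?S n * fdiff (A n) j) * B n (Suc j)) 0) \<longlonglongrightarrow> c * h (Suc i)"
      by (rule Suc.IH[OF diff_asymp_fdiff diff_asymp_shift]) (use Suc.prems in auto)
    \<comment> \<open>The vacuous case distinction has the shape of the hypothesis on
      \<open>B\<close> with \<open>c = 0\<close>, so the induction hypothesis applies to the
      differenced factor.\<close>
    have "diff_asymp (\<lambda>n j. ?S n * fdiff (B n) j) (\<lambda>i. if i = 0 then 0 else 0)"
      using diff_asymp_fdiff[OF Suc.prems(2)] by simp
    from Suc.IH[OF Suc.prems(1) this]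
    have 2: "(\<lambda>n. ?S n ^ i * (fdiff ^^ i) (\<lambda>j. A n j * (?S n * fdiff (B n) j)) 0) \<longlonglongrightarrow> 0 * h i" .
    have eq: "fdiff (\<lambda>j. A n j * B n j) = (\<lambda>j. fdiff (A n) j * B n (Suc j) + A n j * fdiff (B n) j)" for n
      by (auto simp: fdiff_def fun_eq_iff algebra_simps)
    have e1: "(fdiff ^^ i) (\<lambda>j. (?S n * fdiff (A n) j) * B n (Suc j)) 0 = ?S n * (fdiff ^^ i) (\<lambda>j. fdiff (A n) j * B n (Suc j)) 0" for n
      using fdiff_funpow_cmult[of i "?S n" "\<lambda>j. fdiff (A n) j * B n (Suc j)"] by (simp add: algebra_simps)
    have e2: "(fdiff ^^ i) (\<lambda>j. A n j * (?S n * fdiff (B n) j)) 0 = ?S n * (fdiff ^^ i) (\<lambda>j. A n j * fdiff (B n) j) 0" for n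
      using fdiff_funpow_cmult[of i "?S n" "\<lambda>j. A n j * fdiff (B n) j"] by (simp add: algebra_simps)
    have "?S n ^ Suc i * (fdiff ^^ Suc i) (\<lambda>j. A n j * B n j) 0 =
       ?S n ^ i * (fdiff ^^ i) (\<lambda>j. (?S n * fdiff (A n) j) * B n (Suc j)) 0
       + ?S n ^ i * (fdiff ^^ i) (\<lambda>j. A n j * (?S n * fdiff (B n) j)) 0" for n
      unfolding e1 e2 by (simp add: funpow_Suc_right eq fdiff_funpow_add algebra_simps del: funpow.simps)
    then show ?case using tendsto_add[OF 1 2] by simp
  qed
  then show ?thesis unfolding diff_asymp_def by blast
qed

text \<open>For the polynomial prefactors that a pole of \<Lambda> brings in: differences of order
  two and higher vanish, so it is enough that the slope is small against
  \<open>1 / sqrt n\<close>.\<close>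

lemma diff_asymp_affine:
  assumes "(\<lambda>n. sqrt (real n) * c n) \<longlonglongrightarrow> 0"
  shows "diff_asymp (\<lambda>n j. 1 + c n * real j) (\<lambda>i. if i = 0 then 1 else 0)"
proof -
  have 1: "fdiff (\<lambda>j. 1 + c n * real j) = (\<lambda>j. c n)" for n
    by (auto simp: fdiff_def algebra_simps)
  have 2: "(fdiff ^^ Suc i) (\<lambda>j. x) = (\<lambda>_. 0)" for i and x :: real
    by (induction i) (auto simp: fdiff_def)
  have "(\<lambda>n. sqrt (real n) ^ i * (fdiff ^^ i) (\<lambda>j. 1 + c n * real j) 0) \<longlonglongrightarrow> (if i = 0 then 1 else 0)" for i
  proof (cases i)
    case (Suc l)
    then show ?thesis using assms 2 by (cases l) (simp_all add: 1 funpow_Suc_right del: funpow.simps)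
  qed simp
  then show ?thesis unfolding diff_asymp_def by blast
qed

text \<open>With \<open>S\<close> the shift of \<open>h\<close>, this is \<open>(x - S) ^ d\<close>
  applied to \<open>h\<close> and evaluated at index 0. The recursive form matches the induction on
  \<open>d\<close> for the finite sums.\<close>

fun jensen_limit :: "nat \<Rightarrow> (nat \<Rightarrow> real) \<Rightarrow> real \<Rightarrow> real" where
  "jensen_limit 0 h x = h 0"
| "jensen_limit (Suc d) h x = x * jensen_limit d h x - jensen_limit d (\<lambda>i. h (Suc i)) x"

text \<open>Pascal's rule in operator form: with \<open>S\<close> the shift, the sum is
  \<open>(1 + y * S) ^ d\<close> applied to \<open>A\<close> at 0, and
  \<open>1 + y * S = (1 + y) + y * fdiff\<close>.\<close>

lemma jensen_sum_Suc:
  fixes y :: real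
  shows "(\<Sum>j\<le>Suc d. real (Suc d choose j) * A j * y ^ j) =
    (1 + y) * (\<Sum>j\<le>d. real (d choose j) * A j * y ^ j) + y * (\<Sum>j\<le>d. real (d choose j) * fdiff A j * y ^ j)"
proof -
  have "(\<Sum>j\<le>Suc d. real (Suc d choose j) * A j * y ^ j) =
    A 0 + (\<Sum>j\<le>d. real (d choose Suc j) * A (Suc j) * y ^ Suc j) + (\<Sum>j\<le>d. real (d choose j) * A (Suc j) * y ^ Suc j)"
    by (subst sum.atMost_Suc_shift) (simp add: sum.distrib[symmetric] algebra_simps)
  also have "A 0 + (\<Sum>j\<le>d. real (d choose Suc j) * A (Suc j) * y ^ Suc j) =
     (\<Sum>j\<le>Suc d. real (d choose j) * A j * y ^ j)"
    by (subst sum.atMost_Suc_shift) simp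
  also have "\<dots> = (\<Sum>j\<le>d. real (d choose j) * A j * y ^ j)" by simp
  finally show ?thesis
    by (simp add: fdiff_def sum_distrib_left sum.distrib[symmetric] sum_subtractf[symmetric] algebra_simps)
qed

text \<open>The point \<open>y = - 1 + x / sqrt n\<close> is chosen so that
  \<open>sqrt n * (1 + y) = x\<close> for \<open>n > 0\<close>; the other term carries a scaled
  difference times \<open>y\<close>, which tends to -1. This is the recursion of
  \<open>jensen_limit\<close>.\<close>

lemma jensen_sum_tendsto:
  assumes "diff_asymp A h"
  shows "(\<lambda>n. sqrt (real n) ^ d * (\<Sum>j\<le>d. real (d choose j) * A n j * (- 1 + x / sqrt (real n)) ^ j))
            \<longlonglongrightarrow> jensen_limit d h x"
  using assms
proof (induction d arbitrary: A h)
  case 0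
  then show ?case unfolding diff_asymp_def by (auto dest!: spec[where x = 0])
next
  case (Suc d)
  let ?S = "\<lambda>n. sqrt (real n)"
  let ?y = "\<lambda>n. - 1 + x / ?S n"
  let ?T = "\<lambda>A n. ?S n ^ d * (\<Sum>j\<le>d. real (d choose j) * A n j * ?y n ^ j)"
  have y: "?y \<longlonglongrightarrow> - 1" by real_asymp
  have "(\<lambda>n. x * ?T A n + ?y n * ?T (\<lambda>n j. ?S n * fdiff (A n) j) n)
       \<longlonglongrightarrow> x * jensen_limit d h x + (-1) * jensen_limit d (\<lambda>i. h (Suc i)) x"
    by (intro tendsto_add tendsto_mult tendsto_const y Suc.IH diff_asymp_fdiff Suc.prems)
  then have "(\<lambda>n. x * ?T A n + ?y n * ?T (\<lambda>n j. ?S n * fdiff (A n) j) n)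
       \<longlonglongrightarrow> jensen_limit (Suc d) h x" by simp
  then show ?case
  proof (rule Lim_transform_eventually)
    show "\<forall>\<^sub>F n in sequentially. x * ?T A n + ?y n * ?T (\<lambda>n j. ?S n * fdiff (A n) j) n =
       ?S n ^ Suc d * (\<Sum>j\<le>Suc d. real (Suc d choose j) * A n j * ?y n ^ j)"
      using eventually_gt_at_top[of 0]
    proof eventually_elim
      case (elim n)
      have a: "?S n * (1 + ?y n) = x" using elim by simp
      have b: "(\<Sum>j\<le>d. real (d choose j) * (?S n * fdiff (A n) j) * ?y n ^ j) = ?S n * (\<Sum>j\<le>d. real (d choose j) * fdiff (A n) j * ?y n ^ j)"
        by (simp add: sum_distrib_left mult_ac)
      have "s ^ Suc d * ((1 + y) * u + y * v) = (s * (1 + y)) * (s ^ d * u) + y * (s ^ d * (s * v))"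
        for s y u v :: real by (simp add: algebra_simps)
      then have "?S n ^ Suc d * (\<Sum>j\<le>Suc d. real (Suc d choose j) * A n j * ?y n ^ j) =
        (?S n * (1 + ?y n)) * ?T A n + ?y n * (?S n ^ d * (?S n * (\<Sum>j\<le>d. real (d choose j) * fdiff (A n) j * ?y n ^ j)))"
        unfolding jensen_sum_Suc .
      then show ?case unfolding a b by simp
    qed
  qed
qed

lemma jensen_limit_add: "jensen_limit d (\<lambda>i. g i + h i) x = jensen_limit d g x + jensen_limit d h x"
  by (induction d arbitrary: g h) (auto simp: algebra_simps)

lemma jensen_limit_uminus: "jensen_limit d (\<lambda>i. - h i) x = - jensen_limit d h x"
  by (induction d arbitrary: h) (auto simp: algebra_simps)

text \<open>If \<open>T h i = i * h (i - 1)\<close> and \<open>S\<close> is the shift, then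
  \<open>S T - T S\<close> is the identity, whence
  \<open>(x - S) ^ d T = T (x - S) ^ d - d (x - S) ^ (d - 1)\<close>. The first term on the right
  vanishes at index 0.\<close>

lemma jensen_limit_ident_mult:
  "jensen_limit d (\<lambda>i. real i * h (i - 1)) x = - real d * jensen_limit (d - 1) h x"
proof (induction d arbitrary: h)
  case (Suc d)
  have "(\<lambda>i. real (Suc i) * h (Suc i - 1)) = (\<lambda>i. real i * h (Suc (i - 1)) + h i)"
  proof
    show "real (Suc i) * h (Suc i - 1) = real i * h (Suc (i - 1)) + h i" for i
      by (cases i) (auto simp: algebra_simps)
  qed
  then have "jensen_limit (Suc d) (\<lambda>i. real i * h (i - 1)) x = - real d * (x * jensen_limit (d - 1) h x - jensen_limit (d - 1) (\<lambda>i. h (Suc i)) x) - jensen_limit d h x"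
    using Suc.IH[of h] Suc.IH[of "\<lambda>i. h (Suc i)"] by (simp add: jensen_limit_add algebra_simps)
  then show ?case by (cases d) (auto simp: algebra_simps)
qed simp

lemma jensen_limit_has_derivative:
  "((\<lambda>x. jensen_limit d h x) has_real_derivative real d * jensen_limit (d - 1) h x) (at x)"
proof (induction d arbitrary: h)
  case (Suc d)
  have "(jensen_limit (Suc d) h has_real_derivative
      1 * jensen_limit d h x + real d * jensen_limit (d - 1) h x * x
      - real d * jensen_limit (d - 1) (\<lambda>i. h (Suc i)) x) (at x)"
    unfolding jensen_limit.simps by (intro DERIV_diff DERIV_mult' DERIV_mult DERIV_ident Suc.IH)
  also have "1 * jensen_limit d h x + real d * jensen_limit (d - 1) h x * x
      - real d * jensen_limit (d - 1) (\<lambda>i. h (Suc i)) x = real (Suc d) * jensen_limit (Suc d - 1) h x"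
    by (cases d) (auto simp: algebra_simps)
  finally show ?case .
next
  case 0
  have "jensen_limit 0 h = (\<lambda>_. h 0)" for h by auto
  then show ?case by simp
qed

text \<open>The limits of the scaled differences of \<open>exp (- j\<^sup>2 / (2 * n))\<close>, equivalently the
  values at 0 of the Hermite polynomials.\<close>

fun hermite0 :: "nat \<Rightarrow> real" where
  "hermite0 0 = 1"
| "hermite0 (Suc 0) = 0"
| "hermite0 (Suc (Suc i)) = - real (Suc i) * hermite0 i"

lemma hermite0_Suc: "hermite0 (Suc i) = - real i * hermite0 (i - 1)"
  by (cases i) auto

text \<open>Rodrigues' formula in differential form. The recurrence \<open>hermite0_Suc\<close>
  turns the shifted sequence into \<open>- i * h (i - 1)\<close>, so the polynomials
  \<open>jensen_limit d hermite0\<close> satisfy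
  \<open>He (d + 1) = x * He d - d * He (d - 1)\<close>.\<close>

lemma gauss_jensen_limit_has_derivative:
  "((\<lambda>x. exp (- x\<^sup>2 / 2) * jensen_limit d hermite0 x) has_real_derivative
     - (exp (- x\<^sup>2 / 2) * jensen_limit (Suc d) hermite0 x)) (at x)"
proof -
  have "(\<lambda>i. hermite0 (Suc i)) = (\<lambda>i. - (real i * hermite0 (i - 1)))"
    by (simp add: hermite0_Suc fun_eq_iff del: hermite0.simps)
  then have "jensen_limit d (\<lambda>i. hermite0 (Suc i)) x = real d * jensen_limit (d - 1) hermite0 x"
    by (simp only: jensen_limit_uminus jensen_limit_ident_mult)
  then show ?thesis
    by (auto intro!: derivative_eq_intros jensen_limit_has_derivative simp: algebra_simps)
qed

lemma tendsto_power_times_gauss: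
  fixes p :: nat
  shows "((\<lambda>x::real. x ^ p * exp (- x\<^sup>2 / 2)) \<longlongrightarrow> 0) at_top"
proof (rule tendsto_sandwich[where f = "\<lambda>_. 0" and h = "\<lambda>x. x ^ p / exp x"])
  show "((\<lambda>x::real. x ^ p / exp x) \<longlongrightarrow> 0) at_top" by (rule tendsto_power_div_exp_0)
  show "\<forall>\<^sub>F x in at_top. x ^ p * exp (- x\<^sup>2 / 2) \<le> x ^ p / exp (x::real)"
    using eventually_ge_at_top[of 2]
  proof eventually_elim
    case (elim x)
    have "2 * x \<le> x * x" by (rule mult_right_mono) (use elim in simp_all)
    then have "- x\<^sup>2 / 2 \<le> - x" unfolding power2_eq_square by linarith
    then have "x ^ p * exp (- x\<^sup>2 / 2) \<le> x ^ p * exp (- x)"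
      using elim by (intro mult_left_mono zero_le_power) simp_all
    then show ?case by (simp only: exp_minus divide_inverse)
  qed
  show "\<forall>\<^sub>F x in at_top. 0 \<le> x ^ p * exp (- x\<^sup>2 / (2::real))"
    using eventually_ge_at_top[of 0] by eventually_elim simp
qed (rule tendsto_const)

text \<open>The free power \<open>x ^ p\<close> is what the induction needs, because the recursion
  of \<open>jensen_limit\<close> multiplies by \<open>x\<close>.\<close>

lemma gauss_jensen_limit_at_top:
  "((\<lambda>x. x ^ p * (exp (- x\<^sup>2 / 2) * jensen_limit d h x)) \<longlongrightarrow> 0) at_top"
proof (induction d arbitrary: h p)
  case 0
  from tendsto_mult_right[OF tendsto_power_times_gauss[of p], of "h 0"]
  show ?case by (simp add: mult_ac)
next
  case (Suc d)
  from tendsto_diff[OF Suc.IH[of "Suc p" h] Suc.IH[of p "\<lambda>i. h (Suc i)"]]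
  show ?case by (simp add: algebra_simps)
qed

lemma gauss_jensen_limit_at_bot:
  "((\<lambda>x. x ^ p * (exp (- x\<^sup>2 / 2) * jensen_limit d h x)) \<longlongrightarrow> 0) at_bot"
proof (induction d arbitrary: h p)
  case 0
  from tendsto_power_times_gauss[of p] have "((\<lambda>x::real. (-1) ^ p * (x ^ p * exp (- x\<^sup>2 / 2))) \<longlongrightarrow> 0) at_top"
    by (rule tendsto_mult_right_zero)
  moreover have "(\<lambda>x::real. (-1) ^ p * (x ^ p * exp (- x\<^sup>2 / 2))) = (\<lambda>x. (- x) ^ p * exp (- (- x)\<^sup>2 / 2))"
  proof
    fix x :: real
    show "(-1) ^ p * (x ^ p * exp (- x\<^sup>2 / 2)) = (- x) ^ p * exp (- (- x)\<^sup>2 / 2)"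
      unfolding power_minus[of x p] power2_minus mult.assoc ..
  qed
  ultimately have "((\<lambda>x::real. (- x) ^ p * exp (- (- x)\<^sup>2 / 2)) \<longlongrightarrow> 0) at_top"
    by (simp only:)
  then have "((\<lambda>x::real. x ^ p * exp (- x\<^sup>2 / 2)) \<longlongrightarrow> 0) at_bot"
    by (rule filterlim_at_bot_mirror[THEN iffD2])
  from tendsto_mult_right[OF this, of "h 0"] show ?case by (simp add: mult_ac)
next
  case (Suc d)
  from tendsto_diff[OF Suc.IH[of "Suc p" h] Suc.IH[of p "\<lambda>i. h (Suc i)"]]
  show ?case by (simp add: algebra_simps)
qed

text \<open>Each derivative of \<open>exp (- x\<^sup>2 / 2)\<close> gains one sign change over the previous one: the mean value
  theorem gives one between neighbouring points of alternation, and decay at infinity gives one more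
  on either side.\<close>

lemma hermite_alternation:
  "\<exists>y. (\<forall>i<d. y i < y (Suc i)) \<and> (\<forall>i\<le>d. (-1) ^ (d + i) * jensen_limit d hermite0 (y i) > (0::real))"
proof -
  define g where "g d x = exp (- x\<^sup>2 / 2) * jensen_limit d hermite0 x" for d x
  have der: "(g d has_real_derivative - g (Suc d) x) (at x)" for d x
    unfolding g_def by (rule gauss_jensen_limit_has_derivative[where d = d])
  have top: "(g d \<longlongrightarrow> 0) at_top" and bot: "(g d \<longlongrightarrow> 0) at_bot" for d
    using gauss_jensen_limit_at_top[of 0 d hermite0] gauss_jensen_limit_at_bot[of 0 d hermite0] by (simp_all add: g_def[abs_def])
  have mvt: "\<exists>z. a < z \<and> z < b \<and> g d a - g d b = (b - a) * g (Suc d) z" if "a < b" for a b d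
    using MVT2[OF that, of "g d" "\<lambda>x. - g (Suc d) x"] der by force
  have "\<exists>y. (\<forall>i<d. y i < y (Suc i)) \<and> (\<forall>i\<le>d. (-1) ^ (d + i) * g d (y i) > (0::real))" for d
  proof (induction d)
    case 0
    have "g 0 0 > 0" by (simp add: g_def)
    then show ?case by auto
  next
    case (Suc d)
    then obtain y where y: "\<And>i. i < d \<Longrightarrow> y i < y (Suc i)"
      and s: "\<And>i. i \<le> d \<Longrightarrow> (-1) ^ (d + i) * g d (y i) > (0::real)" by blast
    have "\<exists>z > y d. g (Suc d) z > 0"
    proof -
      have "g d (y d) > 0" using s[of d] by simp
      then have "\<forall>\<^sub>F x in at_top. g d x < g d (y d) \<and> x > y d"
        by (intro eventually_conj order_tendstoD[OF top] eventually_gt_at_top)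
      then obtain x where x: "g d x < g d (y d)" "x > y d"
        by (metis (no_types, lifting) eventually_at_top_linorder order_refl)
      from mvt[OF x(2)] obtain z where z: "y d < z" "g d (y d) - g d x = (x - y d) * g (Suc d) z" by blast
      then have "(x - y d) * g (Suc d) z > 0" using x by linarith
      then show ?thesis using z(1) x(2) by (auto simp: zero_less_mult_iff)
    qed
    then obtain zr where zr: "zr > y d" "g (Suc d) zr > 0" by blast
    have "\<exists>z < y 0. (-1) ^ Suc d * g (Suc d) z > 0"
    proof -
      define e :: real where "e = (-1) ^ d"
      have "e * g d (y 0) > 0" using s[of 0] by (simp add: e_def)
      moreover have "((\<lambda>x. e * g d x) \<longlongrightarrow> 0) at_bot" using tendsto_mult_right_zero[OF bot] .
      ultimately have "\<forall>\<^sub>F x in at_bot. e * g d x < e * g d (y 0) \<and> x < y 0"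
        by (intro eventually_conj order_tendstoD(2) eventually_gt_at_bot) auto
      then obtain x where x: "e * g d x < e * g d (y 0)" "x < y 0"
        by (metis (no_types, lifting) eventually_at_bot_linorder order_refl)
      from mvt[OF x(2)] obtain z where z: "z < y 0" "g d x - g d (y 0) = (y 0 - x) * g (Suc d) z" by blast
      have "e * (g d x - g d (y 0)) < 0" using x by (simp add: algebra_simps)
      then have "(y 0 - x) * (e * g (Suc d) z) < 0" unfolding z(2) by (simp add: mult_ac)
      then show ?thesis using z(1) x(2) by (auto simp: mult_less_0_iff e_def)
    qed
    then obtain zl where zl: "zl < y 0" "(-1) ^ Suc d * g (Suc d) zl > 0" by blast
    have "\<exists>z. y i < z \<and> z < y (Suc i) \<and> (-1) ^ (d + i) * g (Suc d) z > 0" if i: "i < d" for i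
    proof -
      define e :: real where "e = (-1) ^ (d + i)"
      from mvt[OF y[OF i]] obtain z where z: "y i < z" "z < y (Suc i)" "g d (y i) - g d (y (Suc i)) = (y (Suc i) - y i) * g (Suc d) z" by blast
      have "e * g d (y i) > 0" "e * g d (y (Suc i)) < 0" using s[of i] s[of "Suc i"] i by (auto simp: e_def)
      then have "e * (g d (y i) - g d (y (Suc i))) > 0" by (simp add: algebra_simps)
      then have "(y (Suc i) - y i) * (e * g (Suc d) z) > 0" unfolding z(3) by (simp add: mult_ac)
      then show ?thesis using z y[OF i] by (auto simp: zero_less_mult_iff e_def)
    qed
    then obtain zm where zm: "\<And>i. i < d \<Longrightarrow> y i < zm i \<and> zm i < y (Suc i) \<and> (-1) ^ (d + i) * g (Suc d) (zm i) > 0"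
      by metis
    \<comment> \<open>New points \<open>1..d\<close> lie between neighbouring old points, the first
      and the last outside them all. A sign found after the old index \<open>i\<close> belongs to
      the new index \<open>Suc i\<close>, which preserves the parity of the exponent.\<close>
    define z where "z i = (if i = 0 then zl else if i = Suc d then zr else zm (i - 1))" for i
    have "z i < z (Suc i)" if "i < Suc d" for i
      using that zm[of 0] zm[of i] zm[of "i - 1"] zl zr unfolding z_def
      by (cases i) (auto split: if_splits)
    moreover have "(-1) ^ (Suc d + i) * g (Suc d) (z i) > 0" if "i \<le> Suc d" for i
    proof (cases i)
      case (Suc l)
      show ?thesis
      proof (cases "l = d")
        case True then show ?thesis using Suc zr by (simp add: z_def)
      next
        case False then show ?thesis using Suc zm[of l] that by (simp add: z_def)
      qed
    qed (use zl in \<open>simp add: z_def\<close>)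
    ultimately show ?case by (intro exI[of _ z]) blast
  qed
  from this[of d] show ?thesis
    by (auto simp: g_def zero_less_mult_iff mult.left_commute[of _ "exp _"])
qed

section \<open>Real-rootedness from sign changes\<close>

lemma alternating_imp_hyperbolic:
  fixes p :: "real poly" and X :: "nat \<Rightarrow> real"
  assumes deg: "degree p \<le> d"
    and X: "\<And>i. i < d \<Longrightarrow> X i < X (Suc i)"
    and alt: "\<And>i. i < d \<Longrightarrow> poly p (X i) * poly p (X (Suc i)) < 0"
    and nz: "p \<noteq> 0"
  shows "hyperbolic p"
proof -
  let ?q = "map_poly complex_of_real p"
  have q: "poly ?q (of_real x) = of_real (poly p x)" for x
    by (induction p) (auto simp: map_poly_pCons)
  have "\<exists>x. X i < x \<and> x < X (Suc i) \<and> poly p x = 0" if "i < d" for i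
    using poly_IVT[OF X[OF that] alt[OF that]] by blast
  then obtain r where r: "\<And>i. i < d \<Longrightarrow> X i < r i \<and> r i < X (Suc i) \<and> poly p (r i) = 0"
    by metis
  have mono: "X i \<le> X j" if "i \<le> j" "j \<le> d" for i j
    using that
  proof (induction j rule: dec_induct)
    case (step n)
    then show ?case using X[of n] by simp
  qed simp
  have "r i < r j" if "i < j" "j < d" for i j
    using r[of i] r[of j] mono[of "Suc i" j] that by force
  then have inj: "inj_on r {..<d}"
    by (auto simp: inj_on_def) (metis linorder_neqE_nat order_less_irrefl)
  let ?R = "(\<lambda>i. complex_of_real (r i)) ` {..<d}"
  have qnz: "?q \<noteq> 0" using nz by (simp add: map_poly_eq_0_iff)
  \<comment> \<open>The \<open>d\<close> sign changes already give \<open>d\<close> distinct real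
    roots, and the degree bound leaves room for no other complex root.\<close>
  have "card ?R = d" using inj by (subst card_image) (auto simp: inj_on_def)
  moreover have sub: "?R \<subseteq> {z. poly ?q z = 0}" using r q by auto
  moreover have "card {z. poly ?q z = 0} \<le> d"
    using card_poly_roots_bound[OF qnz] deg by (simp add: degree_map_poly)
  ultimately have "?R = {z. poly ?q z = 0}"
    using poly_roots_finite[OF qnz] by (metis card_mono card_subset_eq le_antisym)
  then have "z \<in> ?R" if "poly ?q z = 0" for z using that by blast
  then show ?thesis unfolding hyperbolic_def by (metis (no_types, lifting) Reals_of_real imageE)
qed

lemma poly_jensen_poly: "poly (jensen_poly a d n) x = (\<Sum>j\<le>d. real (d choose j) * a (n + j) * x ^ j)"
  by (simp add: jensen_poly_def poly_sum poly_monom atMost_atLeast0)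

lemma degree_jensen_poly: "degree (jensen_poly a d n) \<le> d"
  unfolding jensen_poly_def
  by (intro degree_sum_le) (auto intro: order_trans[OF degree_monom_le])

text \<open>Dividing by \<open>q n\<close> and rescaling the variable by \<open>r n\<close> moves no
  root off the real line. The limit alternates in sign at \<open>d + 1\<close> fixed points, so for
  large \<open>n\<close> the polynomial alternates at their rescaled images.\<close>

theorem eventually_hyperbolic:
  assumes asy: "diff_asymp (\<lambda>n j. a (n + j) / (q n * r n ^ j)) hermite0"
    and q: "eventually (\<lambda>n. q n \<noteq> 0) sequentially" and r: "eventually (\<lambda>n. r n > (0::real)) sequentially"
  shows "eventually (\<lambda>n. hyperbolic (jensen_poly a d n)) sequentially"
proof -
  obtain y where y: "\<And>i. i < d \<Longrightarrow> y i < y (Suc i)"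
    and s: "\<And>i. i \<le> d \<Longrightarrow> (-1) ^ (d + i) * jensen_limit d hermite0 (y i) > (0::real)"
    using hermite_alternation[of d] by blast
  define X where "X n i = (- 1 + y i / sqrt (real n)) / r n" for n i
  define T where "T n i = sqrt (real n) ^ d * (\<Sum>j\<le>d. real (d choose j) * (a (n + j) / (q n * r n ^ j)) * (- 1 + y i / sqrt (real n)) ^ j)" for n i
  have "(\<lambda>n. (-1) ^ (d + i) * T n i) \<longlonglongrightarrow> (-1) ^ (d + i) * jensen_limit d hermite0 (y i)" for i
    unfolding T_def by (intro tendsto_mult tendsto_const jensen_sum_tendsto[OF asy])
  then have "\<forall>\<^sub>F n in sequentially. (-1) ^ (d + i) * T n i > 0" if "i \<le> d" for i
    using order_tendstoD(1)[OF _ s[OF that]] by blast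
  then have ev: "\<forall>\<^sub>F n in sequentially. \<forall>i\<in>{..d}. (-1) ^ (d + i) * T n i > 0"
    by (intro eventually_ball_finite) auto
  show ?thesis
    using ev q r eventually_gt_at_top[of 0]
  proof eventually_elim
    case (elim n)
    have eq: "T n i = sqrt (real n) ^ d / q n * poly (jensen_poly a d n) (X n i)" for i
      unfolding T_def X_def poly_jensen_poly using elim
      by (simp add: sum_distrib_left field_simps power_divide)
    have T: "(-1) ^ (d + i) * T n i > 0" if "i \<le> d" for i using elim that by auto
    show ?case
    proof (rule alternating_imp_hyperbolic[OF degree_jensen_poly, of d "X n"])
      show "X n i < X n (Suc i)" if "i < d" for i
        using y[OF that] elim unfolding X_def by (intro divide_strict_right_mono add_strict_left_mono) auto
      show "poly (jensen_poly a d n) (X n i) * poly (jensen_poly a d n) (X n (Suc i)) < 0" if "i < d" for i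
      proof -
        have "T n i * T n (Suc i) < 0"
          using T[of i] T[of "Suc i"] that
          by (cases "even (d + i)") (auto simp: mult_less_0_iff)
        \<comment> \<open>The sign of \<open>q n\<close> is unknown; it drops out of the product of
          neighbouring values.\<close>
        then have "(sqrt (real n) ^ d / q n) ^ 2 * (poly (jensen_poly a d n) (X n i) * poly (jensen_poly a d n) (X n (Suc i))) < 0"
          unfolding eq by (simp add: power2_eq_square mult_ac)
        then show ?thesis by (simp add: mult_less_0_iff not_less)
      qed
      show "jensen_poly a d n \<noteq> 0" using T[of 0] unfolding eq by auto
    qed
  qed
qed

text \<open>The recurrence makes \<open>A n j\<close> a product of factors
  \<open>n / (n + b + l)\<close> with \<open>l < j\<close>, roughly
  \<open>exp (- j^2 / (2 n))\<close>. Rather than expanding this product, the recurrence is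
  differenced \<open>i\<close> times; after scaling, its limit is the recurrence of
  \<open>hermite0\<close>.\<close>

lemma diff_asymp_hermite:
  fixes A :: "nat \<Rightarrow> nat \<Rightarrow> real"
  assumes rec: "\<And>n j. (real n + b + real j) * A n (Suc j) = real n * A n j"
    and init: "\<And>n. A n 0 = 1" and b: "b > 0"
  shows "diff_asymp A hermite0"
proof -
  define S where "S i n = sqrt (real n) ^ i * (fdiff ^^ i) (A n) 0" for i n
  define B where "B n j = A n (Suc j)" for n j
  have step: "(real n + b + real i) * (fdiff ^^ Suc i) (A n) 0 = - (b + 2 * real i) * (fdiff ^^ i) (A n) 0 - real i * (fdiff ^^ (i - 1)) (A n) 0" for n i
  proof -
    \<comment> \<open>The recurrence as \<open>n * fdiff A + b * B + j * B = 0\<close>, a form in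
      which differencing meets a single product with the index.\<close>
    have "(\<lambda>j. real n * fdiff (A n) j + (b * B n j + real j * B n j)) = (\<lambda>j. 0 * A n j)"
      using rec[of n] by (auto simp: fun_eq_iff B_def fdiff_def algebra_simps)
    moreover have "(fdiff ^^ i) (\<lambda>j. 0 * A n j) 0 = 0"
      unfolding fdiff_funpow_cmult by simp
    ultimately have "(fdiff ^^ i) (\<lambda>j. real n * fdiff (A n) j + (b * B n j + real j * B n j)) 0 = 0"
      by (simp only:)
    then have "real n * (fdiff ^^ Suc i) (A n) 0 + b * (fdiff ^^ i) (B n) 0 + real i * ((fdiff ^^ (i - 1)) (B n) 0 + (fdiff ^^ i) (B n) 0) = 0"
      by (simp only: fdiff_funpow_add fdiff_funpow_cmult fdiff_funpow_ident_mult funpow_Suc_right o_def add.assoc)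
    then have "real n * (fdiff ^^ Suc i) (A n) 0 + b * (fdiff ^^ i) (B n) 0 + (real i * (fdiff ^^ (i - 1)) (B n) 0 + real i * (fdiff ^^ i) (B n) 0) = 0"
      by (simp only: distrib_left)
    moreover have shift: "(fdiff ^^ l) (B n) 0 = (fdiff ^^ l) (A n) 0 + (fdiff ^^ Suc l) (A n) 0" for l
      unfolding B_def fdiff_funpow_shift by simp
    moreover have "real i * (fdiff ^^ (i - 1)) (B n) 0 = real i * ((fdiff ^^ (i - 1)) (A n) 0 + (fdiff ^^ i) (A n) 0)"
      using shift[of "i - 1"] by (cases i) simp_all
    ultimately have "real n * (fdiff ^^ Suc i) (A n) 0 + b * ((fdiff ^^ i) (A n) 0 + (fdiff ^^ Suc i) (A n) 0)
        + (real i * ((fdiff ^^ (i - 1)) (A n) 0 + (fdiff ^^ i) (A n) 0)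
        + real i * ((fdiff ^^ i) (A n) 0 + (fdiff ^^ Suc i) (A n) 0)) = 0"
      by (simp only:)
    then show ?thesis by (simp add: algebra_simps del: funpow.simps)
  qed
  have Sstep: "S (Suc i) n = - (b + 2 * real i) * (sqrt (real n) / (real n + b + real i)) * S i n
      - real i * (real n / (real n + b + real i)) * S (i - 1) n" if "n > 0" for i n
  proof -
    have pos: "real n + b + real i > 0" using b by simp
    have sq: "sqrt (real n) ^ Suc i * (real i * x) = real n * (real i * (sqrt (real n) ^ (i - 1) * x))" for x
      by (cases i) (auto simp: mult_ac)
    have "(real n + b + real i) * S (Suc i) n = sqrt (real n) ^ Suc i * ((real n + b + real i) * (fdiff ^^ Suc i) (A n) 0)"
      by (simp add: S_def mult_ac)
    also have "\<dots> = - (b + 2 * real i) * sqrt (real n) * S i n - sqrt (real n) ^ Suc i * (real i * (fdiff ^^ (i - 1)) (A n) 0)"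
      unfolding step by (simp add: S_def algebra_simps)
    also have "\<dots> = - (b + 2 * real i) * sqrt (real n) * S i n - real i * real n * S (i - 1) n"
      unfolding sq by (simp add: S_def mult_ac)
    finally have *: "(real n + b + real i) * S (Suc i) n = - (b + 2 * real i) * sqrt (real n) * S i n - real i * real n * S (i - 1) n" .
    have "X = u * (s / P) * Y - v * (w / P) * Z" if "P * X = u * s * Y - v * w * Z" "P > 0" for P X Y Z s u v w :: real
      using that by (simp add: field_simps)
    from this[OF * pos] show ?thesis .
  qed
  have "S i \<longlonglongrightarrow> hermite0 i \<and> S (Suc i) \<longlonglongrightarrow> hermite0 (Suc i)" for i
  proof -
    have l1: "(\<lambda>n. sqrt (real n) / (real n + b + real i)) \<longlonglongrightarrow> 0" for i
      by real_asymp
    have l2: "(\<lambda>n. real n / (real n + b + real i)) \<longlonglongrightarrow> 1" for i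
      by real_asymp
    have key: "S (Suc i) \<longlonglongrightarrow> hermite0 (Suc i)" if "S i \<longlonglongrightarrow> hermite0 i" "S (i - 1) \<longlonglongrightarrow> hermite0 (i - 1)" for i
    proof -
      \<comment> \<open>The term with \<open>S i n\<close> carries \<open>sqrt n / n\<close> and
        dies out, and the influence of \<open>b\<close> with it; the term with
        \<open>S (i - 1) n\<close> survives with coefficient \<open>- i\<close>.\<close>
      have "(\<lambda>n. - (b + 2 * real i) * (sqrt (real n) / (real n + b + real i)) * S i n
        - real i * (real n / (real n + b + real i)) * S (i - 1) n) \<longlonglongrightarrow> - (b + 2 * real i) * 0 * hermite0 i - real i * 1 * hermite0 (i - 1)"
        by (intro tendsto_intros l1 l2 that)
      also have "- (b + 2 * real i) * 0 * hermite0 i - real i * 1 * hermite0 (i - 1) = hermite0 (Suc i)"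
        by (simp only: hermite0_Suc)
      finally show ?thesis
        by (rule Lim_transform_eventually) (use Sstep in \<open>auto intro!: eventually_mono[OF eventually_gt_at_top[of 0]]\<close>)
    qed
    have S0: "S 0 \<longlonglongrightarrow> hermite0 0" by (simp add: S_def[abs_def] init)
    show ?thesis
    proof (induction i)
      case 0
      then show ?case using key[of 0] S0 by simp
    next
      case (Suc i)
      then show ?case using key[of "Suc i"] by simp
    qed
  qed
  then show ?thesis unfolding diff_asymp_def S_def by blast
qed

subsection \<open>Concentration of the moments\<close>

lemma set_integrable_exp_neg:
  fixes a :: real
  assumes "a > 0"
  shows "set_integrable lborel {0..} (\<lambda>u. exp (- a * u))"
proof -
  have "(\<lambda>u. exp (- a * u)) absolutely_integrable_on {0..}"
    using integrable_on_exp_minus_to_infinity[OF assms, of 0] by (intro nonnegative_absolutely_integrable_1) auto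
  moreover have "(\<lambda>u. indicator {0..} u *\<^sub>R exp (- a * u)) \<in> borel_measurable borel"
    by (intro borel_measurable_continuous_on_indicator continuous_intros) auto
  ultimately show ?thesis
    unfolding set_integrable_def by (simp add: integrable_completion)
qed

text \<open>The quadratic bound \<open>u^2 / 2 \<le> exp u\<close> reduces the claim to completing a
  square: \<open>(\<kappa> + 1)^2 / (2 c)\<close> is the maximum of
  \<open>(\<kappa> + 1) u - c u^2 / 2\<close>.\<close>

lemma exp_minus_exp_le:
  fixes c \<kappa> u :: real
  assumes "c > 0" "u \<ge> 0"
  shows "exp (\<kappa> * u - c * exp u) \<le> exp ((\<kappa> + 1)\<^sup>2 / (2 * c)) * exp (- u)"
proof -
  have "c * (u\<^sup>2 / 2) \<le> c * exp u"
    using assms exp_lower_Taylor_quadratic[of u] by (intro mult_left_mono) auto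
  moreover have "(\<kappa> + 1) * u - c * (u\<^sup>2 / 2) \<le> (\<kappa> + 1)\<^sup>2 / (2 * c)"
  proof -
    have "0 \<le> (c * u - (\<kappa> + 1))\<^sup>2 / (2 * c)" using assms by simp
    also have "\<dots> = (\<kappa> + 1)\<^sup>2 / (2 * c) - ((\<kappa> + 1) * u - c * (u\<^sup>2 / 2))"
      using assms by (simp add: field_simps power2_eq_square)
    finally show ?thesis by simp
  qed
  ultimately have "\<kappa> * u - c * exp u \<le> (\<kappa> + 1)\<^sup>2 / (2 * c) + - u" by (simp add: algebra_simps)
  then show ?thesis by (simp add: exp_add[symmetric])
qed

lemma set_integrable_exp_minus_exp:
  fixes f :: "real \<Rightarrow> 'a :: {banach, second_countable_topology}"
  assumes "continuous_on {0..} f" "c > 0"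
    and bound: "\<And>u. u \<ge> 0 \<Longrightarrow> norm (f u) \<le> K * exp (\<kappa> * u - c * exp u)"
  shows "set_integrable lborel {0..} f"
proof (rule set_integrable_bound)
  let ?C = "\<bar>K\<bar> * exp ((\<kappa> + 1)\<^sup>2 / (2 * c))"
  show "set_integrable lborel {0..} (\<lambda>u. ?C * exp (- u))"
    using set_integrable_exp_neg[of 1] by simp
  show "set_borel_measurable lborel {0..} f"
    using assms(1) borel_measurable_continuous_on_indicator[of "{0..}" f]
    by (simp add: set_borel_measurable_def)
  have "norm (f u) \<le> norm (?C * exp (- u))" if "u \<ge> 0" for u
  proof -
    have "norm (f u) \<le> \<bar>K\<bar> * exp (\<kappa> * u - c * exp u)"
      using bound[OF that] by (smt (verit) exp_gt_zero mult_right_mono)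
    also have "\<dots> \<le> \<bar>K\<bar> * (exp ((\<kappa> + 1)\<^sup>2 / (2 * c)) * exp (- u))"
      using exp_minus_exp_le[OF assms(2) that] by (intro mult_left_mono) auto
    finally show ?thesis by (simp add: abs_mult mult.assoc)
  qed
  then show "AE u in lborel. u \<in> {0..} \<longrightarrow> norm (f u) \<le> norm (?C * exp (- u))" by auto
qed

lemma power_le_exp_mult:
  fixes u :: real assumes "u \<ge> 0" shows "u ^ m \<le> exp (real m * u)"
proof -
  have "u ^ m \<le> exp u ^ m" using assms exp_ge_add_one_self[of u] by (intro power_mono) linarith+
  then show ?thesis by (simp add: exp_of_nat_mult)
qed

lemma set_integral_FTC_at_top:
  fixes G :: "real \<Rightarrow> 'a :: euclidean_space"
  assumes der: "\<And>u. u \<ge> 0 \<Longrightarrow> (G has_vector_derivative g u) (at u)"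
    and int: "set_integrable lborel {0..} g" and cont: "continuous_on {0..} g"
    and lim: "(G \<longlongrightarrow> L) at_top"
  shows "(LINT u:{0..}|lborel. g u) = L - G 0"
proof (rule tendsto_unique)
  show "((\<lambda>b. LINT u:{0..b}|lborel. g u) \<longlongrightarrow> (LINT u:{0..}|lborel. g u)) at_top"
    by (rule tendsto_set_lebesgue_integral_at_top[OF _ int]) auto
  have "((\<lambda>b. G b - G 0) \<longlongrightarrow> L - G 0) at_top" by (intro tendsto_intros lim)
  then show "((\<lambda>b. LINT u:{0..b}|lborel. g u) \<longlongrightarrow> L - G 0) at_top"
  proof (rule Lim_transform_eventually)
    show "\<forall>\<^sub>F b in at_top. G b - G 0 = (LINT u:{0..b}|lborel. g u)"
      using eventually_ge_at_top[of 0]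
    proof eventually_elim
      case (elim b)
      show ?case unfolding set_lebesgue_integral_def
        by (rule integral_FTC_atLeastAtMost[symmetric, OF elim])
          (auto intro!: continuous_on_subset[OF cont] has_vector_derivative_at_within[OF der])
    qed
  qed
qed simp

section \<open>Moments of the saddle-point weight\<close>

definition moment_const :: "nat \<Rightarrow> real" where
  "moment_const i = (\<Prod>l<i. 3 * (2 * real l + 1))"

text \<open>The equation for \<open>v\<close> says that
  \<open>\<kappa> u - c exp u + m ln u\<close>, the logarithm of the weight \<open>w\<close>, is
  stationary at \<open>v\<close>.\<close>

locale saddle =
  fixes c \<kappa> v :: real and m :: nat
  assumes c: "c > 0" and v: "v \<ge> 1" and m: "v * (c * exp v - \<kappa>) = real m" and m_pos: "m > 0"
begin

definition w :: "real \<Rightarrow> real" where "w u = exp (\<kappa> * u - c * exp u) * u ^ m"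
text \<open>A coordinate around the peak in which \<open>c * exp u = K * (1 + s u)\<close>; it
  agrees with \<open>u - v\<close> to first order.\<close>

definition s :: "real \<Rightarrow> real" where "s u = exp (u - v) - 1"
text \<open>The share of \<open>c * exp u\<close> in the curvature of the exponent at
  \<open>v\<close>; correspondingly \<open>M i\<close> will be at most of order
  \<open>K ^ (- i)\<close> relative to \<open>M 0\<close>.\<close>

definition K :: real where "K = c * exp v"
definition M :: "nat \<Rightarrow> real" where "M i = (LINT u:{0..}|lborel. s u ^ (2 * i) * w u)"

lemma w_nonneg: "u \<ge> 0 \<Longrightarrow> w u \<ge> 0" by (simp add: w_def)

lemma K_pos: "K > 0" using c by (simp add: K_def)

lemma continuous: "continuous_on A w" "continuous_on A s"
  by (auto simp: w_def s_def intro!: continuous_intros)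

lemma exp_bound_w:
  assumes "u \<ge> 0"
  shows "w u \<le> exp ((\<kappa> + real m) * u - c * exp u)"
proof -
  have "w u \<le> exp (\<kappa> * u - c * exp u) * exp (real m * u)"
    unfolding w_def using power_le_exp_mult[OF assms] by (intro mult_left_mono) auto
  then show ?thesis by (simp add: exp_add[symmetric] algebra_simps)
qed

lemma integrable_exp_bound:
  fixes f :: "real \<Rightarrow> real"
  assumes "continuous_on {0..} f" "\<And>u. u \<ge> 0 \<Longrightarrow> \<bar>f u\<bar> \<le> C * exp (A * u)" "C \<ge> 0"
  shows "set_integrable lborel {0..} (\<lambda>u. f u * w u)"
proof (rule set_integrable_exp_minus_exp[OF _ c])
  show "continuous_on {0..} (\<lambda>u. f u * w u)" by (intro continuous_intros assms continuous)
  show "norm (f u * w u) \<le> C * exp ((A + \<kappa> + real m) * u - c * exp u)" if "u \<ge> 0" for u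
  proof -
    have "\<bar>f u\<bar> * \<bar>w u\<bar> \<le> (C * exp (A * u)) * exp ((\<kappa> + real m) * u - c * exp u)"
      using that assms exp_bound_w[OF that] w_nonneg[OF that] by (intro mult_mono) auto
    also have "\<dots> = C * exp ((A + \<kappa> + real m) * u - c * exp u)" by (simp add: exp_add[symmetric] algebra_simps)
    finally show ?thesis by (simp add: abs_mult)
  qed
qed

lemma abs_s_le: "u \<ge> 0 \<Longrightarrow> \<bar>s u\<bar> \<le> exp u"
  using v exp_gt_zero[of "u - v"] unfolding s_def
  by (smt (verit) exp_le_cancel_iff one_le_exp_iff)

lemma integrable_s: "set_integrable lborel {0..} (\<lambda>u. s u ^ l * w u)"
proof (rule integrable_exp_bound)
  show "continuous_on {0..} (\<lambda>u. s u ^ l)" by (intro continuous_intros continuous)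
  show "\<bar>s u ^ l\<bar> \<le> 1 * exp (real l * u)" if "u \<ge> 0" for u
    using power_mono[OF abs_s_le[OF that], of l] by (simp add: power_abs exp_of_nat_mult)
qed simp

lemma M_nonneg: "M i \<ge> 0"
  unfolding M_def set_lebesgue_integral_def
  by (intro Bochner_Integration.integral_nonneg) (auto simp: indicator_def w_nonneg)

lemma M_0_pos: "M 0 > 0"
proof -
  define C where "C = exp (- \<bar>\<kappa>\<bar> * 2 - c * exp 2)"
  have "C \<le> s u ^ (2 * 0) * w u" if "u \<in> {1..2}" for u
  proof -
    have "- \<bar>\<kappa>\<bar> * 2 \<le> \<kappa> * u"
    proof -
      have "\<bar>\<kappa> * u\<bar> \<le> \<bar>\<kappa>\<bar> * 2" using that by (auto simp: abs_mult intro!: mult_left_mono)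
      then show ?thesis by linarith
    qed
    moreover have "c * exp u \<le> c * exp 2" using that c by auto
    ultimately have "C \<le> exp (\<kappa> * u - c * exp u) * 1" by (simp add: C_def)
    also have "\<dots> \<le> w u" unfolding w_def using that by (intro mult_left_mono) auto
    finally show ?thesis by simp
  qed
  then have "(LINT u:{1..2::real}|lborel. C) \<le> (LINT u:{1..2::real}|lborel. s u ^ (2 * 0) * w u)"
    by (intro set_integral_mono set_integrable_subset[OF integrable_s]) (auto simp: set_integrable_def)
  also have "\<dots> \<le> M 0"
    unfolding M_def set_lebesgue_integral_def
    using integrable_s[of "2 * 0"] set_integrable_subset[OF integrable_s[of "2 * 0"], of "{1..2}"]
    by (intro integral_mono) (auto simp: set_integrable_def indicator_def w_nonneg)
  finally have "C \<le> M 0" by (simp add: set_lebesgue_integral_def)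
  moreover have "C > 0" by (simp add: C_def)
  ultimately show ?thesis by simp
qed

text \<open>Integration by parts, with a test function that grows like the derivative of the
  exponent; this makes the drift at least \<open>K\<close> times the test function on the whole half-line.\<close>

lemma K_M_Suc_le: "K * M (Suc i) \<le> (2 * real i + 1) * (LINT u:{0..}|lborel. s u ^ (2 * i) * (1 + s u) * w u)"
proof -
  \<comment> \<open>One power of \<open>u\<close> is split off so that the term
    \<open>m * u ^ (m - 1)\<close> in the derivative of \<open>w\<close> involves no division by
    \<open>u\<close> at 0.\<close>
  define e where "e u = exp (\<kappa> * u - c * exp u) * u ^ (m - 1)" for u
  have we: "w u = u * e u" for u unfolding w_def e_def using m_pos by (cases m) auto
  define g where "g u = s u ^ (2 * i) * (2 * real i + 1) * (1 + s u) * w u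
      + s u ^ (2 * i + 1) * (u * (\<kappa> - c * exp u) + real m) * e u" for u
  have der_e: "(w has_real_derivative (u * (\<kappa> - c * exp u) + real m) * e u) (at u)" for u
  proof -
    have "((\<lambda>u. exp (\<kappa> * u - c * exp u)) has_real_derivative exp (\<kappa> * u - c * exp u) * (\<kappa> - c * exp u)) (at u)"
      by (auto intro!: derivative_eq_intros)
    from DERIV_mult'[OF this DERIV_pow[of m u]]
    show ?thesis unfolding w_def e_def using m_pos by (cases m) (simp_all add: algebra_simps)
  qed
  have der: "((\<lambda>u. s u ^ (2 * i + 1) * w u) has_real_derivative g u) (at u)" for u
  proof -
    have ds: "(s has_real_derivative 1 + s u) (at u)"
      unfolding s_def by (auto intro!: derivative_eq_intros)
    have "((\<lambda>u. s u ^ (2 * i + 1)) has_real_derivative real (2 * i + 1) * ((1 + s u) * s u ^ (2 * i))) (at u)"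
      using DERIV_power[OF ds, of "2 * i + 1"] by simp
    from DERIV_mult'[OF this der_e]
    show ?thesis by (simp add: g_def algebra_simps)
  qed
  have ie: "set_integrable lborel {0..} (\<lambda>u. f u * e u)"
    if "continuous_on {0..} f" "\<And>u. u \<ge> 0 \<Longrightarrow> \<bar>f u\<bar> \<le> C * exp (A * u)" "C \<ge> 0" for f C A
  proof (rule set_integrable_exp_minus_exp[OF _ c])
    show "continuous_on {0..} (\<lambda>u. f u * e u)" unfolding e_def by (intro continuous_intros that)
    show "norm (f u * e u) \<le> C * exp ((A + \<kappa> + real (m - 1)) * u - c * exp u)" if u: "u \<ge> 0" for u
    proof -
      have "e u \<le> exp (\<kappa> * u - c * exp u) * exp (real (m - 1) * u)"
        unfolding e_def using power_le_exp_mult[OF u] by (intro mult_left_mono) auto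
      then have "\<bar>f u\<bar> * \<bar>e u\<bar> \<le> (C * exp (A * u)) * (exp (\<kappa> * u - c * exp u) * exp (real (m - 1) * u))"
        using u \<open>\<And>u. u \<ge> 0 \<Longrightarrow> \<bar>f u\<bar> \<le> C * exp (A * u)\<close>[OF u] \<open>C \<ge> 0\<close> by (intro mult_mono) (auto simp: e_def)
      also have "\<dots> = C * exp ((A + \<kappa> + real (m - 1)) * u - c * exp u)" by (simp add: exp_add[symmetric] algebra_simps)
      finally show ?thesis by (simp add: abs_mult)
    qed
  qed
  have i2: "set_integrable lborel {0..} (\<lambda>u. s u ^ (2 * i + 1) * (u * (\<kappa> - c * exp u) + real m) * e u)"
  proof (rule ie)
    show "continuous_on {0..} (\<lambda>u. s u ^ (2 * i + 1) * (u * (\<kappa> - c * exp u) + real m))"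
      by (intro continuous_intros continuous)
    show "\<bar>s u ^ (2 * i + 1) * (u * (\<kappa> - c * exp u) + real m)\<bar> \<le> (\<bar>\<kappa>\<bar> + c + real m) * exp ((real (2 * i + 1) + 2) * u)"
      if "u \<ge> 0" for u
    proof -
      have e1: "1 \<le> exp u" "u \<le> exp u" using that exp_ge_add_one_self[of u] by linarith+
      have "\<bar>u * (\<kappa> - c * exp u) + real m\<bar> \<le> u * (\<bar>\<kappa>\<bar> + c * exp u) + real m"
      proof -
        have "\<bar>u * (\<kappa> - c * exp u)\<bar> \<le> u * (\<bar>\<kappa>\<bar> + c * exp u)"
        proof -
          have "\<bar>c * exp u\<bar> = c * exp u" using c by simp
          then have "\<bar>\<kappa> - c * exp u\<bar> \<le> \<bar>\<kappa>\<bar> + c * exp u" using abs_triangle_ineq4[of \<kappa> "c * exp u"] by simp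
          then show ?thesis unfolding abs_mult using that by (intro mult_mono) auto
        qed
        then show ?thesis by linarith
      qed
      also have "\<dots> \<le> exp u * (\<bar>\<kappa>\<bar> * exp u + c * exp u) + real m * (exp u * exp u)"
      proof (intro add_mono mult_mono)
        show "\<bar>\<kappa>\<bar> \<le> \<bar>\<kappa>\<bar> * exp u" using e1 mult_left_mono[of 1 "exp u" "\<bar>\<kappa>\<bar>"] by simp
        show "real m \<le> real m * (exp u * exp u)" using that mult_left_mono[of 1 "exp u * exp u" "real m"] e1
          by (simp add: exp_add[symmetric])
      qed (use that e1 c in auto)
      also have "\<dots> = (\<bar>\<kappa>\<bar> + c + real m) * exp (2 * u)"
        by (simp add: exp_add[symmetric] algebra_simps)
      finally have 1: "\<bar>u * (\<kappa> - c * exp u) + real m\<bar> \<le> (\<bar>\<kappa>\<bar> + c + real m) * exp (2 * u)" .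
      have "\<bar>s u\<bar> ^ (2 * i + 1) \<le> exp u ^ (2 * i + 1)"
        by (rule power_mono[OF abs_s_le[OF that]]) simp
      then have 2: "\<bar>s u ^ (2 * i + 1)\<bar> \<le> exp (real (2 * i + 1) * u)"
        unfolding power_abs exp_of_nat_mult .
      have "\<bar>s u ^ (2 * i + 1) * (u * (\<kappa> - c * exp u) + real m)\<bar> \<le> exp (real (2 * i + 1) * u) * ((\<bar>\<kappa>\<bar> + c + real m) * exp (2 * u))"
        unfolding abs_mult by (rule mult_mono[OF 2 1]) auto
      also have "\<dots> = (\<bar>\<kappa>\<bar> + c + real m) * exp ((real (2 * i + 1) + 2) * u)"
        by (simp add: exp_add[symmetric] algebra_simps)
      finally show ?thesis .
    qed
  qed (use c in auto)
  have i1: "set_integrable lborel {0..} (\<lambda>u. s u ^ (2 * i) * (1 + s u) * w u)"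
    using set_integral_add(1)[OF integrable_s[of "2 * i"] integrable_s[of "2 * i + 1"]] by (simp add: algebra_simps)
  have i1': "set_integrable lborel {0..} (\<lambda>u. (2 * real i + 1) * (s u ^ (2 * i) * (1 + s u) * w u))"
    using i1 by simp
  have ig: "set_integrable lborel {0..} g"
    using set_integral_add(1)[OF i1' i2] by (simp add: g_def[abs_def] algebra_simps)
  have lim: "((\<lambda>u. s u ^ (2 * i + 1) * w u) \<longlongrightarrow> 0) at_top"
  proof (rule Lim_null_comparison)
    let ?A = "real (2 * i + 1) + \<kappa> + real m"
    show "\<forall>\<^sub>F u in at_top. norm (s u ^ (2 * i + 1) * w u) \<le> exp ((?A + 1)\<^sup>2 / (2 * c)) * exp (- u)"
      using eventually_ge_at_top[of 0]
    proof eventually_elim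
      case (elim u)
      have "\<bar>s u ^ (2 * i + 1)\<bar> \<le> exp (real (2 * i + 1) * u)"
        unfolding power_abs exp_of_nat_mult by (rule power_mono[OF abs_s_le[OF elim]]) simp
      then have "\<bar>s u ^ (2 * i + 1)\<bar> * \<bar>w u\<bar> \<le> exp (real (2 * i + 1) * u) * exp ((\<kappa> + real m) * u - c * exp u)"
        using exp_bound_w[OF elim] w_nonneg[OF elim] by (intro mult_mono) auto
      also have "\<dots> = exp (?A * u - c * exp u)" by (simp add: exp_add[symmetric] algebra_simps)
      also have "\<dots> \<le> exp ((?A + 1)\<^sup>2 / (2 * c)) * exp (- u)" by (rule exp_minus_exp_le[OF c elim])
      finally show ?case by (simp add: abs_mult)
    qed
    have "((\<lambda>u::real. exp (- u)) \<longlongrightarrow> 0) at_top" by real_asymp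
    then show "((\<lambda>u. exp ((?A + 1)\<^sup>2 / (2 * c)) * exp (- u)) \<longlongrightarrow> 0) at_top"
      by (rule tendsto_mult_right_zero)
  qed
  have "continuous_on {0..} g" unfolding g_def e_def by (intro continuous_intros continuous)
  from set_integral_FTC_at_top[OF der[unfolded has_real_derivative_iff_has_vector_derivative] ig this lim]
  \<comment> \<open>Both boundary terms vanish: at infinity by \<open>lim\<close>, at 0 because
    \<open>m > 0\<close> gives \<open>w 0 = 0\<close>.\<close>
  have zero: "(LINT u:{0..}|lborel. g u) = 0" using m_pos by (simp add: w_def)
  have ib: "set_integrable lborel {0..} (\<lambda>u. (2 * real i + 1) * (s u ^ (2 * i) * (1 + s u) * w u) - K * (s u ^ (2 * Suc i) * w u))"
    by (rule set_integral_diff(1)[OF i1']) (use integrable_s[of "2 * Suc i"] in simp)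
  have "g u \<le> (2 * real i + 1) * (s u ^ (2 * i) * (1 + s u) * w u) - K * (s u ^ (2 * Suc i) * w u)" if u: "u \<in> {0..}" for u
  proof -
    have eu: "c * exp u = K * (1 + s u)" unfolding K_def s_def by (simp add: exp_diff)
    \<comment> \<open>\<open>s u\<close> and \<open>v - u\<close> have opposite signs. Inserting
      \<open>m = v * (K - \<kappa>)\<close> splits \<open>s\<close> times the drift into this term,
      which may be dropped, and \<open>- K * s^2 * u\<close>, which yields the next moment because
      \<open>u * e u = w u\<close>.\<close>
    have "s u * (v - u) \<le> 0"
      unfolding s_def by (cases "u \<le> v") (auto simp: mult_le_0_iff)
    then have "s u * (v - u) * (K - \<kappa>) \<le> 0" if "K - \<kappa> \<ge> 0" using that by (simp add: mult_nonpos_nonneg)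
    moreover have "K - \<kappa> \<ge> 0" using m m_pos v unfolding K_def
      by (metis less_eq_real_def of_nat_0_less_iff zero_less_mult_pos order_less_le_trans zero_less_one)
    ultimately have 3: "s u * (v - u) * (K - \<kappa>) \<le> 0" by blast
    have "s u * (u * (\<kappa> - c * exp u) + real m) = s u * (v - u) * (K - \<kappa>) - K * (s u * s u) * u"
      unfolding eu m[symmetric] K_def[symmetric] by (simp add: algebra_simps)
    then have "s u * (u * (\<kappa> - c * exp u) + real m) \<le> - K * (s u * s u) * u" using 3 by simp
    then have "(s u ^ (2 * i) * e u) * (s u * (u * (\<kappa> - c * exp u) + real m)) \<le> (s u ^ (2 * i) * e u) * (- K * (s u * s u) * u)"
      using u by (intro mult_left_mono) (auto simp: e_def)
    then show ?thesis unfolding g_def we by (simp add: algebra_simps)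
  qed
  then have "(LINT u:{0..}|lborel. g u) \<le> (LINT u:{0..}|lborel. (2 * real i + 1) * (s u ^ (2 * i) * (1 + s u) * w u) - K * (s u ^ (2 * Suc i) * w u))"
    by (rule set_integral_mono[OF ig ib])
  also have "\<dots> = (2 * real i + 1) * (LINT u:{0..}|lborel. s u ^ (2 * i) * (1 + s u) * w u) - K * M (Suc i)"
    unfolding M_def using i1' integrable_s[of "2 * Suc i"] by (subst set_integral_diff(2)) simp_all
  finally show ?thesis using zero by simp
qed

text \<open>By \<open>1 + s \<le> 3 / 2 + s^2 / 2\<close> the unwanted \<open>M (Suc i)\<close>
  appears with half the weight \<open>2 i + 1 \<le> K\<close> and is absorbed on the left. The
  quotient of \<open>3 / 2\<close> and \<open>1 / 2\<close> is the factor 3 in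
  \<open>moment_const\<close>; the odd factors there are those of the even Gaussian moments.\<close>

lemma K_M_Suc_le': 
  assumes "K \<ge> 2 * real i + 1"
  shows "K * M (Suc i) \<le> 3 * (2 * real i + 1) * M i"
proof -
  have i1: "set_integrable lborel {0..} (\<lambda>u. s u ^ (2 * i) * (1 + s u) * w u)"
    using set_integral_add(1)[OF integrable_s[of "2 * i"] integrable_s[of "2 * i + 1"]] by (simp add: algebra_simps)
  have i2: "set_integrable lborel {0..} (\<lambda>u. 3 / 2 * (s u ^ (2 * i) * w u) + 1 / 2 * (s u ^ (2 * Suc i) * w u))"
    using integrable_s[of "2 * i"] integrable_s[of "2 * Suc i"] by (intro set_integral_add(1)) simp_all
  have "s u ^ (2 * i) * (1 + s u) * w u \<le> 3 / 2 * (s u ^ (2 * i) * w u) + 1 / 2 * (s u ^ (2 * Suc i) * w u)"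
    if "u \<in> {0..}" for u
  proof -
    have "1 + s u \<le> 3 / 2 + 1 / 2 * (s u * s u)"
      using zero_le_power2[of "s u - 1"] by (simp add: power2_eq_square algebra_simps)
    moreover have "s u ^ (2 * i) * w u \<ge> 0" using that w_nonneg by simp
    ultimately have "(s u ^ (2 * i) * w u) * (1 + s u) \<le> (s u ^ (2 * i) * w u) * (3 / 2 + 1 / 2 * (s u * s u))"
      by (rule mult_left_mono)
    then show ?thesis by (simp add: algebra_simps)
  qed
  then have "(LINT u:{0..}|lborel. s u ^ (2 * i) * (1 + s u) * w u) \<le>
      (LINT u:{0..}|lborel. 3 / 2 * (s u ^ (2 * i) * w u) + 1 / 2 * (s u ^ (2 * Suc i) * w u))"
    by (rule set_integral_mono[OF i1 i2])
  also have "\<dots> = 3 / 2 * M i + 1 / 2 * M (Suc i)"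
    unfolding M_def using integrable_s[of "2 * i"] integrable_s[of "2 * Suc i"]
    by (subst set_integral_add(2)) simp_all
  finally have "(2 * real i + 1) * (LINT u:{0..}|lborel. s u ^ (2 * i) * (1 + s u) * w u)
      \<le> (2 * real i + 1) * (3 / 2 * M i + 1 / 2 * M (Suc i))"
    by (intro mult_left_mono) auto
  from order_trans[OF K_M_Suc_le this] have "K * M (Suc i) \<le> 3 / 2 * (2 * real i + 1) * M i + 1 / 2 * ((2 * real i + 1) * M (Suc i))"
    by argo
  moreover have "(2 * real i + 1) * M (Suc i) \<le> K * M (Suc i)"
    by (rule mult_right_mono[OF assms M_nonneg])
  ultimately show ?thesis by simp
qed

lemma M_le:
  assumes "K \<ge> 2 * real i"
  shows "K ^ i * M i \<le> (\<Prod>l<i. 3 * (2 * real l + 1)) * M 0"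
  using assms
proof (induction i)
  case (Suc i)
  have "K ^ Suc i * M (Suc i) = K ^ i * (K * M (Suc i))" by simp
  also have "\<dots> \<le> K ^ i * (3 * (2 * real i + 1) * M i)"
    using Suc.prems K_pos by (intro mult_left_mono K_M_Suc_le') auto
  also have "\<dots> = 3 * (2 * real i + 1) * (K ^ i * M i)" by simp
  also have "\<dots> \<le> 3 * (2 * real i + 1) * ((\<Prod>l<i. 3 * (2 * real l + 1)) * M 0)"
    using Suc by (intro mult_left_mono) auto
  finally show ?case by (simp add: mult_ac)
qed simp

text \<open>Chebyshev's device: the indicator of the region left of \<open>v - 1\<close> is
  dominated by \<open>(2 s)^2\<close>, so whatever happens there can be charged to a moment. The 2
  comes from \<open>exp (- 1) \<le> 1 / 2\<close>.\<close>

lemma s_left: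
  assumes "u \<le> v - 1"
  shows "1 \<le> (2 * s u)\<^sup>2"
proof -
  have "exp (u - v) \<le> exp (- 1)" using assms by simp
  also have "\<dots> \<le> 1 / 2" using exp_ge_add_one_self[of 1] by (simp add: exp_minus field_simps)
  finally have "1 \<le> - 2 * s u" by (simp add: s_def)
  then have "1\<^sup>2 \<le> (- 2 * s u)\<^sup>2" by (intro power_mono) auto
  then show ?thesis by simp
qed

text \<open>To the right of \<open>v\<close> this is convexity of \<open>exp\<close>. To the left
  \<open>s\<close> saturates at -1, so a linear comparison uniform in \<open>v\<close> requires a
  bounded distance from the peak.\<close>

lemma abs_diff_le_s:
  assumes "u \<ge> v - 1"
  shows "\<bar>u - v\<bar> \<le> 2 * \<bar>s u\<bar>"
proof (cases "u \<ge> v")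
  case True
  then have "0 \<le> u - v" "u - v \<le> s u"
    using exp_ge_add_one_self[of "u - v"] by (auto simp: s_def simp del: exp_ge_add_one_self)
  then show ?thesis by simp
next
  case False
  define x where "x = v - u"
  have x: "0 < x" "x \<le> 1" using False assms by (auto simp: x_def)
  have "x / 2 \<le> x / (1 + x)" using x by (intro divide_left_mono) auto
  also have "\<dots> = 1 - 1 / (1 + x)" using x by (simp add: field_simps)
  also have "\<dots> \<le> 1 - exp (- x)" using x exp_ge_add_one_self[of x] by (simp add: exp_minus field_simps)
  finally show ?thesis using False by (simp add: s_def x_def)
qed

text \<open>For \<open>u \<ge> v - 1\<close> put \<open>y = sqrt K * \<bar>s\<bar>\<close>, a
  variable of bounded even moments: \<open>u / v - 1\<close> is at most
  \<open>2 y / (v sqrt K)\<close> in size and \<open>u / v + 1\<close> at most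
  \<open>2 + 2 y\<close>. To the left of \<open>v - 1\<close> the deviation is at most 1 and is
  charged to \<open>(2 s) ^ (2 i)\<close>.\<close>

lemma ratio_deviation_le:
  assumes u: "u \<ge> 0" and K: "K \<ge> 1"
  shows "\<bar>(u / v)\<^sup>2 - 1\<bar> ^ i \<le> (16 / (v * sqrt K)) ^ i * (1 + K ^ i * s u ^ (2 * i)) + 4 ^ i * s u ^ (2 * i)"
proof (cases "u \<ge> v - 1")
  case True
  define y where "y = sqrt K * \<bar>s u\<bar>"
  define r where "r = sqrt K"
  have r: "r \<ge> 1" using K by (simp add: r_def)
  have y: "y \<ge> 0" using r by (simp add: y_def r_def)
  have s: "\<bar>s u\<bar> = y / r" using r by (simp add: y_def r_def)
  have "\<bar>u / v - 1\<bar> = \<bar>u - v\<bar> / v" using v by (simp add: field_simps abs_if)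
  also have "\<dots> \<le> 2 * \<bar>s u\<bar> / v" using abs_diff_le_s[OF True] v by (intro divide_right_mono) auto
  finally have 1: "\<bar>u / v - 1\<bar> \<le> 2 * (y / r) / v" by (simp add: s)
  also have "\<dots> \<le> 2 * y"
  proof -
    have "y / r \<le> y / 1" using r y by (intro divide_left_mono) auto
    moreover have "2 * (y / r) / v \<le> 2 * (y / r) / 1" using r y v by (intro divide_left_mono) auto
    ultimately show ?thesis by simp
  qed
  finally have 2: "\<bar>u / v + 1\<bar> \<le> 2 + 2 * y" by linarith
  have "(u / v)\<^sup>2 - 1 = (u / v - 1) * (u / v + 1)" by (simp add: algebra_simps power2_eq_square)
  then have "\<bar>(u / v)\<^sup>2 - 1\<bar> \<le> (2 * (y / r) / v) * (2 + 2 * y)"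
    using y r v by (simp only: abs_mult) (rule mult_mono[OF 1 2], auto)
  also have "\<dots> = 4 / (v * r) * (y + y\<^sup>2)" using r v by (simp add: field_simps power2_eq_square)
  also have "\<dots> \<le> 4 / (v * r) * (4 * max 1 (y\<^sup>2))"
  proof (intro mult_left_mono)
    show "y + y\<^sup>2 \<le> 4 * max 1 (y\<^sup>2)"
      using zero_le_power2[of "y - 1"] by (simp add: power2_eq_square algebra_simps max_def)
  qed (use r v in auto)
  also have "\<dots> = 16 / (v * r) * max 1 (y\<^sup>2)" by simp
  finally have "\<bar>(u / v)\<^sup>2 - 1\<bar> ^ i \<le> (16 / (v * r) * max 1 (y\<^sup>2)) ^ i" by (intro power_mono) auto
  also have "\<dots> \<le> (16 / (v * r)) ^ i * (1 + (y\<^sup>2) ^ i)"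
    unfolding power_mult_distrib using r v by (intro mult_left_mono) (auto simp: max_def)
  also have "(y\<^sup>2) ^ i = K ^ i * s u ^ (2 * i)"
    using K by (simp add: y_def power_mult_distrib power_mult)
  finally have "\<bar>(u / v)\<^sup>2 - 1\<bar> ^ i \<le> (16 / (v * r)) ^ i * (1 + K ^ i * s u ^ (2 * i))" .
  moreover have "0 \<le> 4 ^ i * s u ^ (2 * i)" by simp
  ultimately show ?thesis unfolding r_def by linarith
next
  case False
  have "(u / v)\<^sup>2 \<le> 1" using False u v by (intro power_le_one) auto
  then have "\<bar>(u / v)\<^sup>2 - 1\<bar> \<le> 1" by (simp add: abs_le_iff)
  then have "\<bar>(u / v)\<^sup>2 - 1\<bar> ^ i \<le> 1 ^ i" by (intro power_mono) auto
  also have "\<dots> \<le> ((2 * s u)\<^sup>2) ^ i" using s_left[of u] False by (intro power_mono) auto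
  also have "\<dots> = 4 ^ i * s u ^ (2 * i)" by (simp add: power_mult_distrib power_mult)
  finally have "\<bar>(u / v)\<^sup>2 - 1\<bar> ^ i \<le> 4 ^ i * s u ^ (2 * i)" by simp
  moreover have "0 \<le> (16 / (v * sqrt K)) ^ i * (1 + K ^ i * s u ^ (2 * i))"
    using K_pos v by simp
  ultimately show ?thesis by linarith
qed

lemma integrable_ratio: "set_integrable lborel {0..} (\<lambda>u. \<bar>(u / v)\<^sup>2 - 1\<bar> ^ i * w u)"
proof (rule integrable_exp_bound)
  show "continuous_on {0..} (\<lambda>u. \<bar>(u / v)\<^sup>2 - 1\<bar> ^ i)" using v by (intro continuous_intros) auto
  show "\<bar>\<bar>(u / v)\<^sup>2 - 1\<bar> ^ i\<bar> \<le> 2 ^ i * exp (real (2 * i) * u)" if "u \<ge> 0" for u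
  proof -
    have "u / v \<le> exp u" using that v exp_ge_add_one_self[of u]
      by (smt (verit) divide_le_eq_1 divide_right_mono div_by_1 frac_le)
    then have "(u / v)\<^sup>2 \<le> (exp u)\<^sup>2" using that v by (intro power_mono) auto
    moreover have "1 \<le> (exp u)\<^sup>2" using that by (simp add: one_le_power)
    ultimately have "\<bar>(u / v)\<^sup>2 - 1\<bar> \<le> 2 * (exp u)\<^sup>2" using zero_le_power2[of "u / v"] by linarith
    then have "\<bar>(u / v)\<^sup>2 - 1\<bar> ^ i \<le> (2 * (exp u)\<^sup>2) ^ i" by (intro power_mono) auto
    then show ?thesis unfolding exp_of_nat_mult by (simp add: power_mult_distrib power_mult[symmetric])
  qed
qed simp

text \<open>Two scales survive: \<open>1 / (v sqrt K)\<close>, the relative width of the peak, and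
  \<open>1 / K\<close>, which controls the part left of \<open>v - 1\<close>.\<close>

lemma integral_ratio_le:
  assumes K: "K \<ge> 1" "K \<ge> 2 * real i"
  shows "(LINT u:{0..}|lborel. \<bar>(u / v)\<^sup>2 - 1\<bar> ^ i * w u)
      \<le> ((16 / (v * sqrt K)) ^ i * (1 + moment_const i) + (4 / K) ^ i * moment_const i) * M 0"
proof -
  define A where "A = (16 / (v * sqrt K)) ^ i"
  have A: "A \<ge> 0" using v K_pos by (simp add: A_def)
  have i1: "set_integrable lborel {0..} (\<lambda>u. A * (s u ^ (2 * 0) * w u))"
    and i2: "set_integrable lborel {0..} (\<lambda>u. (A * K ^ i + 4 ^ i) * (s u ^ (2 * i) * w u))"
    using integrable_s[of "2 * 0"] integrable_s[of "2 * i"] by simp_all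
  have "(LINT u:{0..}|lborel. \<bar>(u / v)\<^sup>2 - 1\<bar> ^ i * w u)
      \<le> (LINT u:{0..}|lborel. A * (s u ^ (2 * 0) * w u) + (A * K ^ i + 4 ^ i) * (s u ^ (2 * i) * w u))"
  proof (rule set_integral_mono[OF integrable_ratio set_integral_add(1)[OF i1 i2]])
    fix u :: real assume "u \<in> {0..}"
    then have "\<bar>(u / v)\<^sup>2 - 1\<bar> ^ i * w u \<le> (A * (1 + K ^ i * s u ^ (2 * i)) + 4 ^ i * s u ^ (2 * i)) * w u"
      unfolding A_def by (intro mult_right_mono ratio_deviation_le K w_nonneg) auto
    then show "\<bar>(u / v)\<^sup>2 - 1\<bar> ^ i * w u \<le> A * (s u ^ (2 * 0) * w u) + (A * K ^ i + 4 ^ i) * (s u ^ (2 * i) * w u)"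
      by (simp add: algebra_simps)
  qed
  also have "\<dots> = A * M 0 + (A * K ^ i + 4 ^ i) * M i"
    unfolding M_def using i1 i2 by (subst set_integral_add(2)) simp_all
  also have "\<dots> = A * M 0 + (A + (4 / K) ^ i) * (K ^ i * M i)"
    using K_pos by (simp add: algebra_simps power_divide)
  also have "\<dots> \<le> A * M 0 + (A + (4 / K) ^ i) * (moment_const i * M 0)"
    unfolding moment_const_def using A K_pos by (intro add_left_mono mult_left_mono M_le K) auto
  finally show ?thesis by (simp add: A_def algebra_simps)
qed

end


section \<open>Densities comparable with the saddle-point weight\<close>

lemma saddle_point_exists:
  fixes c \<kappa> :: real
  assumes c: "c > 0" and m: "(m::nat) > 0"
  shows "\<exists>v>0. v * (c * exp v - \<kappa>) = real m"
proof -
  define g where "g v = v * (c * exp v - \<kappa>)" for v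
  \<comment> \<open>\<open>c * b \<ge> \<bar>\<kappa>\<bar> + m\<close> together with
    \<open>exp b \<ge> b\<close> and \<open>b \<ge> 1\<close> forces
    \<open>g b \<ge> m\<close>.\<close>
  define b where "b = (\<bar>\<kappa>\<bar> + real m) / c + real m + 1"
  have b: "b \<ge> 1" using c by (simp add: b_def)
  have "c * b \<le> c * exp b" using c exp_ge_add_one_self[of b] by (intro mult_left_mono) linarith+
  moreover have "c * b \<ge> \<bar>\<kappa>\<bar> + real m" using c by (simp add: b_def field_simps)
  ultimately have "real m \<le> c * exp b - \<kappa>" by linarith
  moreover have "1 * (c * exp b - \<kappa>) \<le> g b" unfolding g_def using b calculation by (intro mult_right_mono) auto
  ultimately have "real m \<le> g b" by simp
  moreover have "continuous_on {0..b} g" unfolding g_def by (intro continuous_intros)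
  ultimately obtain v where "0 \<le> v" "g v = real m"
    using IVT'[of g 0 "real m" b] b by (auto simp: g_def)
  moreover have "v \<noteq> 0" using \<open>g v = real m\<close> m by (auto simp: g_def)
  ultimately show ?thesis by (intro exI[of _ v]) (auto simp: g_def)
qed

lemma exp_ge_square: "x \<ge> 0 \<Longrightarrow> x\<^sup>2 / 2 \<le> exp (x::real)"
  using exp_lower_Taylor_quadratic[of x] by linarith

text \<open>The lower bound is asked only beyond \<open>U\<close>: the kernel of a Dirichlet series
  has a definite sign only where its first exponential dominates, and may be of either sign near
  0.\<close>

locale peaked_density =
  fixes \<phi> :: "real \<Rightarrow> real" and c \<kappa> C\<^sub>0 C\<^sub>1 U :: real
  assumes c: "c > 0" and C0: "C\<^sub>0 > 0" and C1: "C\<^sub>1 > 0"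
    and cont: "continuous_on {0..} \<phi>"
    and upper: "\<And>u. u \<ge> 0 \<Longrightarrow> \<bar>\<phi> u\<bar> \<le> C\<^sub>1 * exp (\<kappa> * u - c * exp u)"
    and lower: "\<And>u. u \<ge> 0 \<Longrightarrow> u \<ge> U \<Longrightarrow> C\<^sub>0 * exp (\<kappa> * u - c * exp u) \<le> \<phi> u"
begin

definition F :: "nat \<Rightarrow> real" where "F m = (LINT u:{0..}|lborel. \<phi> u * u ^ m)"

definition peak :: "nat \<Rightarrow> real" where
  "peak m = (SOME v. v > 0 \<and> v * (c * exp v - \<kappa>) = real m)"

lemma peak: "m > 0 \<Longrightarrow> peak m > 0 \<and> peak m * (c * exp (peak m) - \<kappa>) = real m"
  unfolding peak_def by (rule someI_ex) (use saddle_point_exists[OF c] in blast)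

lemma peak_at_top: "filterlim peak at_top sequentially"
  unfolding filterlim_at_top_ge[where c = 1]
proof safe
  fix Z :: real assume Z: "Z \<ge> 1"
  have "\<forall>\<^sub>F m in sequentially. real m > Z * (c * exp Z + \<bar>\<kappa>\<bar>)"
    by real_asymp
  then show "\<forall>\<^sub>F m in sequentially. Z \<le> peak m"
    using eventually_gt_at_top[of 0]
  proof eventually_elim
    case (elim m)
    show ?case
    proof (rule ccontr)
      assume "\<not> Z \<le> peak m"
      then have "c * exp (peak m) - \<kappa> \<le> c * exp Z + \<bar>\<kappa>\<bar>"
      proof -
        have "c * exp (peak m) \<le> c * exp Z" using \<open>\<not> Z \<le> peak m\<close> c by simp
        then show ?thesis by linarith
      qed
      then have "peak m * (c * exp (peak m) - \<kappa>) \<le> peak m * (c * exp Z + \<bar>\<kappa>\<bar>)"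
        using peak[of m] elim by (intro mult_left_mono) auto
      also have "\<dots> \<le> Z * (c * exp Z + \<bar>\<kappa>\<bar>)"
        using \<open>\<not> Z \<le> peak m\<close> c by (intro mult_right_mono) auto
      finally show False using peak[of m] elim by simp
    qed
  qed
qed

lemma integrable_poly:
  assumes "continuous_on {0..} f" "\<And>u. u \<ge> 0 \<Longrightarrow> \<bar>f u\<bar> \<le> K * exp (A * u)"
  shows "set_integrable lborel {0..} (\<lambda>u. \<phi> u * f u)"
proof (rule set_integrable_exp_minus_exp[OF _ c])
  show "continuous_on {0..} (\<lambda>u. \<phi> u * f u)" by (intro continuous_intros cont assms)
  show "norm (\<phi> u * f u) \<le> (C\<^sub>1 * K) * exp ((\<kappa> + A) * u - c * exp u)" if "u \<ge> 0" for u
  proof -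
    have "\<bar>\<phi> u\<bar> * \<bar>f u\<bar> \<le> (C\<^sub>1 * exp (\<kappa> * u - c * exp u)) * (K * exp (A * u))"
      using upper[OF that] assms(2)[OF that] C1 by (intro mult_mono) auto
    also have "\<dots> = (C\<^sub>1 * K) * exp ((\<kappa> + A) * u - c * exp u)" by (simp add: exp_add[symmetric] algebra_simps)
    finally show ?thesis by (simp add: abs_mult)
  qed
qed

lemma integrable_power: "set_integrable lborel {0..} (\<lambda>u. \<phi> u * u ^ m)"
  using power_le_exp_mult[of _ m] by (intro integrable_poly[where K = 1 and A = "real m"]) (auto intro!: continuous_intros)

text \<open>Below \<open>U\<close> the sign of \<phi> is unknown, but
  \<open>U \<le> peak m - 1\<close>, so the loss there is at most
  \<open>(C\<^sub>0 + C\<^sub>1) * (2 s)^2\<close> times the weight, hence a multiple of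
  \<open>M 1\<close>. The constant 24 is 4 from \<open>(2 s)^2\<close>, times 3 from
  \<open>K * M 1 \<le> 3 * M 0\<close>, times 2 to keep half of
  \<open>C\<^sub>0 * M 0\<close>.\<close>

lemma moment_bound:
  assumes m: "m > 0" and v: "peak m \<ge> 1" "peak m \<ge> U + 1"
    and K: "c * exp (peak m) \<ge> 1" "c * exp (peak m) \<ge> 2 * real i" "c * exp (peak m) \<ge> 2"
      "c * exp (peak m) * C\<^sub>0 \<ge> 24 * (C\<^sub>0 + C\<^sub>1)"
  shows "F m > 0"
    and "\<bar>LINT u:{0..}|lborel. \<phi> u * u ^ m * ((u / peak m)\<^sup>2 - 1) ^ i\<bar> / F m \<le>
      2 * C\<^sub>1 / C\<^sub>0 * ((16 / (peak m * sqrt (c * exp (peak m)))) ^ i * (1 + moment_const i) + (4 / (c * exp (peak m))) ^ i * moment_const i)"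
proof -
  interpret S: saddle c \<kappa> "peak m" m
    using c m v peak[OF m] by unfold_locales auto
  define K where "K = S.K"
  have KK: "c * exp (peak m) = K" by (simp add: K_def S.K_def)
  define w0 where "w0 u = exp (\<kappa> * u - c * exp u)" for u
  have w: "S.w u = w0 u * u ^ m" for u by (simp add: S.w_def w0_def)
  have low: "\<phi> u * u ^ m \<ge> C\<^sub>0 * (S.s u ^ (2 * 0) * S.w u) - 4 * (C\<^sub>0 + C\<^sub>1) * (S.s u ^ (2 * 1) * S.w u)" if u: "u \<in> {0..}" for u
  proof -
    have w0: "w0 u \<ge> 0" by (simp add: w0_def)
    have "\<phi> u \<ge> C\<^sub>0 * w0 u - (C\<^sub>0 + C\<^sub>1) * ((2 * S.s u)\<^sup>2 * w0 u)"
    proof (cases "u \<ge> U")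
      case True
      moreover have "0 \<le> (C\<^sub>0 + C\<^sub>1) * ((2 * S.s u)\<^sup>2 * w0 u)" using C0 C1 w0 by simp
      ultimately show ?thesis using lower[of u] u unfolding w0_def[symmetric] by (smt (verit) atLeast_iff)
    next
      case False
      then have "1 * w0 u \<le> (2 * S.s u)\<^sup>2 * w0 u" using v by (intro mult_right_mono S.s_left w0) auto
      then have "(C\<^sub>0 + C\<^sub>1) * (1 * w0 u) \<le> (C\<^sub>0 + C\<^sub>1) * ((2 * S.s u)\<^sup>2 * w0 u)" using C0 C1 by (intro mult_left_mono) auto
      moreover have "\<bar>\<phi> u\<bar> \<le> C\<^sub>1 * w0 u" using upper[of u] u unfolding w0_def[symmetric] by simp
      ultimately show ?thesis by (simp add: algebra_simps)
    qed
    then have "(C\<^sub>0 * w0 u - (C\<^sub>0 + C\<^sub>1) * ((2 * S.s u)\<^sup>2 * w0 u)) * u ^ m \<le> \<phi> u * u ^ m"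
      using u by (intro mult_right_mono) auto
    then show ?thesis by (simp add: w algebra_simps power2_eq_square)
  qed
  have i0: "set_integrable lborel {0..} (\<lambda>u. C\<^sub>0 * (S.s u ^ (2 * 0) * S.w u))"
    and i1: "set_integrable lborel {0..} (\<lambda>u. 4 * (C\<^sub>0 + C\<^sub>1) * (S.s u ^ (2 * 1) * S.w u))"
    using S.integrable_s[of "2 * 0"] S.integrable_s[of "2 * 1"] by simp_all
  have "C\<^sub>0 * S.M 0 - 4 * (C\<^sub>0 + C\<^sub>1) * S.M 1 = (LINT u:{0..}|lborel. C\<^sub>0 * (S.s u ^ (2 * 0) * S.w u) - 4 * (C\<^sub>0 + C\<^sub>1) * (S.s u ^ (2 * 1) * S.w u))"
    unfolding S.M_def using i0 i1 by (subst set_integral_diff(2)) simp_all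
  also have "\<dots> \<le> F m"
    unfolding F_def by (rule set_integral_mono[OF set_integral_diff(1)[OF i0 i1] integrable_power low])
  finally have 1: "C\<^sub>0 * S.M 0 - 4 * (C\<^sub>0 + C\<^sub>1) * S.M 1 \<le> F m" .
  have "K * S.M 1 \<le> 3 * S.M 0" using S.M_le[of 1] K by (simp add: KK K_def)
  then have "(C\<^sub>0 + C\<^sub>1) * (K * S.M 1) \<le> (C\<^sub>0 + C\<^sub>1) * (3 * S.M 0)" using C0 C1 by (intro mult_left_mono) auto
  then have "8 * (C\<^sub>0 + C\<^sub>1) * (K * S.M 1) \<le> (24 * (C\<^sub>0 + C\<^sub>1)) * S.M 0" by (simp add: algebra_simps)
  also have "\<dots> \<le> (K * C\<^sub>0) * S.M 0" using K(4) S.M_nonneg by (intro mult_right_mono) (simp_all add: KK)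
  finally have "K * (8 * (C\<^sub>0 + C\<^sub>1) * S.M 1) \<le> K * (C\<^sub>0 * S.M 0)" by (simp add: mult_ac)
  then have "8 * (C\<^sub>0 + C\<^sub>1) * S.M 1 \<le> C\<^sub>0 * S.M 0" using S.K_pos by (simp add: K_def)
  with 1 have 2: "C\<^sub>0 / 2 * S.M 0 \<le> F m" by argo
  moreover have pos: "C\<^sub>0 / 2 * S.M 0 > 0" using C0 S.M_0_pos by simp
  ultimately show F: "F m > 0" by simp
  define B where "B = (16 / (peak m * sqrt K)) ^ i * (1 + moment_const i) + (4 / K) ^ i * moment_const i"
  have B: "(LINT u:{0..}|lborel. \<bar>(u / peak m)\<^sup>2 - 1\<bar> ^ i * S.w u) \<le> B * S.M 0"
    unfolding B_def K_def using K unfolding KK K_def by (intro S.integral_ratio_le) auto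
  have ii: "set_integrable lborel {0..} (\<lambda>u. C\<^sub>1 * (\<bar>(u / peak m)\<^sup>2 - 1\<bar> ^ i * S.w u))"
    using S.integrable_ratio by simp
  have bd: "\<bar>\<phi> u * u ^ m * ((u / peak m)\<^sup>2 - 1) ^ i\<bar> \<le> C\<^sub>1 * (\<bar>(u / peak m)\<^sup>2 - 1\<bar> ^ i * S.w u)" if "u \<in> {0..}" for u
  proof -
    have "\<bar>\<phi> u\<bar> * (u ^ m * \<bar>(u / peak m)\<^sup>2 - 1\<bar> ^ i) \<le> (C\<^sub>1 * w0 u) * (u ^ m * \<bar>(u / peak m)\<^sup>2 - 1\<bar> ^ i)"
      using upper[of u] that unfolding w0_def[symmetric] by (intro mult_right_mono) auto
    then show ?thesis using that by (simp add: abs_mult power_abs w mult_ac)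
  qed
  have jj: "set_integrable lborel {0..} (\<lambda>u. \<phi> u * u ^ m * ((u / peak m)\<^sup>2 - 1) ^ i)"
  proof (rule set_integrable_bound[OF ii])
    have *: "continuous_on {0..} (\<lambda>u. \<phi> u * u ^ m * ((u / peak m)\<^sup>2 - 1) ^ i)"
      using v by (intro continuous_intros cont) auto
    show "set_borel_measurable lborel {0..} (\<lambda>u. \<phi> u * u ^ m * ((u / peak m)\<^sup>2 - 1) ^ i)"
      using borel_measurable_continuous_on_indicator[OF _ *] by (simp add: set_borel_measurable_def)
  qed (use bd in \<open>force intro!: AE_I2\<close>)
  have "\<bar>LINT u:{0..}|lborel. \<phi> u * u ^ m * ((u / peak m)\<^sup>2 - 1) ^ i\<bar> \<le> (LINT u:{0..}|lborel. \<bar>\<phi> u * u ^ m * ((u / peak m)\<^sup>2 - 1) ^ i\<bar>)"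
    using set_integral_norm_bound[OF jj] by simp
  also have "\<dots> \<le> (LINT u:{0..}|lborel. C\<^sub>1 * (\<bar>(u / peak m)\<^sup>2 - 1\<bar> ^ i * S.w u))"
    by (rule set_integral_mono[OF set_integrable_abs[OF jj] ii bd])
  also have "\<dots> \<le> C\<^sub>1 * (B * S.M 0)" using B C1 by simp
  also have "\<dots> = 2 * C\<^sub>1 / C\<^sub>0 * B * (C\<^sub>0 / 2 * S.M 0)" using C0 by simp
  also have "\<dots> \<le> 2 * C\<^sub>1 / C\<^sub>0 * B * F m"
  proof (intro mult_left_mono[OF 2])
    have "moment_const i \<ge> 0" unfolding moment_const_def by (intro prod_nonneg) auto
    then show "0 \<le> 2 * C\<^sub>1 / C\<^sub>0 * B" unfolding B_def using C0 C1 v S.K_pos by (simp add: K_def)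
  qed
  finally show "\<bar>LINT u:{0..}|lborel. \<phi> u * u ^ m * ((u / peak m)\<^sup>2 - 1) ^ i\<bar> / F m \<le>
      2 * C\<^sub>1 / C\<^sub>0 * ((16 / (peak m * sqrt (c * exp (peak m)))) ^ i * (1 + moment_const i) + (4 / (c * exp (peak m))) ^ i * moment_const i)"
    using F unfolding KK B_def by (simp add: pos_divide_le_eq)
qed

text \<open>With \<open>K = c * exp v\<close> the saddle equation makes \<open>m\<close> comparable
  with \<open>v * K\<close>. After multiplication by \<open>sqrt m\<close> the two scales in
  \<open>moment_bound\<close> become \<open>O(1 / sqrt v)\<close>: the first by
  \<open>m \<le> 2 * v * K\<close>, the second because also
  \<open>K \<ge> c * v^2 / 2\<close>.\<close>

lemma moments_concentrate:
  "(\<lambda>m. sqrt (real m) ^ i * ((LINT u:{0..}|lborel. \<phi> u * u ^ m * ((u / peak m)\<^sup>2 - 1) ^ i) / F m))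
     \<longlonglongrightarrow> (if i = 0 then 1 else 0)"
  and F_pos: "eventually (\<lambda>m. F m > 0) sequentially"
  and peak_square: "(\<lambda>m. (peak m)\<^sup>2 / real m) \<longlonglongrightarrow> 0"
proof -
  have big: "\<forall>\<^sub>F m in sequentially. m > 0 \<and> peak m \<ge> 1 \<and> peak m \<ge> U + 1 \<and> c * exp (peak m) \<ge> Z" for Z
  proof -
    have "filterlim (\<lambda>m. c * exp (peak m)) at_top sequentially"
      by (intro filterlim_tendsto_pos_mult_at_top[OF tendsto_const c] filterlim_compose[OF exp_at_top peak_at_top])
    then show ?thesis using peak_at_top
      by (intro eventually_conj eventually_gt_at_top) (auto simp: filterlim_at_top)
  qed
  \<comment> \<open>\<open>Z\<close> collects the thresholds of \<open>moment_bound\<close>; its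
    entry \<open>2 * \<bar>\<kappa>\<bar>\<close> puts \<open>K - \<kappa>\<close> between
    \<open>K / 2\<close> and \<open>2 * K\<close>.\<close>
  define Z where "Z = max (max 2 (2 * real i)) (max (24 * (C\<^sub>0 + C\<^sub>1) / C\<^sub>0) (2 * \<bar>\<kappa>\<bar>))"
  have big': "\<forall>\<^sub>F m in sequentially. m > 0 \<and> peak m \<ge> 1 \<and> peak m \<ge> U + 1 \<and> c * exp (peak m) \<ge> 1 \<and> c * exp (peak m) \<ge> 2 * real i
     \<and> c * exp (peak m) \<ge> 2 \<and> c * exp (peak m) * C\<^sub>0 \<ge> 24 * (C\<^sub>0 + C\<^sub>1) \<and> c * exp (peak m) \<ge> 2 * \<bar>\<kappa>\<bar>"
    using big[of Z]
  proof eventually_elim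
    case (elim m)
    then have "c * exp (peak m) \<ge> 24 * (C\<^sub>0 + C\<^sub>1) / C\<^sub>0" by (simp add: Z_def)
    then show ?case using elim C0 by (simp add: Z_def pos_divide_le_eq)
  qed
  show F: "eventually (\<lambda>m. F m > 0) sequentially"
    using big' by eventually_elim (rule moment_bound(1)[of _ i], auto)
  have Kv: "c * exp (peak m) \<ge> c * (peak m)\<^sup>2 / 2" if "peak m \<ge> 1" for m
    using exp_ge_square[of "peak m"] that c by simp
  have "(\<lambda>m. 4 / (c * peak m)) \<longlonglongrightarrow> 0"
    by (intro tendsto_divide_0[OF tendsto_const] filterlim_at_top_imp_at_infinity
      filterlim_tendsto_pos_mult_at_top[OF tendsto_const c peak_at_top])
  then show "(\<lambda>m. (peak m)\<^sup>2 / real m) \<longlonglongrightarrow> 0"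
  proof (rule Lim_null_comparison[rotated])
    show "\<forall>\<^sub>F m in sequentially. norm ((peak m)\<^sup>2 / real m) \<le> 4 / (c * peak m)"
      using big'
    proof eventually_elim
      case (elim m)
      have "c * (peak m)\<^sup>2 / 2 \<le> c * exp (peak m)" using elim Kv by blast
      then have "c * (peak m)\<^sup>2 / 4 \<le> c * exp (peak m) - \<kappa>" using elim by linarith
      then have "peak m * (c * (peak m)\<^sup>2 / 4) \<le> real m" using peak[of m] elim by (metis mult_left_mono less_eq_real_def)
      then show ?case using elim c by (simp add: field_simps power2_eq_square)
    qed
  qed
  show "(\<lambda>m. sqrt (real m) ^ i * ((LINT u:{0..}|lborel. \<phi> u * u ^ m * ((u / peak m)\<^sup>2 - 1) ^ i) / F m))
     \<longlonglongrightarrow> (if i = 0 then 1 else 0)"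
  proof (cases "i = 0")
    case True
    have "\<forall>\<^sub>F m in sequentially. 1 = sqrt (real m) ^ i * ((LINT u:{0..}|lborel. \<phi> u * u ^ m * ((u / peak m)\<^sup>2 - 1) ^ i) / F m)"
      using F by eventually_elim (simp add: True F_def)
    then show ?thesis using True by (auto intro: Lim_transform_eventually[OF tendsto_const])
  next
    case False
    define D :: real where "D = moment_const i"
    have D: "D \<ge> 0" unfolding D_def moment_const_def by (intro prod_nonneg) auto
    define E where "E m = 2 * C\<^sub>1 / C\<^sub>0 * ((16 * sqrt (2 / peak m)) ^ i * (1 + D) + (4 * sqrt (4 / (c * peak m))) ^ i * D)" for m
    have "(\<lambda>m. sqrt (2 / peak m)) \<longlonglongrightarrow> sqrt 0" "(\<lambda>m. sqrt (4 / (c * peak m))) \<longlonglongrightarrow> sqrt 0"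
      by (intro tendsto_real_sqrt tendsto_divide_0[OF tendsto_const] filterlim_at_top_imp_at_infinity peak_at_top
        filterlim_tendsto_pos_mult_at_top[OF tendsto_const c peak_at_top])+
    then have "E \<longlonglongrightarrow> 2 * C\<^sub>1 / C\<^sub>0 * ((16 * sqrt 0) ^ i * (1 + D) + (4 * sqrt 0) ^ i * D)"
      unfolding E_def by (intro tendsto_mult tendsto_add tendsto_power tendsto_const)
    then have "E \<longlonglongrightarrow> 0" using False by (simp add: power_0_left)
    moreover have "\<forall>\<^sub>F m in sequentially. norm (sqrt (real m) ^ i * ((LINT u:{0..}|lborel. \<phi> u * u ^ m * ((u / peak m)\<^sup>2 - 1) ^ i) / F m)) \<le> E m"
      using big' F
    proof eventually_elim
      case (elim m)
      define K where "K = c * exp (peak m)"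
      define v where "v = peak m"
      have v: "v \<ge> 1" and K: "K \<ge> 1" using elim by (simp_all add: v_def K_def)
      have "v * (K - \<kappa>) \<le> v * (2 * K)" using elim v by (intro mult_left_mono) (auto simp: K_def)
      then have mK: "real m \<le> 2 * v * K" using peak[of m] elim by (simp add: K_def v_def mult_ac)
      have Kv': "c * v\<^sup>2 \<le> 2 * K" using Kv[of m] elim unfolding K_def v_def by simp
      have 1: "sqrt (real m) * (16 / (v * sqrt K)) \<le> 16 * sqrt (2 / v)"
      proof -
        have "sqrt (real m) \<le> sqrt (2 / v) * (v * sqrt K)"
        proof (rule real_le_lsqrt)
          have "(sqrt (2 / v) * (v * sqrt K))\<^sup>2 = 2 / v * (v\<^sup>2 * K)"
            using v K by (simp add: power_mult_distrib)
          also have "\<dots> = 2 * v * K" using v by (simp add: power2_eq_square)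
          finally show "real m \<le> (sqrt (2 / v) * (v * sqrt K))\<^sup>2" using mK by simp
        qed (use v K in auto)
        then show ?thesis using v K by (simp add: field_simps)
      qed
      have 2: "sqrt (real m) * (4 / K) \<le> 4 * sqrt (4 / (c * v))"
      proof -
        have "sqrt (real m) \<le> sqrt (4 / (c * v)) * K"
        proof (rule real_le_lsqrt)
          have "real m * (c * v) \<le> (2 * v * K) * (c * v)" using mK c v by (intro mult_right_mono) auto
          also have "\<dots> = 2 * K * (c * v\<^sup>2)" by (simp add: power2_eq_square)
          also have "\<dots> \<le> 2 * K * (2 * K)" using Kv' K by (intro mult_left_mono) auto
          finally have "real m \<le> 4 / (c * v) * K\<^sup>2" using c v by (simp add: field_simps power2_eq_square)
          then show "real m \<le> (sqrt (4 / (c * v)) * K)\<^sup>2" using c v by (simp add: power_mult_distrib)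
        qed (use c v K in auto)
        then show ?thesis using K by (simp add: field_simps)
      qed
      let ?I = "\<bar>LINT u:{0..}|lborel. \<phi> u * u ^ m * ((u / peak m)\<^sup>2 - 1) ^ i\<bar> / F m"
      have "?I \<le> 2 * C\<^sub>1 / C\<^sub>0 * ((16 / (v * sqrt K)) ^ i * (1 + D) + (4 / K) ^ i * D)"
        unfolding K_def v_def D_def using elim by (intro moment_bound(2)) auto
      then have "sqrt (real m) ^ i * ?I \<le> sqrt (real m) ^ i * (2 * C\<^sub>1 / C\<^sub>0 * ((16 / (v * sqrt K)) ^ i * (1 + D) + (4 / K) ^ i * D))"
        by (intro mult_left_mono) auto
      also have "\<dots> = 2 * C\<^sub>1 / C\<^sub>0 * ((sqrt (real m) * (16 / (v * sqrt K))) ^ i * (1 + D) + (sqrt (real m) * (4 / K)) ^ i * D)"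
        unfolding power_mult_distrib by (simp only: distrib_left mult_ac)
      also have "\<dots> \<le> E m"
        unfolding E_def v_def[symmetric] using C0 C1 D v K
        by (intro mult_left_mono add_mono mult_right_mono power_mono 1 2) auto
      finally show ?case using elim by (simp add: abs_mult power_abs)
    qed
    ultimately show ?thesis using False by (auto intro: Lim_null_comparison)
  qed
qed

end

subsection \<open>The completed series\<close>

lemma integral_exp_neg_complex:
  fixes z :: complex
  assumes "Re z > 0"
  shows "set_integrable lborel {0..} (\<lambda>u. exp (- z * of_real u))"
    and "(LINT u:{0..}|lborel. exp (- z * of_real u)) = 1 / z"
proof -
  have norm: "norm (exp (- z * of_real u)) = exp (- Re z * u)" for u by simp
  have cont: "continuous_on {0..} (\<lambda>u. exp (- z * of_real u))" by (intro continuous_intros)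
  show int: "set_integrable lborel {0..} (\<lambda>u. exp (- z * of_real u))"
    by (rule set_integrable_bound[OF set_integrable_exp_neg[OF assms]])
       (use borel_measurable_continuous_on_indicator[OF _ cont] norm in \<open>auto simp: set_borel_measurable_def\<close>)
  have z: "z \<noteq> 0" using assms by auto
  have "(LINT u:{0..}|lborel. exp (- z * of_real u)) = 0 - (- (exp (- z * of_real 0) / z))"
  proof (rule set_integral_FTC_at_top[OF _ int cont])
    show "((\<lambda>u. - (exp (- z * of_real u) / z)) has_vector_derivative exp (- z * of_real u)) (at u)" for u
    proof -
      have "((\<lambda>x. - (exp (- z * x) / z)) has_field_derivative exp (- z * of_real u)) (at (of_real u))"
        using z by (auto intro!: derivative_eq_intros)
      from has_vector_derivative_real_field[OF this] show ?thesis by (simp add: o_def)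
    qed
    have "((\<lambda>u. exp (- Re z * u)) \<longlongrightarrow> 0) at_top"
      using assms by real_asymp
    then have "((\<lambda>u. exp (- z * of_real u)) \<longlongrightarrow> 0) at_top"
      by (subst tendsto_norm_zero_iff[symmetric]) (simp add: norm)
    then have "((\<lambda>u. - (exp (- z * of_real u) / z)) \<longlongrightarrow> - (0 / z)) at_top"
      using z by (intro tendsto_intros) 
    then show "((\<lambda>u. - (exp (- z * of_real u) / z)) \<longlongrightarrow> 0) at_top" by simp
  qed
  then show "(LINT u:{0..}|lborel. exp (- z * of_real u)) = 1 / z" by simp
qed

lemma integral_split_at_0:
  fixes G :: "real \<Rightarrow> 'a :: {banach, second_countable_topology}"
  assumes "set_integrable lborel {0..} G" "set_integrable lborel {0..} (\<lambda>u. G (- u))"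
  shows "integrable lborel G"
    and "integral\<^sup>L lborel G = (LINT u:{0..}|lborel. G u) + (LINT u:{0..}|lborel. G (- u))"
proof -
  let ?f = "\<lambda>u::real. indicator {0..} u *\<^sub>R G (- u)"
  have f: "(\<lambda>u. ?f (0 + (-1) * u)) = (\<lambda>u. indicator {..0} u *\<^sub>R G u)"
    by (auto simp: fun_eq_iff indicator_def)
  have "integrable lborel ?f" using assms(2) by (simp add: set_integrable_def)
  then have "integrable lborel (\<lambda>u. ?f (0 + (-1) * u))" by (rule lborel_integrable_real_affine) simp
  then have neg: "set_integrable lborel {..0} G" unfolding f by (simp add: set_integrable_def)
  have "(LINT u:{0..}|lborel. G (- u)) = (LINT u:{..0}|lborel. G u)"
    unfolding set_lebesgue_integral_def using lborel_integral_real_affine[of "-1" ?f 0]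
    unfolding f by simp
  moreover have ae: "AE x in lborel. \<not> (x \<in> {0..} \<and> x \<in> {..0::real})"
    using AE_lborel_singleton[of 0] by eventually_elim auto
  have un: "{0..} \<union> {..0} = (UNIV :: real set)" by auto
  show "integrable lborel G"
    using set_integrable_Un[OF assms(1) neg] unfolding un by (simp add: set_integrable_def)
  have "(LINT u:{0..} \<union> {..0}|lborel. G u) = (LINT u:{0..}|lborel. G u) + (LINT u:{..0}|lborel. G u)"
    by (rule set_integral_Un_AE[OF ae _ _ assms(1) neg]) auto
  ultimately show "integral\<^sup>L lborel G = (LINT u:{0..}|lborel. G u) + (LINT u:{0..}|lborel. G (- u))"
    unfolding un by (simp add: set_lebesgue_integral_def)
qed

lemma integral_exp_substitution:
  fixes f :: "real \<Rightarrow> complex"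
  assumes h: "h > 0" and cont: "\<And>t. t > 0 \<Longrightarrow> isCont f t"
    and int: "set_integrable lborel {0<..} f" "integrable lborel (\<lambda>u. (h * exp u) *\<^sub>R f (h * exp u))"
  shows "(LINT t:{0<..}|lborel. f t) = (LINT u|lborel. (h * exp u) *\<^sub>R f (h * exp u))"
proof -
  have "(LBINT x=0..\<infinity>. f x) = (LBINT x=-\<infinity>..\<infinity>. (h * exp x) *\<^sub>R f (h * exp x))"
  proof (rule interval_integral_substitution_integrable)
    show "((ereal \<circ> (\<lambda>x. h * exp x) \<circ> real_of_ereal) \<longlongrightarrow> 0) (at_right (- \<infinity>))"
    proof -
      have "((\<lambda>x. h * exp x) \<longlongrightarrow> 0) at_bot" using tendsto_mult_right_zero[OF exp_at_bot] by simp
      then show ?thesis unfolding zero_ereal_def by (simp only: ereal_tendsto_simps)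
    qed
    show "((ereal \<circ> (\<lambda>x. h * exp x) \<circ> real_of_ereal) \<longlongrightarrow> \<infinity>) (at_left \<infinity>)"
      unfolding ereal_tendsto_simps by (intro filterlim_tendsto_pos_mult_at_top[OF tendsto_const h] exp_at_top)
    show "set_integrable lborel (einterval (- \<infinity>) \<infinity>) (\<lambda>x. (h * exp x) *\<^sub>R f (h * exp x))"
      using int(2) by (simp add: set_integrable_def einterval_def)
    show "set_integrable lborel (einterval 0 \<infinity>) f"
      using int(1) by (simp add: einterval_def greaterThan_def)
  qed (use h cont in \<open>auto intro!: derivative_eq_intros\<close>)
  moreover have "(LBINT x=0..\<infinity>. f x) = (LINT t:{0<..}|lborel. f t)"
    unfolding zero_ereal_def interval_integral_to_infinity_eq ..
  moreover have "(LBINT x=-\<infinity>..\<infinity>. (h * exp x) *\<^sub>R f (h * exp x)) = (LINT u|lborel. (h * exp u) *\<^sub>R f (h * exp u))"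
    by (simp add: interval_lebesgue_integral_def set_lebesgue_integral_def einterval_def)
  ultimately show ?thesis by simp
qed

text \<open>The identity theorem for the difference, with its singularities removed, gives equality
  off isolated points. At such a point a nicely meromorphic function is determined by its punctured
  neighbourhood: it takes the limit if there is one, and 0 at a pole.\<close>

lemma nicely_meromorphic_eqI:
  assumes f: "f nicely_meromorphic_on UNIV" and g: "g nicely_meromorphic_on UNIV"
    and eq: "\<And>s. Re s > \<sigma> \<Longrightarrow> f s = g s"
  shows "f = g"
proof
  fix z
  define D where "D = (\<lambda>z. f z - g z)"
  have mero: "D meromorphic_on UNIV"
    using f g unfolding D_def nicely_meromorphic_on_def by (intro meromorphic_intros) auto
  define s0 where "s0 = complex_of_real (\<sigma> + 1)"
  have "open {s. Re s > \<sigma>}" by (rule open_halfspace_Re_gt)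
  then have "\<forall>\<^sub>F s in nhds s0. Re s > \<sigma>"
    by (intro eventually_nhds_in_open[of "{s. Re s > \<sigma>}", simplified]) (auto simp: s0_def)
  then have ev0: "\<forall>\<^sub>F s in at s0. D s = 0"
    by (auto simp: eventually_at_filter D_def eq elim: eventually_mono)
  have sing: "isolated_singularity_at D z" for z
    using mero by (metis UNIV_I meromorphic_onE)
  from ev0 eventually_remove_sings_eq_at[OF sing[of s0]]
  have "\<forall>\<^sub>F s in at s0. remove_sings D s = 0" by eventually_elim simp
  then have "\<exists>\<^sub>F s in at s0. remove_sings D s = 0"
    by (rule eventually_frequently[rotated]) auto
  from frequently_eq_meromorphic_imp_constant[OF this remove_sings_nicely_meromorphic[OF mero]]
  have "remove_sings D w = 0" for w by auto
  with eventually_remove_sings_eq_at[OF sing[of z]] have ev: "\<forall>\<^sub>F s in at z. f s = g s"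
    by (auto simp: D_def elim: eventually_mono)
  have "is_pole f z \<longleftrightarrow> is_pole g z" by (rule is_pole_cong[OF ev refl])
  moreover have "(f \<longlongrightarrow> l) (at z) \<longleftrightarrow> (g \<longlongrightarrow> l) (at z)" for l
    by (rule tendsto_cong[OF ev])
  moreover have "is_pole f z \<Longrightarrow> \<not> (f \<longlongrightarrow> l) (at z)" for l
    using not_tendsto_and_filterlim_at_infinity[of "at z" f l] by (auto simp: is_pole_def)
  ultimately show "f z = g z"
    using f g unfolding nicely_meromorphic_on_def by (metis LIM_unique UNIV_I)
qed

section \<open>The kernel of the Mellin integral and its transform\<close>

context good_dirichlet_series
begin

definition b :: "nat \<Rightarrow> real" where "b m = Re (\<alpha> (n\<^sub>0 + m))"
text \<open>The substitution \<open>t = h * exp u\<close> turns the involution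
  \<open>t \<mapsto> 1 / (N t)\<close> into \<open>u \<mapsto> - u\<close>.\<close>

definition h :: real where "h = 1 / sqrt N"
definition \<kappa> :: real where "\<kappa> = k / 2"
definition c :: real where "c = pi * real n\<^sub>0 * h"
definition \<beta> :: real where "\<beta> = Re (\<alpha> 0)"
definition B :: "real \<Rightarrow> real" where "B q = (\<Sum>m. b m * q ^ m)"
text \<open>The kernel \<open>(f (h exp u) - f \<infinity>) * exp (\<kappa> u)\<close>, with the
  first exponential of the series pulled out, so that the factor with \<open>B\<close> tends to the
  nonzero \<open>b 0\<close> as \<open>u\<close> grows.\<close>

definition \<phi> :: "real \<Rightarrow> real" where
  "\<phi> u = exp (\<kappa> * u) * (exp (- c * exp u) * B (exp (- pi * h * exp u)))"

lemma h_pos: "h > 0" using N_pos by (simp add: h_def)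

lemma c_pos: "c > 0" using h_pos n0_pos by (simp add: c_def)

lemma alpha_b: "\<alpha> (n\<^sub>0 + m) = of_real (b m)" unfolding b_def using real_coeffs by simp

lemma alpha_0: "\<alpha> 0 = of_real \<beta>" unfolding \<beta>_def using real_coeffs by simp

lemma b_0: "b 0 \<noteq> 0" using leading_coeff alpha_b[of 0] by auto

lemma exp_term_eq: "exp_term \<alpha> t (n\<^sub>0 + m) = of_real (exp (- pi * real n\<^sub>0 * t) * (b m * exp (- pi * t) ^ m))"
proof -
  have "exp (- pi * real (n\<^sub>0 + m) * t) = exp (- pi * real n\<^sub>0 * t) * exp (- pi * t) ^ m"
    by (simp add: exp_of_nat_mult[symmetric] exp_add[symmetric] algebra_simps)
  then show ?thesis unfolding exp_term_def alpha_b by simp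
qed

lemma summable_b: "summable (\<lambda>m. b m * q ^ m)" if "0 < q" "q < 1"
proof -
  define t where "t = - ln q / pi"
  have t: "t > 0" "exp (- pi * t) = q" using that by (auto simp: t_def divide_neg_pos)
  have "summable (\<lambda>m. complex_of_real (exp (- pi * real n\<^sub>0 * t) * (b m * q ^ m)))"
    using exp_summable[OF t(1)] unfolding exp_term_eq t(2) .
  then have "summable (\<lambda>m. exp (- pi * real n\<^sub>0 * t) * (b m * q ^ m))"
    by (simp only: summable_of_real_iff)
  then show ?thesis by (subst (asm) summable_cmult_iff) auto
qed

lemma exp_series_eq:
  assumes "t > 0"
  shows "exp_series n\<^sub>0 \<alpha> t = of_real (\<beta> + exp (- pi * real n\<^sub>0 * t) * B (exp (- pi * t)))"
proof -
  have "summable (\<lambda>m. b m * exp (- pi * t) ^ m)" using assms by (intro summable_b) auto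
  then have "(\<Sum>m. exp_term \<alpha> t (n\<^sub>0 + m)) = of_real (exp (- pi * real n\<^sub>0 * t) * B (exp (- pi * t)))"
    unfolding exp_term_eq B_def by (subst suminf_of_real[symmetric]) (auto simp: suminf_mult intro!: summable_mult)
  then show ?thesis by (simp add: exp_series_def alpha_0)
qed

lemma isCont_B: "\<bar>q\<bar> < 1 \<Longrightarrow> isCont B q"
  unfolding B_def[abs_def]
  by (rule isCont_powser[of b "(1 + \<bar>q\<bar>) / 2"]) (use summable_b[of "(1 + \<bar>q\<bar>) / 2"] in auto)

lemma isCont_\<phi>: "isCont \<phi> u"
proof -
  have "isCont (\<lambda>u. B (exp (- pi * h * exp u))) u"
  proof (rule isCont_o2[where g = B])
    show "isCont B (exp (- pi * h * exp u))" using h_pos by (intro isCont_B) simp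
  qed (intro continuous_intros)
  then show ?thesis unfolding \<phi>_def by (intro continuous_intros)
qed

lemma continuous_on_\<phi>: "continuous_on A \<phi>"
  by (intro continuous_at_imp_continuous_on ballI isCont_\<phi>)

lemma exp_series_exp:
  "exp_series n\<^sub>0 \<alpha> (h * exp u) = of_real (\<beta> + exp (- \<kappa> * u) * \<phi> u)"
proof -
  have "- pi * real n\<^sub>0 * (h * exp u) = - c * exp u" "- pi * (h * exp u) = - pi * h * exp u"
    by (simp_all add: c_def)
  moreover have "exp (- \<kappa> * u) * (exp (\<kappa> * u) * x) = x" for x
    by (simp add: mult.assoc[symmetric] exp_add[symmetric])
  ultimately show ?thesis
    unfolding \<phi>_def using h_pos by (subst exp_series_eq) (simp_all only: mult_pos_pos exp_gt_zero)
qed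

text \<open>Modularity at \<open>t = h * exp u\<close>, where
  \<open>N powr (k / 2) * h powr k = 1\<close>. The constant term \<beta> was removed from the
  kernel and reappears as two exponentials, the source of the polar terms.\<close>

lemma \<phi>_reflect: "\<phi> (- u) = \<epsilon> * \<phi> u + \<beta> * (\<epsilon> * exp (\<kappa> * u) - exp (- \<kappa> * u))"
proof -
  have 1: "1 / (N * (h * exp u)) = h * exp (- u)"
    using N_pos by (simp add: h_def exp_minus field_simps)
  have "ln h = - ln N / 2" using N_pos by (simp add: h_def ln_div ln_sqrt)
  then have 2: "N powr (k / 2) * (h * exp u) powr k = exp (k * u)"
    using N_pos h_pos by (simp add: powr_def ln_mult exp_add[symmetric] field_simps)
  have "exp_series n\<^sub>0 \<alpha> (h * exp (- u)) = of_real (\<epsilon> * exp (k * u)) * exp_series n\<^sub>0 \<alpha> (h * exp u)"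
    using modularity[of "h * exp u"] h_pos unfolding 1 mult.assoc 2 by simp
  then have "complex_of_real (\<beta> + exp (\<kappa> * u) * \<phi> (- u)) = of_real ((\<epsilon> * exp (k * u)) * (\<beta> + exp (- \<kappa> * u) * \<phi> u))"
    unfolding exp_series_exp by simp
  then have "\<beta> + exp (\<kappa> * u) * \<phi> (- u) = (\<epsilon> * exp (k * u)) * (\<beta> + exp (- \<kappa> * u) * \<phi> u)"
    by (simp only: of_real_eq_iff)
  then have "exp (- \<kappa> * u) * (\<beta> + exp (\<kappa> * u) * \<phi> (- u)) = exp (- \<kappa> * u) * ((\<epsilon> * exp (k * u)) * (\<beta> + exp (- \<kappa> * u) * \<phi> u))"
    by simp
  moreover have "exp (- \<kappa> * u) * exp (\<kappa> * u) = 1" "exp (- \<kappa> * u) * exp (k * u) = exp (\<kappa> * u)"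
    by (simp_all add: exp_add[symmetric] \<kappa>_def field_simps)
  moreover have "x = \<epsilon> * y + \<beta> * (\<epsilon> * P - E1)"
    if "E1 * (\<beta> + P * x) = E1 * ((\<epsilon> * Ek) * (\<beta> + E1 * y))" "E1 * P = 1" "E1 * Ek = P" for x y P E1 Ek :: real
    using that by algebra
  ultimately show ?thesis by blast
qed

text \<open>For \<open>u \<ge> 0\<close> the arguments of \<open>B\<close> stay in a compact subset
  of its disc of convergence, which gives the upper constant; the limit \<open>B 0 = b 0\<close>
  gives the lower one. The factor \<open>sgn (b 0)\<close> makes the tail positive.\<close>

lemma peaked:
  obtains C0 C1 U where "peaked_density (\<lambda>u. sgn (b 0) * \<phi> u) c \<kappa> C0 C1 U"
proof -
  define q1 where "q1 = exp (- pi * h)"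
  have q1: "0 < q1" "q1 < 1" using h_pos by (auto simp: q1_def)
  have q: "exp (- pi * h * exp u) \<in> {0..q1}" if "u \<ge> 0" for u
    using that h_pos by (auto simp: q1_def)
  have "continuous_on {0..q1} B" using q1 by (intro continuous_at_imp_continuous_on ballI isCont_B) auto
  then have "compact (B ` {0..q1})" by (intro compact_continuous_image) auto
  then obtain C1 where C1: "C1 > 0" "\<And>q. q \<in> {0..q1} \<Longrightarrow> \<bar>B q\<bar> \<le> C1"
    using compact_imp_bounded[of "B ` {0..q1}"] by (auto simp: bounded_pos)
  have B0: "B 0 = b 0" unfolding B_def using powser_zero[of b] by simp
  have "((\<lambda>u. exp (- pi * h * exp u)) \<longlongrightarrow> 0) at_top"
    using h_pos by real_asymp
  then have "((\<lambda>u. B (exp (- pi * h * exp u))) \<longlongrightarrow> B 0) at_top"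
    by (rule isCont_tendsto_compose[OF isCont_B, rotated]) auto
  then have "((\<lambda>u. sgn (b 0) * B (exp (- pi * h * exp u))) \<longlongrightarrow> sgn (b 0) * b 0) at_top"
    unfolding B0 by (intro tendsto_intros)
  moreover have "sgn (b 0) * b 0 > \<bar>b 0\<bar> / 2" using b_0 by (simp add: sgn_if)
  ultimately have "\<forall>\<^sub>F u in at_top. sgn (b 0) * B (exp (- pi * h * exp u)) > \<bar>b 0\<bar> / 2"
    by (rule order_tendstoD(1))
  then obtain U where U: "\<And>u. u \<ge> U \<Longrightarrow> sgn (b 0) * B (exp (- pi * h * exp u)) > \<bar>b 0\<bar> / 2"
    by (auto simp: eventually_at_top_linorder)
  have \<phi>: "\<phi> u = exp (\<kappa> * u - c * exp u) * B (exp (- pi * h * exp u))" for u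
    by (simp add: \<phi>_def exp_diff exp_minus divide_inverse)
  have "peaked_density (\<lambda>u. sgn (b 0) * \<phi> u) c \<kappa> (\<bar>b 0\<bar> / 2) C1 U"
  proof
    show "continuous_on {0..} (\<lambda>u. sgn (b 0) * \<phi> u)"
      by (intro continuous_intros continuous_on_\<phi>)
    show "\<bar>sgn (b 0) * \<phi> u\<bar> \<le> C1 * exp (\<kappa> * u - c * exp u)" if "u \<ge> 0" for u
      using C1(2)[OF q[OF that]] b_0 by (simp add: \<phi> abs_mult abs_sgn_eq mult.commute)
    show "\<bar>b 0\<bar> / 2 * exp (\<kappa> * u - c * exp u) \<le> sgn (b 0) * \<phi> u" if "u \<ge> U" for u
      using mult_right_mono[OF less_imp_le[OF U[OF that]], of "exp (\<kappa> * u - c * exp u)"] by (simp add: \<phi> mult_ac)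
  qed (use c_pos b_0 C1 in auto)
  then show ?thesis by (rule that)
qed

lemma \<phi>_bound: obtains C1 where "C1 > 0" "\<And>u. u \<ge> 0 \<Longrightarrow> \<bar>\<phi> u\<bar> \<le> C1 * exp (\<kappa> * u - c * exp u)"
proof -
  obtain C0 C1 U where "peaked_density (\<lambda>u. sgn (b 0) * \<phi> u) c \<kappa> C0 C1 U" using peaked .
  then interpret peaked_density "\<lambda>u. sgn (b 0) * \<phi> u" c \<kappa> C0 C1 U .
  show ?thesis using that[of C1] upper C1 b_0 by (simp add: abs_mult abs_sgn_eq)
qed

lemma integrable_\<phi>_mult:
  fixes g :: "real \<Rightarrow> complex"
  assumes "continuous_on {0..} g" "\<And>u. u \<ge> 0 \<Longrightarrow> norm (g u) \<le> exp (A * u)"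
  shows "set_integrable lborel {0..} (\<lambda>u. of_real (\<phi> u) * g u)"
proof -
  obtain C1 where C1: "C1 > 0" "\<And>u. u \<ge> 0 \<Longrightarrow> \<bar>\<phi> u\<bar> \<le> C1 * exp (\<kappa> * u - c * exp u)" using \<phi>_bound by blast
  show ?thesis
  proof (rule set_integrable_exp_minus_exp[OF _ c_pos])
    show "continuous_on {0..} (\<lambda>u. of_real (\<phi> u) * g u)"
      by (intro continuous_intros continuous_on_\<phi> assms)
    show "norm (of_real (\<phi> u) * g u) \<le> C1 * exp ((\<kappa> + A) * u - c * exp u)" if "u \<ge> 0" for u
    proof -
      have "\<bar>\<phi> u\<bar> * norm (g u) \<le> (C1 * exp (\<kappa> * u - c * exp u)) * exp (A * u)"
        using C1 assms(2) that by (intro mult_mono) auto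
      also have "\<dots> = C1 * exp ((\<kappa> + A) * u - c * exp u)" by (simp add: exp_add[symmetric] algebra_simps)
      finally show ?thesis by (simp add: norm_mult)
    qed
  qed
qed

definition F :: "nat \<Rightarrow> real" where "F m = (LINT u:{0..}|lborel. \<phi> u * u ^ m)"

text \<open>The decay of \<phi> beats \<open>exp (norm w * u)\<close> for every \<open>w\<close>, so
  the exponential series may be integrated termwise over the whole half-line.\<close>

lemma laplace_sums:
  fixes w :: complex
  shows "(\<lambda>m. of_real (F m / fact m) * w ^ m) sums (LINT u:{0..}|lborel. of_real (\<phi> u) * exp (w * of_real u))"
proof -
  define S where "S n u = (\<Sum>m<n. (w * of_real u) ^ m /\<^sub>R fact m)" for n u
  have Sn: "norm (S n u) \<le> exp (norm w * u)" if "u \<ge> 0" for n u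
  proof -
    have "norm (S n u) \<le> (\<Sum>m<n. (norm w * u) ^ m /\<^sub>R fact m)"
      unfolding S_def using that by (intro order_trans[OF norm_sum] sum_mono) (simp add: norm_power norm_mult)
    also have "\<dots> \<le> (\<Sum>m. (norm w * u) ^ m /\<^sub>R fact m)"
      using that by (intro sum_le_suminf summable_exp_generic) auto
    finally show ?thesis by (simp add: exp_def)
  qed
  have lim: "(\<lambda>n. S n u) \<longlonglongrightarrow> exp (w * of_real u)" for u
    unfolding S_def using exp_converges[of "w * of_real u"] by (simp add: sums_def)
  have "(\<lambda>n. LINT u|lborel. indicator {0..} u *\<^sub>R (of_real (\<phi> u) * S n u))
      \<longlonglongrightarrow> (LINT u|lborel. indicator {0..} u *\<^sub>R (of_real (\<phi> u) * exp (w * of_real u)))"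
  proof (rule integral_dominated_convergence[where w = "\<lambda>u. indicator {0..} u *\<^sub>R norm (of_real (\<phi> u) * (of_real (exp (norm w * u)) :: complex))"])
    have i: "set_integrable lborel {0..} (\<lambda>u. of_real (\<phi> u) * (of_real (exp (norm w * u)) :: complex))"
      by (rule integrable_\<phi>_mult[where A = "norm w"]) (auto intro!: continuous_intros)
    show "integrable lborel (\<lambda>u. indicator {0..} u *\<^sub>R norm (of_real (\<phi> u) * (of_real (exp (norm w * u)) :: complex)))"
      using set_integrable_norm[OF i] by (simp add: set_integrable_def)
    have "set_integrable lborel {0..} (\<lambda>u. of_real (\<phi> u) * exp (w * of_real u))"
      by (rule integrable_\<phi>_mult[where A = "norm w"])
         (auto intro!: continuous_intros simp: mult_right_mono complex_Re_le_cmod)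
    then show "(\<lambda>u. indicator {0..} u *\<^sub>R (of_real (\<phi> u) * exp (w * of_real u))) \<in> borel_measurable lborel"
      unfolding set_integrable_def by (rule borel_measurable_integrable)
    have "set_integrable lborel {0..} (\<lambda>u. of_real (\<phi> u) * S n u)" for n
      using Sn by (intro integrable_\<phi>_mult[where A = "norm w"]) (auto simp: S_def intro!: continuous_intros)
    then show "(\<lambda>u. indicator {0..} u *\<^sub>R (of_real (\<phi> u) * S n u)) \<in> borel_measurable lborel" for n
      unfolding set_integrable_def by (rule borel_measurable_integrable)
    show "AE u in lborel. (\<lambda>n. indicator {0..} u *\<^sub>R (of_real (\<phi> u) * S n u)) \<longlonglongrightarrow> indicator {0..} u *\<^sub>R (of_real (\<phi> u) * exp (w * of_real u))"
      by (intro AE_I2 tendsto_intros lim)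
    show "AE u in lborel. norm (indicator {0..} u *\<^sub>R (of_real (\<phi> u) * S n u)) \<le> indicator {0..} u *\<^sub>R norm (of_real (\<phi> u) * (of_real (exp (norm w * u)) :: complex))" for n
      using Sn by (intro AE_I2) (auto simp: indicator_def norm_mult intro!: mult_left_mono)
  qed
  moreover have "(LINT u|lborel. indicator {0..} u *\<^sub>R (of_real (\<phi> u) * S n u)) = (\<Sum>m<n. of_real (F m / fact m) * w ^ m)" for n
  proof -
    have p: "set_integrable lborel {0..} (\<lambda>u. complex_of_real (\<phi> u) * of_real u ^ m)" for m
      using power_le_exp_mult[of _ m]
      by (intro integrable_\<phi>_mult[where A = "real m"]) (auto intro!: continuous_intros simp: norm_power)
    have F: "(LINT u|lborel. indicator {0..} u *\<^sub>R (complex_of_real (\<phi> u) * of_real u ^ m)) = of_real (F m)" for m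
    proof -
      have "(LINT u|lborel. indicator {0..} u *\<^sub>R (complex_of_real (\<phi> u) * of_real u ^ m)) = (LINT u:{0..}|lborel. complex_of_real (\<phi> u * u ^ m))"
        by (simp add: set_lebesgue_integral_def)
      then show ?thesis unfolding F_def set_integral_complex_of_real .
    qed
    have "(LINT u|lborel. indicator {0..} u *\<^sub>R (of_real (\<phi> u) * S n u)) =
       (LINT u|lborel. (\<Sum>m<n. (w ^ m / fact m) * (indicator {0..} u *\<^sub>R (complex_of_real (\<phi> u) * of_real u ^ m))))"
      by (intro Bochner_Integration.integral_cong)
         (auto simp: S_def sum_distrib_left scaleR_sum_right power_mult_distrib scaleR_conv_of_real field_simps intro!: sum.cong)
    also have "\<dots> = (\<Sum>m<n. (w ^ m / fact m) * of_real (F m))"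
    proof (subst Bochner_Integration.integral_sum)
      show "integrable lborel (\<lambda>u. (w ^ m / fact m) * (indicator {0..} u *\<^sub>R (complex_of_real (\<phi> u) * of_real u ^ m)))" for m
        using p unfolding set_integrable_def by (intro integrable_mult_right)
    qed (simp only: integral_mult_right_zero F)
    finally show ?thesis by (simp add: mult.commute)
  qed
  ultimately show ?thesis unfolding sums_def set_lebesgue_integral_def by simp
qed

definition A :: "complex \<Rightarrow> complex" where
  "A w = (LINT u:{0..}|lborel. of_real (\<phi> u) * exp (w * of_real u))"

text \<open>The transform of the kernel over the full line without its polar part: the left
  half-line is folded over by \<open>\<phi>_reflect\<close>.\<close>

definition E :: "complex \<Rightarrow> complex" where "E w = A w + of_real \<epsilon> * A (- w)"

definition coef :: "nat \<Rightarrow> real" where "coef m = (1 + \<epsilon> * (-1) ^ m) * F m / fact m"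

lemma E_sums: "(\<lambda>m. of_real (coef m) * w ^ m) sums E w"
proof -
  have "(\<lambda>m. of_real (F m / fact m) * w ^ m + of_real \<epsilon> * (of_real (F m / fact m) * (- w) ^ m)) sums E w"
    unfolding E_def A_def by (intro sums_add sums_mult laplace_sums)
  moreover have "of_real (F m / fact m) * w ^ m + of_real \<epsilon> * (of_real (F m / fact m) * (- w) ^ m) = of_real (coef m) * w ^ m" for m
    by (subst power_minus) (simp add: coef_def field_simps)
  ultimately show ?thesis by simp
qed

lemma E_analytic: "E analytic_on S"
proof -
  have "E holomorphic_on ball 0 r" for r
    by (rule power_series_holomorphic[where a = "\<lambda>m. of_real (coef m)"]) (use E_sums in simp)
  then have "E field_differentiable at w" for w
    by (rule holomorphic_on_imp_differentiable_at[of E "ball 0 (norm w + 1)"]) auto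
  then have "E holomorphic_on UNIV" by (simp add: holomorphic_on_def)
  then have "E analytic_on UNIV" by (simp add: analytic_on_open)
  then show ?thesis by (rule analytic_on_subset) simp
qed

lemma E_compose_analytic: "g analytic_on S \<Longrightarrow> (\<lambda>s. E (g s)) analytic_on S"
  using analytic_on_compose[of g S E] E_analytic by (simp add: o_def)

text \<open>The explicit continuation; the two fractions are the half-line integrals of the two
  exponentials in \<open>\<phi>_reflect\<close>.\<close>

definition \<Lambda>\<^sub>0 :: "complex \<Rightarrow> complex" where
  "\<Lambda>\<^sub>0 s = E (s - of_real \<kappa>) + of_real (\<beta> * \<epsilon>) / (s - of_real k) - of_real \<beta> / s"

lemma isCont_mellin_integrand:
  assumes "t > 0"
  shows "isCont (mellin_integrand n\<^sub>0 \<alpha> s) t"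
proof -
  have B: "isCont (\<lambda>t. B (exp (- pi * t))) t"
  proof (rule isCont_o2[where g = B])
    show "isCont B (exp (- pi * t))" using assms by (intro isCont_B) simp
  qed (intro continuous_intros)
  have "isCont (\<lambda>t. complex_of_real (exp (- pi * real n\<^sub>0 * t) * B (exp (- pi * t))) * exp (s * of_real (ln t)) / of_real t) t"
    using assms by (intro continuous_intros B) auto
  moreover have "\<forall>\<^sub>F t in nhds t. t > 0" using assms by (rule order_tendstoD(1)[OF filterlim_ident])
  then have "\<forall>\<^sub>F t in nhds t. complex_of_real (exp (- pi * real n\<^sub>0 * t) * B (exp (- pi * t))) * exp (s * of_real (ln t)) / of_real t
      = mellin_integrand n\<^sub>0 \<alpha> s t"
    by eventually_elim (simp add: mellin_integrand_def exp_series_eq alpha_0 powr_def Ln_of_real)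
  ultimately show ?thesis by (simp only: isCont_cong)
qed

lemma mellin_integrand_exp:
  "(h * exp u) *\<^sub>R mellin_integrand n\<^sub>0 \<alpha> s (h * exp u)
     = exp (s * of_real (ln h)) * (of_real (\<phi> u) * exp ((s - of_real \<kappa>) * of_real u))"
proof -
  have "complex_of_real (h * exp u) powr s = exp (s * of_real (ln h + u))"
    using h_pos by (simp add: powr_def Ln_of_real ln_mult del: of_real_mult)
  then have "(h * exp u) *\<^sub>R mellin_integrand n\<^sub>0 \<alpha> s (h * exp u) = of_real (exp (- \<kappa> * u) * \<phi> u) * exp (s * of_real (ln h + u))"
    using h_pos unfolding mellin_integrand_def exp_series_exp alpha_0 by (simp add: scaleR_conv_of_real)
  also have "exp (s * of_real (ln h + u)) = exp (s * of_real (ln h)) * exp (s * of_real u)"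
    by (simp add: exp_add[symmetric] distrib_left)
  also have "of_real (exp (- \<kappa> * u) * \<phi> u) * (exp (s * of_real (ln h)) * exp (s * of_real u))
      = exp (s * of_real (ln h)) * (of_real (\<phi> u) * (exp (of_real (- \<kappa> * u)) * exp (s * of_real u)))"
    by (simp only: exp_of_real[symmetric] of_real_mult mult_ac)
  also have "exp (of_real (- \<kappa> * u)) * exp (s * of_real u) = exp ((s - of_real \<kappa>) * of_real u)"
    by (simp add: exp_add[symmetric] algebra_simps)
  finally show ?thesis .
qed

lemma integrable_\<phi>_exp:
  fixes w :: complex
  shows "set_integrable lborel {0..} (\<lambda>u. of_real (\<phi> u) * exp (w * of_real u))"
  by (rule integrable_\<phi>_mult[where A = "Re w"]) (auto intro!: continuous_intros)

text \<open>To the right of \<open>max 0 k\<close> both elementary exponentials are integrable. The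
  bounds on \<open>Re s\<close> are recorded in the conclusion because they keep \<open>s\<close>
  away from the possible poles 0 and \<open>k\<close>.\<close>

lemma completed_series_eq: "\<exists>\<sigma>. \<forall>s. Re s > \<sigma> \<longrightarrow> completed_series N J M a s = \<Lambda>\<^sub>0 s \<and> Re s > 0 \<and> Re s > k"
proof -
  obtain \<sigma> where \<sigma>: "\<And>s. Re s > \<sigma> \<Longrightarrow> set_integrable lborel {0<..} (mellin_integrand n\<^sub>0 \<alpha> s) \<and>
         completed_series N J M a s =
           of_real N powr (s / 2) * (LINT t:{0<..}|lborel. mellin_integrand n\<^sub>0 \<alpha> s t)"
    using integral_representation by blast
  have "completed_series N J M a s = \<Lambda>\<^sub>0 s \<and> Re s > 0 \<and> Re s > k" if s: "Re s > max \<sigma> (max 0 k)" for s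
  proof -
    define w where "w = s - of_real \<kappa>"
    have rw: "Re (w - of_real \<kappa>) > 0" "Re (w + of_real \<kappa>) > 0"
      using s by (auto simp: w_def \<kappa>_def)
    have wk: "w - of_real \<kappa> = s - of_real k" "w + of_real \<kappa> = s"
      by (simp_all add: w_def \<kappa>_def)
    define G where "G u = of_real (\<phi> u) * exp (w * of_real u)" for u
    have i1: "set_integrable lborel {0..} G" unfolding G_def by (rule integrable_\<phi>_exp)
    have G_neg: "G (- u) = of_real \<epsilon> * (of_real (\<phi> u) * exp (- w * of_real u))
        + (of_real (\<beta> * \<epsilon>) * exp (- (w - of_real \<kappa>) * of_real u) - of_real \<beta> * exp (- (w + of_real \<kappa>) * of_real u))" for u
    proof -
      have "exp (- (w - of_real \<kappa>) * of_real u) = of_real (exp (\<kappa> * u)) * exp (- w * of_real u)"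
        "exp (- (w + of_real \<kappa>) * of_real u) = of_real (exp (- \<kappa> * u)) * exp (- w * of_real u)"
        unfolding exp_of_real[symmetric] exp_add[symmetric] by (simp_all add: algebra_simps)
      then show ?thesis unfolding G_def \<phi>_reflect by (simp add: algebra_simps)
    qed
    have j1: "set_integrable lborel {0..} (\<lambda>u. of_real \<epsilon> * (of_real (\<phi> u) * exp (- w * of_real u)))"
      using integrable_\<phi>_exp[of "- w"] by (rule set_integrable_mult_right)
    have j2: "set_integrable lborel {0..} (\<lambda>u. of_real (\<beta> * \<epsilon>) * exp (- (w - of_real \<kappa>) * of_real u))"
      using integral_exp_neg_complex(1)[OF rw(1)] by (rule set_integrable_mult_right)
    have j3: "set_integrable lborel {0..} (\<lambda>u. of_real \<beta> * exp (- (w + of_real \<kappa>) * of_real u))"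
      using integral_exp_neg_complex(1)[OF rw(2)] by (rule set_integrable_mult_right)
    have i2: "set_integrable lborel {0..} (\<lambda>u. G (- u))"
      unfolding G_neg by (intro set_integral_add(1) set_integral_diff(1) j1 j2 j3)
    have "(LINT u:{0..}|lborel. G (- u)) = of_real \<epsilon> * A (- w) + (of_real (\<beta> * \<epsilon>) * (1 / (w - of_real \<kappa>)) - of_real \<beta> * (1 / (w + of_real \<kappa>)))"
      unfolding G_neg A_def
      by (simp only: set_integral_add(2)[OF j1 set_integral_diff(1)[OF j2 j3]] set_integral_diff(2)[OF j2 j3]
          set_integral_mult_right integral_exp_neg_complex(2)[OF rw(1)] integral_exp_neg_complex(2)[OF rw(2)])
    moreover have "(LINT u:{0..}|lborel. G u) = A w" by (simp add: G_def A_def)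
    ultimately have "integral\<^sup>L lborel G = \<Lambda>\<^sub>0 s"
      unfolding integral_split_at_0(2)[OF i1 i2] by (simp add: \<Lambda>\<^sub>0_def E_def w_def[symmetric] wk)
    moreover have "(LINT t:{0<..}|lborel. mellin_integrand n\<^sub>0 \<alpha> s t) = (LINT u|lborel. (h * exp u) *\<^sub>R mellin_integrand n\<^sub>0 \<alpha> s (h * exp u))"
    proof (rule integral_exp_substitution[OF h_pos isCont_mellin_integrand])
      show "set_integrable lborel {0<..} (mellin_integrand n\<^sub>0 \<alpha> s)" using \<sigma>[of s] s by simp
      show "integrable lborel (\<lambda>u. (h * exp u) *\<^sub>R mellin_integrand n\<^sub>0 \<alpha> s (h * exp u))"
        unfolding mellin_integrand_exp using integral_split_at_0(1)[OF i1 i2]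
        unfolding G_def w_def by (rule integrable_mult_right)
    qed
    moreover have "of_real N powr (s / 2) * exp (s * of_real (ln h)) = 1"
    proof -
      have "ln h = - ln N / 2" using N_pos by (simp add: h_def ln_div ln_sqrt)
      then show ?thesis using N_pos by (simp add: powr_def Ln_of_real exp_add[symmetric])
    qed
    ultimately have "of_real N powr (s / 2) * (LINT t:{0<..}|lborel. mellin_integrand n\<^sub>0 \<alpha> s t) = \<Lambda>\<^sub>0 s"
      unfolding mellin_integrand_exp G_def[symmetric] w_def[symmetric]
      by (simp add: mult.assoc[symmetric])
    then show ?thesis using \<sigma>[of s] s by simp
  qed
  then show ?thesis by blast
qed

section \<open>Continuation, poles and Taylor coefficients\<close>

lemma \<Lambda>\<^sub>0_analytic:
  assumes "s \<noteq> 0" "s \<noteq> of_real k"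
  shows "\<Lambda>\<^sub>0 analytic_on {s}"
proof -
  have "(\<lambda>s. E (s - of_real \<kappa>)) analytic_on {s}"
    by (intro E_compose_analytic analytic_intros)
  then show ?thesis unfolding \<Lambda>\<^sub>0_def using assms by (intro analytic_intros) auto
qed

lemma \<Lambda>\<^sub>0_meromorphic: "\<Lambda>\<^sub>0 meromorphic_on UNIV"
proof -
  have "(\<lambda>s. E (s - of_real \<kappa>)) analytic_on UNIV"
    by (intro E_compose_analytic analytic_intros)
  then show ?thesis unfolding \<Lambda>\<^sub>0_def
    by (intro meromorphic_intros analytic_on_imp_meromorphic_on) (auto intro: analytic_intros)
qed

text \<open>\<open>\<Lambda>\<^sub>0\<close> has artificial values at 0 and \<open>k\<close> from
  division by zero; \<open>remove_sings\<close> replaces them by those that nice meromorphy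
  prescribes. Uniqueness is \<open>nicely_meromorphic_eqI\<close>.\<close>

lemma completed_L_eq: "completed_L N J M a = remove_sings \<Lambda>\<^sub>0"
  unfolding completed_L_def
proof (rule the_equality)
  obtain \<sigma> where \<sigma>: "\<And>s. Re s > \<sigma> \<Longrightarrow> completed_series N J M a s = \<Lambda>\<^sub>0 s \<and> Re s > 0 \<and> Re s > k"
    using completed_series_eq by blast
  have eq: "remove_sings \<Lambda>\<^sub>0 s = completed_series N J M a s" if "Re s > \<sigma>" for s
    using \<sigma>[OF that] by (subst remove_sings_at_analytic[OF \<Lambda>\<^sub>0_analytic]) auto
  have nice: "remove_sings \<Lambda>\<^sub>0 nicely_meromorphic_on UNIV"
    by (rule remove_sings_nicely_meromorphic[OF \<Lambda>\<^sub>0_meromorphic])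
  then show "remove_sings \<Lambda>\<^sub>0 nicely_meromorphic_on UNIV \<and> (\<exists>\<sigma>. \<forall>s. \<sigma> < Re s \<longrightarrow> remove_sings \<Lambda>\<^sub>0 s = completed_series N J M a s)"
    using eq by blast
  fix \<Lambda> assume L: "\<Lambda> nicely_meromorphic_on UNIV \<and> (\<exists>\<sigma>. \<forall>s. \<sigma> < Re s \<longrightarrow> \<Lambda> s = completed_series N J M a s)"
  then obtain \<sigma>' where \<sigma>': "\<And>s. \<sigma>' < Re s \<Longrightarrow> \<Lambda> s = completed_series N J M a s" by blast
  show "\<Lambda> = remove_sings \<Lambda>\<^sub>0"
    by (rule nicely_meromorphic_eqI[of _ _ "max \<sigma> \<sigma>'"]) (use L nice eq \<sigma>' in auto)
qed

text \<open>For \<open>k \<noteq> 0\<close> the residue at \<open>k\<close> is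
  \<open>\<beta> * \<epsilon>\<close>. For \<open>k = 0\<close> both polar terms sit at 0: they
  cancel if \<open>\<epsilon> = 1\<close>, the excluded case, and add up to
  \<open>- 2 * \<beta> / s\<close> if \<open>\<epsilon> = -1\<close>.\<close>

lemma is_pole_\<Lambda>\<^sub>0:
  assumes "\<beta> \<noteq> 0" "\<not> (\<kappa> = 0 \<and> \<epsilon> = 1)"
  shows "is_pole \<Lambda>\<^sub>0 (of_real k)"
proof -
  have Ek: "(\<lambda>s. E (s - of_real \<kappa>)) \<midarrow>of_real k\<rightarrow> E (of_real k - of_real \<kappa>)"
  proof -
    have "(\<lambda>s. E (s - of_real \<kappa>)) analytic_on {of_real k}"
      by (intro E_compose_analytic analytic_intros)
    then show ?thesis using analytic_at_imp_isCont isContD by blast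
  qed
  have pole: "filterlim (\<lambda>s. C / (s - of_real k)) at_infinity (at (of_real k))" if "C \<noteq> 0" for C :: complex
    using is_pole_cmult_iff[OF that, of "\<lambda>s. 1 / (s - of_real k)" "of_real k"] is_pole_inverse[of "of_real k"]
    by (simp add: is_pole_def)
  have \<epsilon>: "\<epsilon> \<noteq> 0" using sign by auto
  show ?thesis
  proof (cases "k = 0")
    case False
    then have "(\<lambda>s. E (s - of_real \<kappa>) - of_real \<beta> / s) \<midarrow>of_real k\<rightarrow> E (of_real k - of_real \<kappa>) - of_real \<beta> / of_real k"
      by (intro tendsto_intros Ek) auto
    from tendsto_add_filterlim_at_infinity[OF this pole[of "of_real (\<beta> * \<epsilon>)"]]
    show ?thesis using assms \<epsilon> by (simp add: is_pole_def \<Lambda>\<^sub>0_def[abs_def] algebra_simps)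
  next
    case True
    then have "\<kappa> = 0" unfolding \<kappa>_def by simp
    then have "\<epsilon> = -1" using assms sign by auto
    have "\<Lambda>\<^sub>0 = (\<lambda>s. E (s - of_real \<kappa>) + of_real (- 2 * \<beta>) / (s - of_real k))"
    proof
      show "\<Lambda>\<^sub>0 s = E (s - of_real \<kappa>) + of_real (- 2 * \<beta>) / (s - of_real k)" for s
        unfolding \<Lambda>\<^sub>0_def using True \<open>\<epsilon> = -1\<close> by (simp add: field_simps)
    qed
    with tendsto_add_filterlim_at_infinity[OF Ek pole[of "of_real (- 2 * \<beta>)"]]
    show ?thesis using assms by (simp add: is_pole_def)
  qed
qed

lemma is_pole_completed_L: "is_pole (completed_L N J M a) s \<longleftrightarrow> is_pole \<Lambda>\<^sub>0 s"
proof -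
  have "isolated_singularity_at \<Lambda>\<^sub>0 s" using \<Lambda>\<^sub>0_meromorphic by (metis UNIV_I meromorphic_onE)
  from is_pole_cong[OF eventually_remove_sings_eq_at[OF this] refl] show ?thesis unfolding completed_L_eq .
qed

text \<open>Absence of a pole at \<open>k\<close> makes the polar term at 0 disappear as well:
  either \<beta> vanishes or the two terms cancel.\<close>

lemma Xi_no_pole:
  assumes "\<not> is_pole (completed_L N J M a) (of_real k)"
  shows "Xi N J M a k = (\<lambda>z. E (- \<i> * z))"
proof -
  have "\<beta> = 0 \<or> \<kappa> = 0 \<and> \<epsilon> = 1" using assms is_pole_\<Lambda>\<^sub>0 unfolding is_pole_completed_L by blast
  then have \<Lambda>: "\<Lambda>\<^sub>0 = (\<lambda>s. E (s - of_real \<kappa>))" by (auto simp: \<Lambda>\<^sub>0_def fun_eq_iff \<kappa>_def)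
  have "\<Lambda>\<^sub>0 analytic_on {s}" for s
    unfolding \<Lambda> by (intro E_compose_analytic analytic_intros)
  then have "completed_L N J M a = \<Lambda>\<^sub>0" unfolding completed_L_eq by (simp add: fun_eq_iff)
  then show ?thesis using assms by (simp add: Xi_def Let_def \<Lambda> \<kappa>_def)
qed

text \<open>With \<open>w = - \<i> z\<close> the prefactor is
  \<open>(w + \<kappa>) * (w - \<kappa>)\<close>. It clears both denominators, and the polar terms
  survive as a polynomial of degree at most 1, which no higher Taylor coefficient sees.\<close>

lemma Xi_pole:
  assumes "is_pole (completed_L N J M a) (of_real k)"
  shows "Xi N J M a k = (\<lambda>z. (- (z ^ 2) - of_real (\<kappa>\<^sup>2)) * E (- \<i> * z)
      + (of_real (\<beta> * \<kappa> * (\<epsilon> + 1)) + of_real (\<beta> * (1 - \<epsilon>)) * \<i> * z))"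
proof
  fix z :: complex
  define H where "H z = (- (z ^ 2) - of_real (\<kappa>\<^sup>2)) * E (- \<i> * z)
      + (of_real (\<beta> * \<kappa> * (\<epsilon> + 1)) + of_real (\<beta> * (1 - \<epsilon>)) * \<i> * z)" for z :: complex
  let ?f = "\<lambda>z. (- z\<^sup>2 - (of_real k)\<^sup>2 / 4) * completed_L N J M a (of_real k / 2 - \<i> * z)"
  have "?f z = H z" if z: "- \<i> * z \<noteq> of_real \<kappa>" "- \<i> * z \<noteq> - of_real \<kappa>" for z
  proof -
    define w where "w = - \<i> * z"
    have zw: "z = \<i> * w" by (simp add: w_def)
    have s: "of_real k / 2 - \<i> * z = w + of_real \<kappa>" by (simp add: w_def \<kappa>_def)
    have n: "w + of_real \<kappa> \<noteq> 0" "w - of_real \<kappa> \<noteq> 0" "w + of_real \<kappa> - of_real k = w - of_real \<kappa>"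
      using z unfolding w_def[symmetric] by (auto simp: \<kappa>_def add_eq_0_iff2)
    then have "w + of_real \<kappa> \<noteq> of_real k" by (metis right_minus_eq)
    have "completed_L N J M a (w + of_real \<kappa>) = \<Lambda>\<^sub>0 (w + of_real \<kappa>)"
      unfolding completed_L_eq using n(1) \<open>w + of_real \<kappa> \<noteq> of_real k\<close>
      by (intro remove_sings_at_analytic \<Lambda>\<^sub>0_analytic)
    also have "\<dots> = E w + of_real (\<beta> * \<epsilon>) / (w - of_real \<kappa>) - of_real \<beta> / (w + of_real \<kappa>)"
      unfolding \<Lambda>\<^sub>0_def n(3) by simp
    finally have L: "completed_L N J M a (w + of_real \<kappa>) = E w + of_real (\<beta> * \<epsilon>) / (w - of_real \<kappa>) - of_real \<beta> / (w + of_real \<kappa>)" .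
    have "- z\<^sup>2 - (of_real k)\<^sup>2 / 4 = (w + of_real \<kappa>) * (w - of_real \<kappa>)"
      by (simp add: zw \<kappa>_def algebra_simps power2_eq_square)
    then have "?f z = ((w + of_real \<kappa>) * (w - of_real \<kappa>)) * (E w + of_real (\<beta> * \<epsilon>) / (w - of_real \<kappa>) - of_real \<beta> / (w + of_real \<kappa>))"
      unfolding s L by (simp only:)
    also have "\<dots> = (w + of_real \<kappa>) * (w - of_real \<kappa>) * E w + of_real (\<beta> * \<epsilon>) * (w + of_real \<kappa>) - of_real \<beta> * (w - of_real \<kappa>)"
    proof -
      have "x * y * (t + p / y - q / x) = x * y * t + p * x - q * y" if "x \<noteq> 0" "y \<noteq> 0" for x y t p q :: complex
        using that by (simp add: field_simps)
      then show ?thesis using n by blast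
    qed
    also have "\<dots> = H z" unfolding H_def w_def[symmetric] by (simp add: zw algebra_simps power2_eq_square)
    finally show ?thesis .
  qed
  \<comment> \<open>The formula holds off at most two points; there \<open>remove_sings\<close>
    takes the limit, which is read off from the continuous \<open>H\<close>.\<close>
  moreover have "\<forall>\<^sub>F z' in at z. - \<i> * z' \<noteq> of_real \<kappa> \<and> - \<i> * z' \<noteq> - of_real \<kappa>"
  proof -
    have "\<forall>\<^sub>F z' in at z. z' \<noteq> \<i> * of_real \<kappa> \<and> z' \<noteq> - \<i> * of_real \<kappa>"
      by (intro eventually_conj eventually_neq_at_within)
    then show ?thesis by eventually_elim (auto simp: complex_eq_iff)
  qed
  ultimately have "\<forall>\<^sub>F z in at z. H z = ?f z" by (auto elim!: eventually_mono)
  moreover have "H \<midarrow>z\<rightarrow> H z"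
  proof -
    have "(\<lambda>z. E (- \<i> * z)) analytic_on {z}"
      by (intro E_compose_analytic analytic_intros)
    then have "H analytic_on {z}" unfolding H_def by (intro analytic_intros) auto
    then show ?thesis using analytic_at_imp_isCont isContD by blast
  qed
  ultimately have "?f \<midarrow>z\<rightarrow> H z" by (rule Lim_transform_eventually[rotated])
  then have "remove_sings ?f z = H z" by (rule remove_sings_eqI)
  then show "Xi N J M a k z = (- (z ^ 2) - of_real (\<kappa>\<^sup>2)) * E (- \<i> * z)
      + (of_real (\<beta> * \<kappa> * (\<epsilon> + 1)) + of_real (\<beta> * (1 - \<epsilon>)) * \<i> * z)"
    using assms unfolding Xi_def Let_def H_def by simp
qed

text \<open>Taylor coefficients in the variable \<open>- \<i> z\<close>, meant for
  \<open>m \<ge> 2\<close>: in the case of a pole, smaller indices would meet the truncated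
  \<open>m - 2\<close> and the linear polynomial of \<open>Xi_pole\<close>.\<close>

definition Xi_coef :: "nat \<Rightarrow> real" where
  "Xi_coef m = (if is_pole (completed_L N J M a) (of_real k) then coef (m - 2) - \<kappa>\<^sup>2 * coef m else coef m)"

lemma higher_deriv_Xi:
  assumes "m \<ge> 2"
  shows "(deriv ^^ m) (Xi N J M a k) 0 = fact m * ((- \<i>) ^ m * of_real (Xi_coef m))"
proof -
  define P where "P = Abs_fps (\<lambda>m. of_real (coef m) * (- \<i>) ^ m)"
  have P: "(\<lambda>z. E (- \<i> * z)) has_fps_expansion P"
  proof (rule has_fps_expansionI, rule always_eventually, rule allI)
    show "(\<lambda>n. fps_nth P n * z ^ n) sums E (- \<i> * z)" for z
      using E_sums[of "- \<i> * z"] unfolding P_def by (simp only: power_mult_distrib fps_nth_Abs_fps mult.assoc)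
  qed
  have "\<exists>Q. Xi N J M a k has_fps_expansion Q \<and> fps_nth Q m = (- \<i>) ^ m * of_real (Xi_coef m)"
  proof (cases "is_pole (completed_L N J M a) (of_real k)")
    case False
    then show ?thesis using P by (intro exI[of _ P]) (simp add: Xi_no_pole Xi_coef_def P_def)
  next
    case True
    let ?c = "of_real (\<beta> * \<kappa> * (\<epsilon> + 1)) :: complex" and ?d = "of_real (\<beta> * (1 - \<epsilon>)) * \<i>"
    let ?Q = "(- (fps_X ^ 2) - fps_const (of_real (\<kappa>\<^sup>2))) * P + (fps_const ?c + fps_const ?d * fps_X)"
    have "Xi N J M a k has_fps_expansion ?Q"
      unfolding Xi_pole[OF True] by (intro fps_expansion_intros P)
    moreover have "fps_nth ?Q m = (- \<i>) ^ m * of_real (Xi_coef m)"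
    proof -
      obtain l where l: "m = Suc (Suc l)" using assms by (metis add_2_eq_Suc le_iff_add)
      have "fps_nth ?Q m = - fps_nth (fps_X ^ 2 * P) m - of_real (\<kappa>\<^sup>2) * fps_nth P m"
        using assms by (simp add: left_diff_distrib fps_X_def l)
      also have "\<dots> = - fps_nth P l - of_real (\<kappa>\<^sup>2) * fps_nth P m"
        unfolding fps_X_power_mult_nth by (simp add: l)
      finally show ?thesis using True by (simp add: P_def Xi_coef_def l algebra_simps)
    qed
    ultimately show ?thesis by blast
  qed
  then obtain Q where "Xi N J M a k has_fps_expansion Q" "fps_nth Q m = (- \<i>) ^ m * of_real (Xi_coef m)"
    by blast
  then show ?thesis using fps_nth_fps_expansion[of "Xi N J M a k" Q m] by (simp add: field_simps)
qed

definition e :: nat where "e = (if \<epsilon> = 1 then 0 else 1)"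

text \<open>The signs in the definition of \<gamma> are inverse to the power of
  \<open>- \<i>\<close> that comes from rotating the variable. For \<open>n > 0\<close> the index is
  at least 2, as \<open>higher_deriv_Xi\<close> requires.\<close>

lemma xi_gamma_eq:
  assumes "n > 0"
  shows "xi_gamma N J M a \<epsilon> k n = fact n * Xi_coef (2 * n + e)"
proof -
  have cancel: "x * (p / q) * (q * (y * r)) = p * r" if "x * y = 1" "q \<noteq> 0" for x y p q r :: complex
  proof -
    have "x * (p / q) * (q * (y * r)) = (x * y) * (p / q * q) * r" by (simp only: mult_ac)
    then show ?thesis using that by simp
  qed
  show ?thesis
  proof (cases "\<epsilon> = 1")
    case True
    have "(-1) ^ n * (- \<i>) ^ (2 * n) = 1"
      by (simp add: power_mult power_mult_distrib[symmetric])
    then have "(-1) ^ n * (fact n / fact (2 * n)) * (fact (2 * n) * ((- \<i>) ^ (2 * n) * of_real (Xi_coef (2 * n)))) = complex_of_real (fact n * Xi_coef (2 * n))"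
      by (subst cancel) (simp_all only: fact_nonzero of_real_mult of_real_fact not_False_eq_True)
    moreover have "xi_gamma N J M a \<epsilon> k n = Re ((-1) ^ n * (fact n / fact (2 * n)) * (deriv ^^ (2 * n)) (Xi N J M a k) 0)"
      using True by (simp add: xi_gamma_def)
    moreover have "e = 0" unfolding e_def using True by simp
    ultimately show ?thesis using assms by (simp add: higher_deriv_Xi)
  next
    case False
    have "\<i> ^ (2 * n + 1) * (- \<i>) ^ (2 * n + 1) = 1"
      unfolding power_mult_distrib[symmetric] by simp
    then have "\<i> ^ (2 * n + 1) * (fact n / fact (2 * n + 1)) * (fact (2 * n + 1) * ((- \<i>) ^ (2 * n + 1) * of_real (Xi_coef (2 * n + 1)))) = complex_of_real (fact n * Xi_coef (2 * n + 1))"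
      by (subst cancel) (simp_all only: fact_nonzero of_real_mult of_real_fact not_False_eq_True)
    moreover have "xi_gamma N J M a \<epsilon> k n = Re (\<i> ^ (2 * n + 1) * (fact n / fact (2 * n + 1)) * (deriv ^^ (2 * n + 1)) (Xi N J M a k) 0)"
      using False unfolding xi_gamma_def by (simp only: if_False)
    moreover have "e = 1" unfolding e_def using False by simp
    ultimately show ?thesis using assms by (simp only: higher_deriv_Xi Re_complex_of_real)
  qed
qed

lemma coef_eq: "coef (2 * n + e) = 2 * F (2 * n + e) / fact (2 * n + e)"
  using sign by (auto simp: coef_def e_def)

end

subsection \<open>Asymptotics of the Taylor coefficients\<close>

context peaked_density
begin

lemma integrable_ratio_power:
  assumes "v \<noteq> 0"
  shows "set_integrable lborel {0..} (\<lambda>u. \<phi> u * (u ^ m * ((u / v)\<^sup>2) ^ j * ((u / v)\<^sup>2 - 1) ^ i))"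
proof (rule integrable_poly)
  show "continuous_on {0..} (\<lambda>u. u ^ m * ((u / v)\<^sup>2) ^ j * ((u / v)\<^sup>2 - 1) ^ i)"
    using assms by (intro continuous_intros) auto
  show "\<bar>u ^ m * ((u / v)\<^sup>2) ^ j * ((u / v)\<^sup>2 - 1) ^ i\<bar>
      \<le> ((1 / v\<^sup>2) ^ j * (1 / v\<^sup>2 + 1) ^ i) * exp ((real m + 2 * real j + 2 * real i) * u)" if u: "u \<ge> 0" for u
  proof -
    have e: "(u / v)\<^sup>2 \<le> 1 / v\<^sup>2 * exp (2 * u)"
      using power_le_exp_mult[OF u, of 2] by (simp add: power_divide divide_right_mono)
    moreover have "1 \<le> exp (2 * u)" using u by simp
    ultimately have e': "\<bar>(u / v)\<^sup>2 - 1\<bar> \<le> (1 / v\<^sup>2 + 1) * exp (2 * u)"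
      using zero_le_power2[of "u / v"] unfolding distrib_right by linarith
    have "u ^ m * ((u / v)\<^sup>2) ^ j * \<bar>(u / v)\<^sup>2 - 1\<bar> ^ i
       \<le> exp (real m * u) * (1 / v\<^sup>2 * exp (2 * u)) ^ j * ((1 / v\<^sup>2 + 1) * exp (2 * u)) ^ i"
      using u by (intro mult_mono power_mono e e' power_le_exp_mult) auto
    also have "\<dots> = ((1 / v\<^sup>2) ^ j * (1 / v\<^sup>2 + 1) ^ i) * exp ((real m + 2 * real j + 2 * real i) * u)"
    proof -
      have "p * (x * q) ^ j * (y * q) ^ i = (x ^ j * y ^ i) * (p * (q ^ j * q ^ i))" for p q x y :: real
        by (simp add: power_mult_distrib mult_ac)
      moreover have "exp (real m * u) * (exp (2 * u) ^ j * exp (2 * u) ^ i) = exp ((real m + 2 * real j + 2 * real i) * u)"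
        unfolding exp_of_nat_mult[symmetric] exp_add[symmetric] by (simp add: algebra_simps)
      ultimately show ?thesis by (simp only:)
    qed
    finally show ?thesis
      unfolding abs_mult[of _ "_ ^ i"] power_abs[of _ i] using u
      by (simp only: abs_of_nonneg mult_nonneg_nonneg zero_le_power zero_le_power2)
  qed
qed

text \<open>A step in \<open>j\<close> multiplies the integrand by \<open>(u / v)^2\<close>, so a
  difference multiplies it by \<open>(u / v)^2 - 1\<close>.\<close>

lemma fdiff_moments:
  assumes "v \<noteq> 0"
  shows "(fdiff ^^ i) (\<lambda>j. F (m + 2 * j) / (F m * (v\<^sup>2) ^ j)) =
    (\<lambda>j. (LINT u:{0..}|lborel. \<phi> u * (u ^ m * ((u / v)\<^sup>2) ^ j * ((u / v)\<^sup>2 - 1) ^ i)) / F m)"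
proof (induction i)
  case 0
  have "F (m + 2 * j) / (v\<^sup>2) ^ j = (LINT u:{0..}|lborel. \<phi> u * (u ^ m * ((u / v)\<^sup>2) ^ j))" for j
    unfolding F_def set_integral_divide_zero[symmetric] by (simp add: power_add power_mult power_divide)
  then show ?case by (simp add: fun_eq_iff) (metis divide_divide_eq_left' mult.commute)
next
  case (Suc i)
  have *: "(LINT u:{0..}|lborel. \<phi> u * (u ^ m * ((u / v)\<^sup>2) ^ Suc j * ((u / v)\<^sup>2 - 1) ^ i))
      - (LINT u:{0..}|lborel. \<phi> u * (u ^ m * ((u / v)\<^sup>2) ^ j * ((u / v)\<^sup>2 - 1) ^ i))
      = (LINT u:{0..}|lborel. \<phi> u * (u ^ m * ((u / v)\<^sup>2) ^ j * ((u / v)\<^sup>2 - 1) ^ Suc i))" for j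
    by (subst set_integral_diff(2)[OF integrable_ratio_power[OF assms] integrable_ratio_power[OF assms], symmetric])
       (simp add: algebra_simps)
  show ?case
    unfolding funpow.simps o_apply Suc.IH unfolding fdiff_def diff_divide_distrib[symmetric] * ..
qed

text \<open>Concentration is known at the scale \<open>sqrt (m n)\<close>; as
  \<open>n \<le> m n\<close>, the differences of positive order vanish a fortiori at the scale
  \<open>sqrt n\<close>.\<close>

lemma diff_asymp_moments:
  assumes m: "filterlim m at_top sequentially" and le: "eventually (\<lambda>n. n \<le> m n) sequentially"
  shows "diff_asymp (\<lambda>n j. F (m n + 2 * j) / (F (m n) * ((peak (m n))\<^sup>2) ^ j)) (\<lambda>i. if i = 0 then 1 else 0)"
  unfolding diff_asymp_def
proof
  fix i
  define X where "X m = (LINT u:{0..}|lborel. \<phi> u * u ^ m * ((u / peak m)\<^sup>2 - 1) ^ i) / F m" for m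
  let ?f = "\<lambda>n. sqrt (real n) ^ i * (fdiff ^^ i) (\<lambda>j. F (m n + 2 * j) / (F (m n) * ((peak (m n))\<^sup>2) ^ j)) 0"
  have ev: "\<forall>\<^sub>F n in sequentially. sqrt (real n) ^ i * X (m n) = ?f n"
    using eventually_compose_filterlim[OF eventually_gt_at_top[of 0] m]
  proof eventually_elim
    case (elim n)
    then have "peak (m n) \<noteq> 0" using peak[of "m n"] by simp
    then show ?case by (simp add: fdiff_moments X_def mult.assoc)
  qed
  have lim: "(\<lambda>n. sqrt (real (m n)) ^ i * X (m n)) \<longlonglongrightarrow> (if i = 0 then 1 else 0)"
    using filterlim_compose[OF moments_concentrate[of i] m] by (simp add: X_def)
  have "(\<lambda>n. sqrt (real n) ^ i * X (m n)) \<longlonglongrightarrow> (if i = 0 then 1 else 0)"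
  proof (cases "i = 0")
    case False
    then have "(\<lambda>n. sqrt (real (m n)) ^ i * X (m n)) \<longlonglongrightarrow> 0" using lim by simp
    then have "(\<lambda>n. sqrt (real n) ^ i * X (m n)) \<longlonglongrightarrow> 0"
    proof (rule Lim_null_comparison[rotated, OF tendsto_norm_zero])
      show "\<forall>\<^sub>F n in sequentially. norm (sqrt (real n) ^ i * X (m n)) \<le> norm (sqrt (real (m n)) ^ i * X (m n))"
        using le by eventually_elim (auto simp: abs_mult power_abs intro!: mult_right_mono power_mono)
    qed
    then show ?thesis using False by simp
  qed (use lim in simp)
  then show "?f \<longlonglongrightarrow> (if i = 0 then 1 else 0)" by (rule Lim_transform_eventually[OF _ ev])
qed

end

section \<open>Combination of the factorials with the moments\<close>

context good_dirichlet_series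
begin

definition G :: "nat \<Rightarrow> real" where "G n = fact n / fact (2 * n + e)"

lemma G_pos: "G n > 0" by (simp add: G_def)

lemma G_nonzero: "G n \<noteq> 0"
  using G_pos[of n] by simp

text \<open>Of the two new factors in the denominator, the even one cancels against
  \<open>n + 1\<close> up to a factor 2. What remains is \<open>2 * (2 n + 1 + 2 e)\<close> in
  either parity, which explains the shift \<open>1 / 2 + e\<close>.\<close>

lemma G_Suc: "4 * (real n + (1 / 2 + real e)) * G (Suc n) = G n"
proof -
  have "e = 0 \<or> e = 1" by (simp add: e_def)
  then show ?thesis
  proof
    assume e: "e = 0"
    have "fact (2 * Suc n) = (2 * real n + 2) * ((2 * real n + 1) * fact (2 * n))" by (simp add: algebra_simps)
    then show ?thesis unfolding G_def e by (simp add: divide_simps) (simp add: algebra_simps)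
  next
    assume e: "e = 1"
    have "fact (2 * Suc n + 1) = (2 * real n + 3) * ((2 * real n + 2) * fact (2 * n + 1))" by (simp add: algebra_simps)
    then show ?thesis unfolding G_def e by (simp add: divide_simps) (simp add: algebra_simps)
  qed
qed

lemma diff_asymp_G: "diff_asymp (\<lambda>n j. (4 * real n) ^ j * G (n + j) / G n) hermite0"
proof (rule diff_asymp_hermite)
  show "(real n + (1 / 2 + real e) + real j) * ((4 * real n) ^ Suc j * G (n + Suc j) / G n) = real n * ((4 * real n) ^ j * G (n + j) / G n)" for n j
    using G_Suc[of "n + j"] G_pos[of n] by (simp add: divide_simps) (simp add: algebra_simps)
qed (simp_all add: G_nonzero)

lemma xi_gamma_no_pole:
  assumes "\<not> is_pole (completed_L N J M a) (of_real k)" "n > 0"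
  shows "xi_gamma N J M a \<epsilon> k n = 2 * G n * F (2 * n + e)"
  using assms by (simp add: xi_gamma_eq Xi_coef_def coef_eq G_def)

text \<open>Rewriting \<open>1 / fact (m - 2)\<close> over the common denominator
  \<open>fact m\<close>, with \<open>m = 2 n + e\<close>, puts the weight \<open>m * (m - 1)\<close>
  on the lower moment.\<close>

lemma xi_gamma_pole:
  assumes "is_pole (completed_L N J M a) (of_real k)" "n > 0"
  shows "xi_gamma N J M a \<epsilon> k n = 2 * G n *
    (real (2 * n + e) * (real (2 * n + e) - 1) * F (2 * n + e - 2) - \<kappa>\<^sup>2 * F (2 * n + e))"
proof -
  obtain l where l: "n = Suc l" using assms(2) by (cases n) auto
  have "coef (2 * n + e - 2) = 2 * F (2 * n + e - 2) / fact (2 * n + e - 2)"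
    using coef_eq[of l] by (simp add: l)
  moreover have "fact (2 * n + e) = real (2 * n + e) * (real (2 * n + e) - 1) * (fact (2 * n + e - 2) :: real)"
    by (simp add: l algebra_simps)
  moreover have "x * (2 * y / q - \<kappa>\<^sup>2 * (2 * z / (p * q))) = 2 * (x / (p * q)) * (p * y - \<kappa>\<^sup>2 * z)"
    if "p * q \<noteq> 0" for x y z p q :: real
    using that by (simp add: field_simps)
  moreover have "fact (2 * n + e) \<noteq> (0 :: real)" by simp
  ultimately show ?thesis
    using assms by (simp only: xi_gamma_eq Xi_coef_def coef_eq G_def if_True)
qed

theorem jensen_hyperbolic: "eventually (\<lambda>n. hyperbolic (jensen_poly (xi_gamma N J M a \<epsilon> k) d n)) sequentially"
proof -
  obtain C0 C1 U where "peaked_density (\<lambda>u. sgn (b 0) * \<phi> u) c \<kappa> C0 C1 U" using peaked .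
  then interpret pd: peaked_density "\<lambda>u. sgn (b 0) * \<phi> u" c \<kappa> C0 C1 U .
  have pdF: "pd.F m = sgn (b 0) * F m" for m
    unfolding pd.F_def F_def by (simp add: mult.assoc)
  have sg: "sgn (b 0) \<noteq> 0" using b_0 by (simp add: sgn_zero_iff)
  have ratio: "pd.F m / (pd.F m' * x) = F m / (F m' * x)" for m m' x
    using sg by (simp add: pdF)
  have F_nz: "eventually (\<lambda>m. F m \<noteq> 0) sequentially"
    using pd.F_pos by eventually_elim (auto simp: pdF)
  let ?\<gamma> = "xi_gamma N J M a \<epsilon> k"
  show ?thesis
  proof (cases "is_pole (completed_L N J M a) (of_real k)")
    case False
    define m where "m n = 2 * n + e" for n
    have m: "filterlim m at_top sequentially" unfolding m_def
      by (rule filterlim_at_top_mono[OF filterlim_ident]) auto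
    have R: "diff_asymp (\<lambda>n j. F (m n + 2 * j) / (F (m n) * ((pd.peak (m n))\<^sup>2) ^ j)) (\<lambda>i. if i = 0 then 1 else 0)"
      using pd.diff_asymp_moments[OF m] unfolding ratio by (auto simp: m_def)
    show ?thesis
    \<comment> \<open>\<open>r n\<close> is the leading part of the ratio of consecutive \<gamma>:
      the moments grow by about \<open>peak^2\<close> per step, while \<open>G\<close> falls by a
      factor of about \<open>4 n\<close>.\<close>
    proof (rule eventually_hyperbolic[where q = "\<lambda>n. 2 * G n * F (m n)" and r = "\<lambda>n. (pd.peak (m n))\<^sup>2 / (4 * real n)"])
      show "diff_asymp (\<lambda>n j. ?\<gamma> (n + j) / (2 * G n * F (m n) * ((pd.peak (m n))\<^sup>2 / (4 * real n)) ^ j)) hermite0"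
        using diff_asymp_mult[OF diff_asymp_G R]
      proof (rule diff_asymp_cong)
        show "\<forall>\<^sub>F n in sequentially. (\<lambda>j. (4 * real n) ^ j * G (n + j) / G n * (F (m n + 2 * j) / (F (m n) * ((pd.peak (m n))\<^sup>2) ^ j)))
          = (\<lambda>j. ?\<gamma> (n + j) / (2 * G n * F (m n) * ((pd.peak (m n))\<^sup>2 / (4 * real n)) ^ j))"
          using eventually_gt_at_top[of 0]
        proof eventually_elim
          case (elim n)
          have "2 * (n + j) + e = m n + 2 * j" for j by (simp add: m_def)
          then have "?\<gamma> (n + j) = 2 * G (n + j) * F (m n + 2 * j)" for j
            using xi_gamma_no_pole[OF False, of "n + j"] elim by (simp only: add_gr_0 simp_thms)
          then show ?case using elim by (simp add: fun_eq_iff power_divide mult_ac)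
        qed
      qed simp
      show "\<forall>\<^sub>F n in sequentially. 2 * G n * F (m n) \<noteq> 0"
        using eventually_compose_filterlim[OF F_nz m] by eventually_elim (simp add: G_nonzero)
      show "\<forall>\<^sub>F n in sequentially. (pd.peak (m n))\<^sup>2 / (4 * real n) > 0"
        using eventually_gt_at_top[of 0]
      proof eventually_elim
        case (elim n)
        then show ?case using pd.peak[of "m n"] by (simp add: m_def)
      qed
    qed
  next
    case True
    \<comment> \<open>The base index is that of the lower moment, which dominates: it carries a
      factor of order \<open>t^2\<close>, whereas the other moment exceeds it only by a factor of
      about \<open>v\<close>, and \<open>v / m\<close> tends to 0.\<close>
    define m where "m n = 2 * n + e - 2" for n
    define v where "v n = (pd.peak (m n))\<^sup>2" for n
    define t where "t n = real (2 * n + e)" for n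
    have m: "filterlim m at_top sequentially"
      by (rule filterlim_at_top_mono[OF filterlim_ident]) (auto simp: m_def intro!: eventually_mono[OF eventually_ge_at_top[of 2]])
    have le: "\<forall>\<^sub>F n in sequentially. n \<le> m n"
      using eventually_ge_at_top[of 2] by eventually_elim (simp add: m_def)
    define R where "R n j = F (m n + 2 * j) / (F (m n) * v n ^ j)" for n j
    have R: "diff_asymp R (\<lambda>i. if i = 0 then 1 else 0)"
      using pd.diff_asymp_moments[OF m le] unfolding ratio R_def v_def .
    have a1: "diff_asymp (\<lambda>n j. 1 + (2 / t n) * real j) (\<lambda>i. if i = 0 then 1 else 0)"
      by (rule diff_asymp_affine, unfold t_def) real_asymp
    have a2: "diff_asymp (\<lambda>n j. 1 + (2 / (t n - 1)) * real j) (\<lambda>i. if i = 0 then 1 else 0)"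
      by (rule diff_asymp_affine, unfold t_def) real_asymp
    have v: "(\<lambda>n. - \<kappa>\<^sup>2 * (v n / (t n * (t n - 1)))) \<longlonglongrightarrow> 0"
    proof -
      have "(\<lambda>n. v n / real (m n)) \<longlonglongrightarrow> 0"
        using filterlim_compose[OF pd.peak_square m] by (simp add: v_def)
      then have "(\<lambda>n. v n / (t n * (t n - 1))) \<longlonglongrightarrow> 0"
      proof (rule Lim_null_comparison[rotated])
        show "\<forall>\<^sub>F n in sequentially. norm (v n / (t n * (t n - 1))) \<le> v n / real (m n)"
          using eventually_ge_at_top[of 2]
        proof eventually_elim
          case (elim n)
          have "real (m n) = t n - 2" using elim by (simp add: m_def t_def)
          moreover have "t n \<ge> 4" using elim by (simp add: t_def)
          moreover have mono: "(t n - 2) \<le> t n * (t n - 1)"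
          proof -
            have "x - 2 \<le> x * (x - 1)" for x :: real
              using zero_le_power2[of "x - 1"] by (simp add: power2_eq_square algebra_simps)
            then show ?thesis .
          qed
          moreover have "v n \<ge> 0" by (simp add: v_def)
          moreover have "norm (v n / (t n * (t n - 1))) = v n / (t n * (t n - 1))"
            using \<open>t n \<ge> 4\<close> \<open>v n \<ge> 0\<close> by simp
          moreover have "v n / (t n * (t n - 1)) \<le> v n / (t n - 2)"
            using \<open>t n \<ge> 4\<close> by (intro divide_left_mono mono \<open>v n \<ge> 0\<close> mult_pos_pos) simp_all
          ultimately show ?case by (simp only:)
        qed
      qed
      from tendsto_mult_right_zero[OF this] show ?thesis .
    qed
    \<comment> \<open>The affine factors are the normalised
      \<open>(t + 2 j) * (t + 2 j - 1)\<close>. The last summand is a unit shift of \<open>R\<close>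
      with vanishing coefficient, so \<open>W\<close> is the constant 1 to every order and all of
      \<open>hermite0\<close> comes from \<open>G\<close>.\<close>
    define W where "W n j = R n j * (1 + (2 / t n) * real j) * (1 + (2 / (t n - 1)) * real j)
       + (- \<kappa>\<^sup>2 * (v n / (t n * (t n - 1)))) * R n (Suc j)" for n j
    have W: "diff_asymp W (\<lambda>i. if i = 0 then 1 else 0)"
    proof -
      note factors = diff_asymp_mult[OF diff_asymp_mult[OF R a1] a2]
      note pole_term = diff_asymp_cmult[OF diff_asymp_shift[OF R] v]
      show ?thesis
        by (rule diff_asymp_cong[OF diff_asymp_add[OF factors pole_term]]) (simp_all add: W_def fun_eq_iff)
    qed
    show ?thesis
    proof (rule eventually_hyperbolic[where q = "\<lambda>n. 2 * G n * (t n * (t n - 1)) * F (m n)" and r = "\<lambda>n. v n / (4 * real n)"])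
      show "diff_asymp (\<lambda>n j. ?\<gamma> (n + j) / (2 * G n * (t n * (t n - 1)) * F (m n) * (v n / (4 * real n)) ^ j)) hermite0"
        using diff_asymp_mult[OF diff_asymp_G W]
      proof (rule diff_asymp_cong)
        show "\<forall>\<^sub>F n in sequentially. (\<lambda>j. (4 * real n) ^ j * G (n + j) / G n * W n j)
          = (\<lambda>j. ?\<gamma> (n + j) / (2 * G n * (t n * (t n - 1)) * F (m n) * (v n / (4 * real n)) ^ j))"
          using eventually_ge_at_top[of 2] eventually_compose_filterlim[OF F_nz m]
        proof eventually_elim
          case (elim n)
          have t: "t n \<noteq> 0" "t n - 1 \<noteq> 0" using elim by (auto simp: t_def)
          have vn: "v n \<noteq> 0" using pd.peak[of "m n"] elim by (auto simp: v_def m_def)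
          show ?case
          proof
            fix j
            have mj: "2 * (n + j) + e - 2 = m n + 2 * j" "2 * (n + j) + e = m n + 2 * Suc j" "real (m n + 2 * Suc j) = t n + 2 * real j"
              using elim by (auto simp: m_def t_def)
            have \<gamma>: "?\<gamma> (n + j) = 2 * G (n + j) * ((t n + 2 * real j) * (t n + 2 * real j - 1) * F (m n + 2 * j) - \<kappa>\<^sup>2 * F (m n + 2 * Suc j))"
              using xi_gamma_pole[OF True, of "n + j"] elim unfolding mj by simp
            have "W n j = ((t n + 2 * real j) / t n) * ((t n + 2 * real j - 1) / (t n - 1)) * (F (m n + 2 * j) / (F (m n) * v n ^ j))
               - \<kappa>\<^sup>2 / (t n * (t n - 1)) * (F (m n + 2 * Suc j) / (F (m n) * v n ^ j))"
            proof -
              have "1 + (2 / t n) * real j = (t n + 2 * real j) / t n" "1 + (2 / (t n - 1)) * real j = (t n + 2 * real j - 1) / (t n - 1)"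
                using t by (simp_all add: field_simps)
              moreover have "v n * R n (Suc j) = F (m n + 2 * Suc j) / (F (m n) * v n ^ j)"
                using vn by (simp add: R_def)
              moreover have "r * (p / x) * (q / y) + (- l * (z / (x * y))) * r' = (p / x) * (q / y) * r - l / (x * y) * (z * r')"
                for r r' p q x y z l :: real
                by (simp add: divide_inverse mult_ac)
              ultimately show ?thesis unfolding W_def R_def[of n j] by (simp only:)
            qed
            also have "\<dots> = ((t n + 2 * real j) * (t n + 2 * real j - 1) * F (m n + 2 * j) - \<kappa>\<^sup>2 * F (m n + 2 * Suc j)) / (t n * (t n - 1) * F (m n) * v n ^ j)"
            proof -
              have "(p / x) * (q / y) * (X / (f * w)) - l / (x * y) * (Y / (f * w)) = (p * q * X - l * Y) / (x * y * f * w)"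
                for p q x y X Y f w l :: real
                by (simp add: diff_divide_distrib mult_ac)
              then show ?thesis .
            qed
            finally have W: "W n j = \<dots>" .
            show "(4 * real n) ^ j * G (n + j) / G n * W n j = ?\<gamma> (n + j) / (2 * G n * (t n * (t n - 1)) * F (m n) * (v n / (4 * real n)) ^ j)"
            proof -
              have "x * g' / g * (Z / (T * f * w)) = 2 * g' * Z / (2 * g * T * f * (w / x))" for x g g' Z T f w :: real
                by (simp add: mult_ac)
              then show ?thesis unfolding W \<gamma> power_divide .
            qed
          qed
        qed
      qed simp
      show "\<forall>\<^sub>F n in sequentially. 2 * G n * (t n * (t n - 1)) * F (m n) \<noteq> 0"
        using eventually_ge_at_top[of 2] eventually_compose_filterlim[OF F_nz m]
      proof eventually_elim
        case (elim n)
        have "t n \<noteq> 0" "t n - 1 \<noteq> 0" using elim by (simp_all add: t_def)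
        then show ?case using elim(2) G_nonzero[of n] by simp
      qed
      show "\<forall>\<^sub>F n in sequentially. v n / (4 * real n) > 0"
        using eventually_ge_at_top[of 2]
      proof eventually_elim
        case (elim n)
        then show ?case using pd.peak[of "m n"] by (simp add: m_def v_def)
      qed
    qed
  qed
qed

end

theorem theorem1p1:
  fixes a \<alpha> :: "nat \<Rightarrow> complex" and N \<epsilon> k :: real and J M n\<^sub>0 d :: nat
  assumes "good_dirichlet_series a N J M n\<^sub>0 \<alpha> \<epsilon> k"
    and "d \<ge> 1"
  shows "finite {n. \<not> hyperbolic (jensen_poly (xi_gamma N J M a \<epsilon> k) d n)}"
  using good_dirichlet_series.jensen_hyperbolic[OF assms(1), of d]
  by (simp add: cofinite_eq_sequentially[symmetric] eventually_cofinite)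

end
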